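(* Let $d\ge 1$ and let $T_1,\dots,T_d$ be commuting invertible measure preserving transformations of a standard probability space $(X,\mu)$. Let $X^*=X^{2^d}$, let $\mu^*=\mu_{T_1,\dots,T_d}$ be the box measure on $X^*$ associated to $T_1,\dots,T_d$, let $T_1^*,\dots,T_d^*$ be the side transformations of $X^*$ (which commute and preserve $\mu^*$), and let $|\!|\!|\cdot|\!|\!|^*$ be the box seminorm on $L^\infty(\mu^* )$ associated to the system $(X^*,\mu^*,T_1^*,\dots,T_d^* )$. Let $$\mathcal W^*:=\bigvee_{i=1}^d \mathcal I(T_i^* ),$$ where $\mathcal I(T_i^* )$ is the $\sigma$-algebra of sets of $(X^*,\mu^* )$ invariant under $T_i^*$. If $F\in L^\infty(\mu^* )$ is such that $\mathbb E_{\mu^*}(F\mid\mathcal W^* )=0$, then $|\!|\!|F|\!|\!|^*=0$.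
   Context: All functions are measurable and real valued; sets, functions and $\sigma$-algebras are considered modulo null sets. For a measure preserving transformation $S$ of a probability space $(Y,\nu)$, $\mathcal I(S)$ is the $\sigma$-algebra of $S$-invariant sets, and $\nu\times_{\mathcal I(S)}\nu$ is the measure on $Y\times Y$ characterized by $\int f(y)f'(y')\,d(\nu\times_{\mathcal I(S)}\nu)(y,y')=\int \mathbb E_\nu(f\mid\mathcal I(S))\,\mathbb E_\nu(f'\mid\mathcal I(S))\,d\nu$ for all bounded measurable $f,f'$ on $Y$. Points of $X^{2^k}$ are written $x=(x_\epsilon:\epsilon\in\{0,1\}^k)$, and $X^{2^{k+1}}$ is identified with $X^{2^k}\times X^{2^k}$ via $x\mapsto\bigl((x_{\eta 0})_{\eta\in\{0,1\}^k},(x_{\eta1})_{\eta\in\{0,1\}^k}\bigr)$. Box measure: given commuting invertible measure preserving transformations $T_1,\dots,T_d$ of $(X,\mu)$, put $\mu_{T_1}=\mu\times_{\mathcal I(T_1)}\mu$ on $X^2$ and, inductively for $1\le k<d$, $\mu_{T_1,\dots,T_{k+1}}=\mu_{T_1,\dots,T_k}\times_{\mathcal I(T_{k+1}\times\dots\times T_{k+1})}\mu_{T_1,\dots,T_k}$ on $X^{2^{k+1}}$, where $T_{k+1}\times\dots\times T_{k+1}$ ($2^k$ factors) acts diagonally on $X^{2^k}$. Side transformations: for $1\le i\le d$ and $x\in X^*$, $(T_i^*x)_\epsilon=T_ix_\epsilon$ if $\epsilon_i=0$, and $(T_i^*x)_\epsilon=x_\epsilon$ if $\epsilon_i=1$.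 Box seminorm: for $f\in L^\infty(\mu)$, the box seminorm of $f$ associated to the system $(X,\mu,T_1,\dots,T_d)$ is $\bigl(\int\prod_{\epsilon\in\{0,1\}^d}f(x_\epsilon)\,d\mu_{T_1,\dots,T_d}(x)\bigr)^{1/2^d}$ (the integral is nonnegative). The same definition, applied with $(X^*,\mu^*,T_1^*,\dots,T_d^* )$ in place of $(X,\mu,T_1,\dots,T_d)$, gives $|\!|\!|\cdot|\!|\!|^*$. *)

theory Defs
  imports "HOL-Probability.Probability"
begin

section \<open>Standard probability spaces and their automorphisms\<close>

definition standard_prob_space :: "'a measure \<Rightarrow> bool" where
  "standard_prob_space M \<longleftrightarrow> prob_space M \<and>
     (\<exists>X. completely_metrizable_space X \<and> second_countable X \<and> topspace X = space M \<and>
          sets M = sigma_sets (topspace X) {U. openin X U})"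

definition mp_automorphism :: "'a measure \<Rightarrow> ('a \<Rightarrow> 'a) \<Rightarrow> bool" where
  "mp_automorphism M S \<longleftrightarrow> S \<in> measurable M M \<and> distr M M S = M \<and>
     (\<exists>R \<in> measurable M M. \<forall>x \<in> space M. R (S x) = x \<and> S (R x) = x)"

section \<open>Invariant sets and relatively independent squares\<close>

text \<open>
  Sets are taken modulo null sets, so invariance is required almost everywhere. The result is a
  sub-\<open>\<sigma>\<close>-algebra in the form expected by \<^const>\<open>real_cond_exp\<close>, which only looks at its space and
  its measurable sets.
\<close>

definition invariant_algebra :: "'a measure \<Rightarrow> ('a \<Rightarrow> 'a) \<Rightarrow> 'a measure" where
  "invariant_algebra N S =
     sigma (space N) {A \<in> sets N. AE y in N. S y \<in> A \<longleftrightarrow> y \<in> A}"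

definition join_invariant_algebras :: "'a measure \<Rightarrow> (nat \<Rightarrow> 'a \<Rightarrow> 'a) \<Rightarrow> nat \<Rightarrow> 'a measure" where
  "join_invariant_algebras N S d =
     sigma (space N) (\<Union>i<d. sets (invariant_algebra N (S i)))"

definition rel_square :: "'a measure \<Rightarrow> ('a \<Rightarrow> 'a) \<Rightarrow> ('a \<times> 'a) measure" where
  "rel_square N S = (THE P. sets P = sets (N \<Otimes>\<^sub>M N) \<and>
     (\<forall>f \<in> borel_measurable N. \<forall>f' \<in> borel_measurable N.
        bounded (f ` space N) \<longrightarrow> bounded (f' ` space N) \<longrightarrow>
        (\<integral>z. f (fst z) * f' (snd z) \<partial>P) =
        (\<integral>y. real_cond_exp N (invariant_algebra N S) f y *
              real_cond_exp N (invariant_algebra N S) f' y \<partial>N)))"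

section \<open>Box measures and box seminorms\<close>

text \<open>
  An element of \<open>{0,1}\<^sup>k\<close> is a list of \<open>k\<close> Booleans, \<^const>\<open>False\<close> standing for \<open>0\<close> and \<^const>\<open>True\<close>
  for \<open>1\<close>. The space \<open>X\<close> to the power \<open>2\<^sup>k\<close> consists of the extensional functions on \<open>cube k\<close>.
  Numbering starts at 0: the transformations are \<open>T 0, \<dots>, T (d - 1)\<close>, and \<open>T i\<close> belongs to the
  coordinate \<open>\<epsilon> ! i\<close>.
\<close>

definition cube :: "nat \<Rightarrow> bool list set" where
  "cube k = {\<epsilon>. length \<epsilon> = k}"

definition diagonal_map :: "nat \<Rightarrow> ('a \<Rightarrow> 'a) \<Rightarrow> (bool list \<Rightarrow> 'a) \<Rightarrow> (bool list \<Rightarrow> 'a)" where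
  "diagonal_map k S x = (\<lambda>\<epsilon>\<in>cube k. S (x \<epsilon>))"

text \<open>
  The inverse of the identification \<open>x \<mapsto> ((x (\<eta> @ [False]))\<^sub>\<eta>, (x (\<eta> @ [True]))\<^sub>\<eta>)\<close>.
\<close>

definition glue :: "nat \<Rightarrow> (bool list \<Rightarrow> 'a) \<times> (bool list \<Rightarrow> 'a) \<Rightarrow> (bool list \<Rightarrow> 'a)" where
  "glue k z = (\<lambda>\<epsilon>\<in>cube (Suc k). if last \<epsilon> then snd z (butlast \<epsilon>) else fst z (butlast \<epsilon>))"

text \<open>
  The recursion starts from \<open>\<mu>\<close> itself, transported to the functions on the one-point set
  \<open>cube 0 = {[]}\<close>; its first step is therefore the relatively independent square of \<open>\<mu>\<close> over the
  invariant sets of the first transformation.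
\<close>

primrec box_measure :: "'a measure \<Rightarrow> (nat \<Rightarrow> 'a \<Rightarrow> 'a) \<Rightarrow> nat \<Rightarrow> (bool list \<Rightarrow> 'a) measure" where
  "box_measure M T 0 = distr M (PiM (cube 0) (\<lambda>_. M)) (\<lambda>x. \<lambda>\<epsilon>\<in>cube 0. x)"
| "box_measure M T (Suc k) =
     distr (rel_square (box_measure M T k) (diagonal_map k (T k)))
           (PiM (cube (Suc k)) (\<lambda>_. M)) (glue k)"

definition side_map :: "nat \<Rightarrow> (nat \<Rightarrow> 'a \<Rightarrow> 'a) \<Rightarrow> nat \<Rightarrow> (bool list \<Rightarrow> 'a) \<Rightarrow> (bool list \<Rightarrow> 'a)" where
  "side_map d T i x = (\<lambda>\<epsilon>\<in>cube d. if \<epsilon> ! i then x \<epsilon> else T i (x \<epsilon>))"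

definition box_seminorm :: "'a measure \<Rightarrow> (nat \<Rightarrow> 'a \<Rightarrow> 'a) \<Rightarrow> nat \<Rightarrow> ('a \<Rightarrow> real) \<Rightarrow> real" where
  "box_seminorm M T d f =
     root (2 ^ d) (\<integral>x. (\<Prod>\<epsilon>\<in>cube d. f (x \<epsilon>)) \<partial>box_measure M T d)"

end

theory Submission
  imports Defs
begin

text \<open>
  Write \<open>X\<^sup>*\<close> for the cube \<open>X\<close> to the power \<open>2\<^sup>d\<close> with its box measure,
  \<open>x\<^sub>0\<close> for the coordinate of \<open>x\<close> at the vertex \<open>0\<close>, and \<open>W\<close> for the join of the invariant
  algebras of the side transformations. The \<open>2\<^sup>d\<close>-th power of the seminorm of \<open>F\<close> is \<open>\<integral>F D\<close>, where the
  dual function \<open>D\<close> is the conditional expectation of the product of the values of \<open>F\<close> at the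
  vertices other than \<open>0\<close> of the cube over \<open>X\<^sup>*\<close>, given the point at the vertex \<open>0\<close>. The claim therefore follows once \<open>D\<close> is
  \<open>W\<close>-measurable (\<open>dual_function_side_join\<close>), and for this it is enough to compare \<open>D\<close> with its
  conditional expectation on products \<open>f(x\<^sub>0) G(x)\<close>, where \<open>G\<close> is a product of functions of the
  coordinates \<open>x\<^sub>\<epsilon>\<close> with \<open>\<epsilon> \<noteq> 0\<close>. Three facts settle this comparison.

  \<^item> If \<open>\<epsilon>\<^sub>i = 1\<close>, then \<open>x\<^sub>\<epsilon>\<close> does not move under the \<open>i\<close>-th side transformation. So \<open>G\<close> is
    \<open>W\<close>-measurable, and in the cube over \<open>X\<^sup>*\<close> a function of \<open>x\<^sub>\<epsilon>\<close> has the same value at the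
    vertex \<open>0\<close> as at its neighbour in direction \<open>i\<close> (\<open>invariant_function_coordinates\<close>).

  \<^item> The conditional expectation of \<open>f(x\<^sub>0)\<close> given \<open>W\<close> is again a function \<open>f'(x\<^sub>0)\<close>
    (\<open>cond_exp_initial_coordinate\<close>): it is invariant under the transformations of all faces
    \<open>\<epsilon>\<^sub>i = 1\<close>, because these commute with the side transformations and fix \<open>x\<^sub>0\<close>, and only
    functions of \<open>x\<^sub>0\<close> are invariant under all of them (\<open>upper_invariant_function\<close>).

  \<^item> A form \<open>\<integral>\<Prod>F\<^sub>\<epsilon>(x\<^sub>\<epsilon>)\<close> vanishes if the function at the vertex \<open>0\<close> has seminorm \<open>0\<close>
    (\<open>box_form_vanishes\<close>).

  Split \<open>f\<close> into \<open>f'\<close> and \<open>f - f'\<close>. The part \<open>f'(x\<^sub>0) G\<close> is \<open>W\<close>-measurable and gives no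
  difference. The part \<open>f - f'\<close> is orthogonal to \<open>W\<close>, in particular to products of functions of the
  other coordinates, so its seminorm over \<open>X\<close> vanishes; hence so does the seminorm of
  \<open>(f - f')(x\<^sub>0)\<close> over \<open>X\<^sup>*\<close>, because \<open>x \<mapsto> x\<^sub>0\<close> is a factor map. Moving \<open>G\<close> to the neighbours
  of \<open>0\<close> leaves \<open>(f - f')(x\<^sub>0)\<close> alone at that vertex, and the form is \<open>0\<close>.

  Two tools carry these facts. The mean ergodic theorem, obtained from the maximal inequality, gives
  \<open>\<integral>f(u) g(v)\<close> over a relatively independent square as the limit of the averages of
  \<open>\<integral>f (g \<circ> S\<^sup>n)\<close>. Consequently forms of level \<open>k + 1\<close> are limits of averages of forms of level
  \<open>k\<close>, which permits induction on \<open>k\<close> without exchanging the order of the transformations. Secondly,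
  the relatively independent squares have to exist: their values on rectangles are prescribed, and
  countable additivity follows from the approximation of measurable sets by compact and open ones, a
  property that passes from \<open>X\<close> to the cubes because it only depends on the marginals.
\<close>

section \<open>Bounded measurable functions and conditional expectation\<close>

definition bounded_borel :: "'a measure \<Rightarrow> ('a \<Rightarrow> real) set" where
  "bounded_borel N = {f \<in> borel_measurable N. \<exists>C. \<forall>x\<in>space N. \<bar>f x\<bar> \<le> C}"

lemma bounded_borelI:
  "f \<in> borel_measurable N \<Longrightarrow> (\<And>x. x \<in> space N \<Longrightarrow> \<bar>f x\<bar> \<le> C) \<Longrightarrow> f \<in> bounded_borel N"
  unfolding bounded_borel_def by blast

lemma bounded_borel_measurable:
  "f \<in> bounded_borel N \<Longrightarrow> f \<in> borel_measurable N"
  unfolding bounded_borel_def by blast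

lemma bounded_borelE:
  assumes "f \<in> bounded_borel N"
  obtains C where "0 < C" "\<And>x. x \<in> space N \<Longrightarrow> \<bar>f x\<bar> \<le> C"
proof -
  obtain C where "\<forall>x\<in>space N. \<bar>f x\<bar> \<le> C"
    using assms unfolding bounded_borel_def by blast
  then have "\<bar>f x\<bar> \<le> max C 1" if "x \<in> space N" for x
    using that by (metis max.coboundedI1)
  then show thesis
    using that[of "max C 1"] by auto
qed

lemma bounded_borel_iff: "f \<in> bounded_borel N \<longleftrightarrow> f \<in> borel_measurable N \<and> bounded (f ` space N)"
  unfolding bounded_borel_def bounded_iff by auto

lemma bounded_borel_const [simp, intro]: "(\<lambda>_. c) \<in> bounded_borel N"
  by (rule bounded_borelI[where C = "\<bar>c\<bar>"]) auto

lemma bounded_borel_indicator [simp, intro]: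
  "A \<in> sets N \<Longrightarrow> (indicator A :: _ \<Rightarrow> real) \<in> bounded_borel N"
  by (rule bounded_borelI[where C = 1]) (auto split: split_indicator)

lemma bounded_borel_mult:
  assumes "f \<in> bounded_borel N" "g \<in> bounded_borel N"
  shows "(\<lambda>x. f x * g x) \<in> bounded_borel N"
proof -
  obtain C where C: "0 < C" "\<And>x. x \<in> space N \<Longrightarrow> \<bar>f x\<bar> \<le> C"
    using assms(1) by (rule bounded_borelE) (rule that)
  obtain D where D: "0 < D" "\<And>x. x \<in> space N \<Longrightarrow> \<bar>g x\<bar> \<le> D"
    using assms(2) by (rule bounded_borelE) (rule that)
  show ?thesis
  proof (rule bounded_borelI[where C = "C * D"])
    show "(\<lambda>x. f x * g x) \<in> borel_measurable N"
      using assms[THEN bounded_borel_measurable] by simp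
    show "\<bar>f x * g x\<bar> \<le> C * D" if "x \<in> space N" for x
      unfolding abs_mult using C D that by (intro mult_mono) auto
  qed
qed

lemma bounded_borel_add:
  assumes "f \<in> bounded_borel N" "g \<in> bounded_borel N"
  shows "(\<lambda>x. f x + g x) \<in> bounded_borel N"
proof -
  obtain C where C: "0 < C" "\<And>x. x \<in> space N \<Longrightarrow> \<bar>f x\<bar> \<le> C"
    using assms(1) by (rule bounded_borelE) (rule that)
  obtain D where D: "0 < D" "\<And>x. x \<in> space N \<Longrightarrow> \<bar>g x\<bar> \<le> D"
    using assms(2) by (rule bounded_borelE) (rule that)
  show ?thesis
  proof (rule bounded_borelI[where C = "C + D"])
    show "(\<lambda>x. f x + g x) \<in> borel_measurable N"
      using assms[THEN bounded_borel_measurable] by simp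
    show "\<bar>f x + g x\<bar> \<le> C + D" if "x \<in> space N" for x
      using C(2)[OF that] D(2)[OF that] by linarith
  qed
qed

lemma bounded_borel_diff:
  assumes "f \<in> bounded_borel N" "g \<in> bounded_borel N"
  shows "(\<lambda>x. f x - g x) \<in> bounded_borel N"
  using bounded_borel_add[OF assms(1) bounded_borel_mult[OF bounded_borel_const[of "-1"] assms(2)]]
  by simp

lemma bounded_borel_prod:
  "(\<And>i. i \<in> I \<Longrightarrow> f i \<in> bounded_borel N) \<Longrightarrow> (\<lambda>x. \<Prod>i\<in>I. f i x) \<in> bounded_borel N"
  by (induction I rule: infinite_finite_induct) (auto intro: bounded_borel_mult bounded_borel_add)

lemma bounded_borel_sum:
  "(\<And>i. i \<in> I \<Longrightarrow> f i \<in> bounded_borel N) \<Longrightarrow> (\<lambda>x. \<Sum>i\<in>I. f i x) \<in> bounded_borel N"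
  by (induction I rule: infinite_finite_induct) (auto intro: bounded_borel_mult bounded_borel_add)

lemma bounded_borel_comp:
  assumes "f \<in> bounded_borel M" "g \<in> measurable N M"
  shows "(\<lambda>x. f (g x)) \<in> bounded_borel N"
proof -
  obtain C where C: "\<And>x. x \<in> space M \<Longrightarrow> \<bar>f x\<bar> \<le> C"
    using assms(1) by (rule bounded_borelE) blast
  show ?thesis
    using C measurable_space[OF assms(2)]
      measurable_compose[OF assms(2) bounded_borel_measurable[OF assms(1)]]
    by (intro bounded_borelI[where C = C]) auto
qed

lemmas bounded_borel_closure =
  bounded_borel_const bounded_borel_indicator bounded_borel_mult bounded_borel_add
  bounded_borel_diff bounded_borel_prod bounded_borel_sum

lemma (in finite_measure) integrable_bounded_borel [simp, intro]:
  assumes "f \<in> bounded_borel M"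
  shows "integrable M f"
proof -
  obtain C where "\<And>x. x \<in> space M \<Longrightarrow> \<bar>f x\<bar> \<le> C"
    using assms by (rule bounded_borelE) blast
  then show ?thesis
    using bounded_borel_measurable[OF assms] by (intro integrable_const_bound[where B = C]) simp_all
qed

text \<open>
  Conditional expectations are determined up to null sets only; clipping produces a version that is
  bounded everywhere, so that bounded functions can be used throughout.
\<close>

lemma bounded_cond_exp_version:
  assumes "prob_space N" "subalgebra N J" "f \<in> bounded_borel N"
  obtains g where "g \<in> borel_measurable J" "g \<in> bounded_borel N"
    "AE x in N. real_cond_exp N J f x = g x"
    "\<And>h. h \<in> borel_measurable J \<Longrightarrow> h \<in> bounded_borel N \<Longrightarrow>
       (\<integral>x. f x * h x \<partial>N) = (\<integral>x. g x * h x \<partial>N)"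
proof -
  interpret prob_space N by fact
  interpret finite_measure_subalgebra N J by standard fact
  obtain C where C: "\<And>x. x \<in> space N \<Longrightarrow> \<bar>f x\<bar> \<le> C"
    using assms(3) by (rule bounded_borelE) blast
  have int: "integrable N f" using assms(3) by simp
  define g where "g = (\<lambda>x. max (-C) (min C (real_cond_exp N J f x)))"
  have J: "space J = space N" using assms(2) by (simp add: subalgebra_def)
  have gJ: "g \<in> borel_measurable J" unfolding g_def by measurable
  then have gN: "g \<in> borel_measurable N" by (rule measurable_from_subalg[OF assms(2)])
  have 1: "AE x in N. real_cond_exp N J f x \<le> C"
    by (rule real_cond_exp_le_c[OF int]) (use C in \<open>auto simp: abs_le_iff\<close>)
  have 2: "AE x in N. real_cond_exp N J f x \<ge> - C"
    by (rule real_cond_exp_ge_c[OF int]) (use C in \<open>force simp: abs_le_iff\<close>)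
  have eq: "AE x in N. real_cond_exp N J f x = g x"
    using 1 2 by eventually_elim (auto simp: g_def)
  have bb: "g \<in> bounded_borel N"
    by (rule bounded_borelI[OF gN, where C = "\<bar>C\<bar>"]) (auto simp: g_def)
  show thesis
  proof (rule that[OF gJ bb eq])
    fix h assume h: "h \<in> borel_measurable J" "h \<in> bounded_borel N"
    have "(\<integral>x. h x * f x \<partial>N) = (\<integral>x. h x * real_cond_exp N J f x \<partial>N)"
      using h(1) bounded_borel_measurable[OF assms(3)] bounded_borel_mult[OF h(2) assms(3)]
      by (intro real_cond_exp_intg(2)[symmetric]) auto
    also have "\<dots> = (\<integral>x. g x * h x \<partial>N)"
      using eq bounded_borel_measurable[OF h(2)] gN
      by (intro integral_cong_AE) (auto simp: mult.commute)
    finally show "(\<integral>x. f x * h x \<partial>N) = (\<integral>x. g x * h x \<partial>N)"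
      by (simp add: mult.commute)
  qed
qed

lemma AE_zero_of_square_integral:
  assumes "prob_space N" "f \<in> bounded_borel N" "(\<integral>x. f x * f x \<partial>N) = 0"
  shows "AE x in N. f x = 0"
proof -
  interpret prob_space N by fact
  have "AE x in N. f x * f x = 0"
    using assms integral_nonneg_eq_0_iff_AE[of N "\<lambda>x. f x * f x"] bounded_borel_mult[OF assms(2) assms(2)]
    by simp
  then show ?thesis by simp
qed

text \<open>
  A bounded function is determined by its integrals over a generating \<open>\<pi>\<close>-system: after adding a
  constant it becomes the density of a measure.
\<close>

lemma AE_zero_on_generator:
  assumes "prob_space N" "g \<in> bounded_borel N"
    and G: "Int_stable G" "G \<subseteq> Pow (space N)" "space N \<in> G" "sets N = sigma_sets (space N) G"
    and zero: "\<And>A. A \<in> G \<Longrightarrow> (\<integral>x. g x * indicator A x \<partial>N) = 0"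
  shows "AE x in N. g x = 0"
proof -
  interpret prob_space N by fact
  obtain C where C: "0 < C" "\<And>x. x \<in> space N \<Longrightarrow> \<bar>g x\<bar> \<le> C"
    using assms(2) by (rule bounded_borelE) (rule that)
  have [measurable]: "g \<in> borel_measurable N" using assms(2) by (rule bounded_borel_measurable)
  have pos: "0 \<le> g x + C" if "x \<in> space N" for x using C(2)[OF that] by linarith
  have em: "emeasure (density N (\<lambda>x. ennreal (g x + C))) A = ennreal (\<integral>x. (g x + C) * indicator A x \<partial>N)"
    if "A \<in> sets N" for A
  proof -
    have "emeasure (density N (\<lambda>x. ennreal (g x + C))) A
        = (\<integral>\<^sup>+x. ennreal ((g x + C) * indicator A x) \<partial>N)"
      using that by (subst emeasure_density) (auto intro!: nn_integral_cong split: split_indicator)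
    also have "\<dots> = ennreal (\<integral>x. (g x + C) * indicator A x \<partial>N)"
      using that pos assms(2)
      by (intro nn_integral_eq_integral integrable_bounded_borel bounded_borel_mult bounded_borel_add) auto
    finally show ?thesis .
  qed
  have em': "emeasure (density N (\<lambda>x. ennreal C)) A = ennreal (\<integral>x. C * indicator A x \<partial>N)"
    if "A \<in> sets N" for A
    using that C(1) by (simp add: emeasure_density nn_integral_cmult_indicator emeasure_eq_measure ennreal_mult)
  have GN: "G \<subseteq> sets N" using G by auto
  have "density N (\<lambda>x. ennreal (g x + C)) = density N (\<lambda>x. ennreal C)"
  proof (rule measure_eqI_generator_eq[OF G(1,2), where A = "\<lambda>_. space N"])
    fix A assume A: "A \<in> G"
    then have AN: "A \<in> sets N" using GN by auto
    have "(\<integral>x. (g x + C) * indicator A x \<partial>N)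
        = (\<integral>x. g x * indicator A x + C * indicator A x \<partial>N)"
      by (simp add: distrib_right)
    also have "\<dots> = (\<integral>x. C * indicator A x \<partial>N)"
      using A AN zero[OF A] assms(2)
      by (subst Bochner_Integration.integral_add)
         (auto intro!: integrable_bounded_borel bounded_borel_closure)
    finally show "emeasure (density N (\<lambda>x. ennreal (g x + C))) A = emeasure (density N (\<lambda>x. ennreal C)) A"
      using em em' AN by simp
  next
    show "emeasure (density N (\<lambda>x. ennreal (g x + C))) (space N) \<noteq> \<infinity>" using em by simp
  qed (use G in auto)
  then have "AE x in N. ennreal (g x + C) = ennreal C"
    by (subst (asm) density_unique_iff) simp_all
  moreover have "AE x in N. 0 \<le> g x + C" using pos by auto
  ultimately show ?thesis
    by eventually_elim (use C(1) in simp)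
qed

section \<open>Invariant sets and the ergodic theorem\<close>

definition measure_preserving :: "'a measure \<Rightarrow> ('a \<Rightarrow> 'a) \<Rightarrow> bool" where
  "measure_preserving N S \<longleftrightarrow> S \<in> measurable N N \<and> distr N N S = N"

lemma measure_preserving_measurable:
  "measure_preserving N S \<Longrightarrow> S \<in> measurable N N"
  by (simp add: measure_preserving_def)

lemma measure_preserving_integral:
  assumes "measure_preserving N S" "f \<in> borel_measurable N"
  shows "(\<integral>x. f (S x) \<partial>N) = (\<integral>x. (f x :: real) \<partial>N)"
  using assms integral_distr[of S N N f] by (simp add: measure_preserving_def)

lemma AE_along_map:
  assumes "\<pi> \<in> measurable P N" "distr P N \<pi> = N" "AE x in N. Q x"
  shows "AE z in P. Q (\<pi> z)"
proof -
  have "AE x in distr P N \<pi>. Q x" unfolding assms(2) by fact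
  then show ?thesis by (rule AE_distrD[OF assms(1)])
qed

lemma measure_preserving_AE:
  assumes "measure_preserving N S" "AE x in N. P x"
  shows "AE x in N. P (S x)"
  using assms(1) by (intro AE_along_map[OF _ _ assms(2)]) (simp_all add: measure_preserving_def)

lemma measure_preserving_funpow:
  assumes "measure_preserving N S"
  shows "measure_preserving N (S ^^ n)"
proof (induction n)
  case 0
  then show ?case by (simp add: measure_preserving_def distr_id)
next
  case (Suc n)
  have S: "S \<in> measurable N N" using assms by (simp add: measure_preserving_def)
  from Suc have "distr N N (S \<circ> S ^^ n) = distr (distr N N (S ^^ n)) N S"
    using assms by (subst distr_distr) (auto simp: measure_preserving_def)
  then show ?case
    using assms Suc S by (auto simp: measure_preserving_def simp del: o_apply intro: measurable_comp)
qed

lemma funpow_in_space: "S \<in> measurable N N \<Longrightarrow> x \<in> space N \<Longrightarrow> (S ^^ n) x \<in> space N"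
  by (induction n) (auto dest: measurable_space)

lemma sets_invariant_algebra:
  assumes [measurable]: "S \<in> measurable N N"
  shows "sets (invariant_algebra N S) = {A \<in> sets N. AE y in N. S y \<in> A \<longleftrightarrow> y \<in> A}" (is "_ = ?I")
proof -
  have "sigma_algebra (space N) ?I"
    unfolding sigma_algebra_iff2
  proof (intro conjI ballI allI impI)
    show "?I \<subseteq> Pow (space N)" by (auto dest: sets.sets_into_space)
    show "{} \<in> ?I" by simp
  next
    fix A assume A: "A \<in> ?I"
    then have "AE y in N. S y \<in> A \<longleftrightarrow> y \<in> A" by simp
    then have "AE y in N. S y \<in> space N - A \<longleftrightarrow> y \<in> space N - A"
      using AE_space by eventually_elim (use measurable_space[OF assms] in auto)
    then show "space N - A \<in> ?I" using A by auto
  next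
    fix A :: "nat \<Rightarrow> 'a set" assume A: "range A \<subseteq> ?I"
    have "AE y in N. \<forall>i. S y \<in> A i \<longleftrightarrow> y \<in> A i" using A by (subst AE_all_countable) auto
    then have "AE y in N. S y \<in> \<Union> (range A) \<longleftrightarrow> y \<in> \<Union> (range A)"
      by eventually_elim auto
    then show "\<Union> (range A) \<in> ?I" using A by auto
  qed
  then show ?thesis
    unfolding invariant_algebra_def
    using sigma_algebra.sigma_sets_eq by (subst sets_measure_of) (auto dest: sets.sets_into_space)
qed

lemma space_invariant_algebra [simp]: "space (invariant_algebra N S) = space N"
  unfolding invariant_algebra_def by (rule space_measure_of) (auto dest: sets.sets_into_space)

lemma subalgebra_invariant_algebra: "S \<in> measurable N N \<Longrightarrow> subalgebra N (invariant_algebra N S)"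
  unfolding subalgebra_def by (auto simp: sets_invariant_algebra)

lemma invariant_measurable_iff:
  fixes f :: "'a \<Rightarrow> real"
  assumes [measurable]: "S \<in> measurable N N" "f \<in> borel_measurable N"
  shows "f \<in> borel_measurable (invariant_algebra N S) \<longleftrightarrow> (AE x in N. f (S x) = f x)"
proof
  assume f: "f \<in> borel_measurable (invariant_algebra N S)"
  have "AE x in N. \<forall>q\<in>\<rat>. f (S x) < q \<longleftrightarrow> f x < q"
  proof (subst AE_ball_countable[OF countable_rat], rule ballI)
    fix q :: real
    have "{x \<in> space N. f x < q} \<in> sets (invariant_algebra N S)"
      using f by (simp add: borel_measurable_iff_less)
    then have "AE x in N. S x \<in> {x \<in> space N. f x < q} \<longleftrightarrow> x \<in> {x \<in> space N. f x < q}"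
      by (simp add: sets_invariant_algebra)
    then show "AE x in N. f (S x) < q \<longleftrightarrow> f x < q"
      using AE_space by eventually_elim (use measurable_space[OF assms(1)] in auto)
  qed
  then show "AE x in N. f (S x) = f x"
  proof eventually_elim
    case (elim x)
    show ?case
    proof (rule ccontr)
      assume "f (S x) \<noteq> f x"
      then consider "f (S x) < f x" | "f x < f (S x)" by linarith
      then show False
        by cases (use elim Rats_dense_in_real in \<open>metis less_irrefl less_trans\<close>)+
    qed
  qed
next
  assume inv: "AE x in N. f (S x) = f x"
  show "f \<in> borel_measurable (invariant_algebra N S)"
  proof (rule measurableI)
    fix A :: "real set" assume [measurable]: "A \<in> sets borel"
    have "AE x in N. S x \<in> f -` A \<inter> space N \<longleftrightarrow> x \<in> f -` A \<inter> space N"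
      using inv AE_space by eventually_elim (use measurable_space[OF assms(1)] in auto)
    then show "f -` A \<inter> space (invariant_algebra N S) \<in> sets (invariant_algebra N S)"
      by (simp add: sets_invariant_algebra)
  qed simp
qed

text \<open>
  Garsia's argument: the maximum \<open>m n\<close> of the first \<open>n\<close> partial sums satisfies
  \<open>m n \<le> h + m n \<circ> S\<close> where it is positive, and integrating this inequality cancels \<open>m n\<close>.
\<close>

lemma maximal_ergodic_inequality:
  assumes "prob_space N" and S: "measure_preserving N S" and h: "h \<in> bounded_borel N"
  shows "0 \<le> (\<integral>x. h x * indicator {x \<in> space N. \<exists>n. 0 < (\<Sum>k<n. h ((S ^^ k) x))} x \<partial>N)"
proof -
  interpret prob_space N by fact
  define s where "s n x = (\<Sum>k<n. h ((S ^^ k) x))" for n x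
  define m where "m = rec_nat (\<lambda>_. 0) (\<lambda>_ r x. max 0 (h x + r (S x)))"
  have m0: "m 0 x = 0" and mSuc: "m (Suc n) x = max 0 (h x + m n (S x))" for n x
    by (simp_all add: m_def)
  have [measurable]: "S \<in> measurable N N" "h \<in> borel_measurable N"
    using S h by (auto intro: measure_preserving_measurable bounded_borel_measurable)
  have sSuc: "s (Suc n) x = h x + s n (S x)" for n x
    unfolding s_def by (subst sum.lessThan_Suc_shift) (simp add: funpow_swap1)
  have upper: "j \<le> n \<Longrightarrow> s j x \<le> m n x" for j n x
  proof (induction n arbitrary: j x)
    case (Suc n)
    show ?case
    proof (cases j)
      case 0
      then show ?thesis by (simp add: s_def mSuc)
    next
      case (Suc i)
      then show ?thesis using Suc.prems Suc.IH[of i "S x"] by (simp add: mSuc sSuc max_def)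
    qed
  qed (simp add: s_def m0)
  have attained: "\<exists>j\<le>n. m n x = s j x" for n x
  proof (induction n arbitrary: x)
    case (Suc n)
    obtain j where "j \<le> n" "m n (S x) = s j (S x)" using Suc by blast
    then have "m (Suc n) x = s 0 x \<or> m (Suc n) x = s (Suc j) x"
      by (auto simp: mSuc sSuc max_def s_def[of 0])
    then show ?case using \<open>j \<le> n\<close> by (metis Suc_le_mono le0)
  qed (simp add: s_def m0)
  have incr: "m n x \<le> m (Suc n) x" for n x
    using attained[of n x] upper by (metis le_SucI)
  have nonneg: "0 \<le> m n x" for n x using upper[of 0 n x] by (simp add: s_def)
  have m_bb: "m n \<in> bounded_borel N" for n
  proof (induction n)
    case 0
    then show ?case using bounded_borel_const[of 0 N] by (simp add: m_def)
  next
    case (Suc n)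
    let ?g = "\<lambda>x. h x + m n (S x)"
    have g: "?g \<in> bounded_borel N" by (intro bounded_borel_add h bounded_borel_comp[OF Suc]) simp
    then obtain C where "0 < C" "\<And>x. x \<in> space N \<Longrightarrow> \<bar>?g x\<bar> \<le> C" by (rule bounded_borelE) (rule that)
    then have "(\<lambda>x. max 0 (?g x)) \<in> bounded_borel N"
      using bounded_borel_measurable[OF g]
      by (intro bounded_borelI[where C = C] borel_measurable_max) (auto simp: abs_le_iff max_def)
    then show ?case by (simp add: mSuc[abs_def])
  qed
  have [measurable]: "m n \<in> borel_measurable N" for n
    using m_bb by (rule bounded_borel_measurable)
  define A where "A n = {x \<in> space N. 0 < m n x}" for n
  have [measurable]: "A n \<in> sets N" for n unfolding A_def by measurable
  have step: "0 \<le> (\<integral>x. h x * indicator (A (Suc n)) x \<partial>N)" for n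
  proof -
    have "0 = (\<integral>x. m (Suc n) x - m (Suc n) (S x) \<partial>N)"
      using m_bb[of "Suc n"] measure_preserving_integral[OF S, of "m (Suc n)"]
      by (subst Bochner_Integration.integral_diff) (auto intro!: integrable_bounded_borel bounded_borel_comp[OF m_bb])
    also have "\<dots> \<le> (\<integral>x. h x * indicator (A (Suc n)) x \<partial>N)"
    proof (rule integral_mono)
      show "m (Suc n) x - m (Suc n) (S x) \<le> h x * indicator (A (Suc n)) x" if "x \<in> space N" for x
        using that nonneg[of "Suc n" x] nonneg[of "Suc n" "S x"] incr[of n "S x"]
        by (auto simp: A_def mSuc[of n x] indicator_def max_def not_less split: if_splits)
    qed (auto intro!: integrable_bounded_borel bounded_borel_closure h m_bb bounded_borel_comp[OF m_bb])
    finally show ?thesis .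
  qed
  have lim: "(\<lambda>n. \<integral>x. h x * indicator (A (Suc n)) x \<partial>N)
      \<longlonglongrightarrow> (\<integral>x. h x * indicator (\<Union>n. A n) x \<partial>N)"
  proof (rule integral_dominated_convergence[where w = "\<lambda>x. \<bar>h x\<bar>"])
    show "AE x in N. (\<lambda>n. h x * indicator (A (Suc n)) x) \<longlonglongrightarrow> h x * indicator (\<Union>n. A n) x"
    proof (rule AE_I2, rule tendsto_mult[OF tendsto_const])
      fix x
      have "incseq A" using incr by (intro incseq_SucI) (force simp: A_def intro: less_le_trans)
      then show "(\<lambda>n. indicator (A (Suc n)) x :: real) \<longlonglongrightarrow> indicator (\<Union>n. A n) x"
        by (intro LIMSEQ_Suc LIMSEQ_indicator_incseq)
    qed
  qed (use integrable_bounded_borel[OF h] in \<open>auto split: split_indicator\<close>)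
  have "(\<Union>n. A n) = {x \<in> space N. \<exists>n. 0 < s n x}"
  proof safe
    fix x n assume "x \<in> A n"
    then show "x \<in> space N" "\<exists>n. 0 < s n x" using attained[of n x] by (auto simp: A_def)
  next
    fix x n assume "x \<in> space N" "0 < s n x"
    then have "x \<in> A n" using less_le_trans[of 0 "s n x" "m n x"] upper[of n n x] by (simp add: A_def)
    then show "x \<in> (\<Union>n. A n)" by blast
  qed
  then show ?thesis
    using LIMSEQ_le_const[OF lim, of 0] step by (simp add: s_def)
qed

text \<open>
  A bounded change of the partial sums affects the growth rate along a subsequence by less than any
  prescribed amount.
\<close>

lemma frequently_invariant:
  fixes s :: "nat \<Rightarrow> 'a \<Rightarrow> real" and e r K :: real
  assumes "\<And>n. \<bar>s n y - s n x\<bar> \<le> K" "0 < r" "\<exists>\<^sub>F n in sequentially. (e + r) * n < s n x"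
  shows "\<exists>\<^sub>F n in sequentially. (e + r / 2) * n < s n y"
proof -
  have "filterlim (\<lambda>n. (r / 2) * real n) at_top sequentially"
    using \<open>0 < r\<close> by (intro filterlim_tendsto_pos_mult_at_top[OF tendsto_const] filterlim_real_sequentially) simp
  then have ev: "\<forall>\<^sub>F n in sequentially. K < (r / 2) * real n"
    by (simp add: filterlim_at_top_dense)
  show ?thesis
    using frequently_eventually_frequently[OF assms(3) ev]
  proof (rule frequently_elim1)
    fix n assume "(e + r) * real n < s n x \<and> K < r / 2 * real n"
    then show "(e + r / 2) * real n < s n y"
      using assms(1)[of n] by (simp add: field_simps abs_le_iff)
  qed
qed

text \<open>
  The set where the ergodic averages exceed \<open>e\<close> infinitely often is invariant, so the maximal
  inequality can be applied to \<open>h - e\<close> on that set; there it says that the set is null.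
\<close>

lemma ergodic_averages_upper:
  fixes e :: real
  assumes "prob_space N" and S: "measure_preserving N S" and h: "h \<in> bounded_borel N"
    and zero: "\<And>A. A \<in> sets (invariant_algebra N S) \<Longrightarrow> (\<integral>x. h x * indicator A x \<partial>N) = 0"
    and "0 < e"
  shows "AE x in N. \<forall>\<^sub>F n in sequentially. (\<Sum>k<n. h ((S ^^ k) x)) \<le> e * n"
proof -
  interpret prob_space N by fact
  define s where "s n x = (\<Sum>k<n. h ((S ^^ k) x))" for n x
  have S' [measurable]: "S \<in> measurable N N" and [measurable]: "h \<in> borel_measurable N"
    using S h by (auto intro: measure_preserving_measurable bounded_borel_measurable)
  obtain C where C: "0 < C" "\<And>x. x \<in> space N \<Longrightarrow> \<bar>h x\<bar> \<le> C"
    using h by (rule bounded_borelE) (rule that)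
  have [measurable]: "(S ^^ n) \<in> measurable N N" for n
    using measure_preserving_funpow[OF S] by (rule measure_preserving_measurable)
  have [measurable]: "s n \<in> borel_measurable N" for n unfolding s_def by measurable
  \<comment> \<open>The strict margin \<open>1 / Suc m\<close> absorbs the bounded error in the passage from \<open>x\<close> to \<open>S x\<close>.\<close>
  define A where "A = {x \<in> space N. \<exists>m. \<exists>\<^sub>F n in sequentially. (e / 2 + 1 / Suc m) * n < s n x}"
  have A [measurable]: "A \<in> sets N"
    unfolding A_def frequently_sequentially by measurable
  have close: "\<bar>s n (S x) - s n x\<bar> \<le> 2 * C" if "x \<in> space N" for n x
  proof -
    have "s n (S x) - s n x = (\<Sum>k<n. h ((S ^^ Suc k) x) - h ((S ^^ k) x))"
      by (simp add: s_def sum_subtractf funpow_swap1)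
    also have "\<dots> = h ((S ^^ n) x) - h x"
      using sum_lessThan_telescope[of "\<lambda>k. h ((S ^^ k) x)" n] by simp
    finally show ?thesis
      using C(2)[OF that] C(2)[OF funpow_in_space[OF S' that, of n]] by linarith
  qed
  have A_inv: "S x \<in> A \<longleftrightarrow> x \<in> A" if x: "x \<in> space N" for x
  proof -
    have half: "1 / real (Suc m) / 2 \<ge> 1 / Suc (2 * m + 1)" for m by (simp add: field_simps)
    have shrink: "\<exists>\<^sub>F n in sequentially. (e / 2 + 1 / Suc (2 * m + 1)) * n < s n z"
      if "\<exists>\<^sub>F n in sequentially. (e / 2 + 1 / real (Suc m) / 2) * n < s n z" for z m
      using that
    proof (rule frequently_elim1)
      fix n assume "(e / 2 + 1 / real (Suc m) / 2) * real n < s n z"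
      moreover have "(e / 2 + 1 / Suc (2 * m + 1)) * real n \<le> (e / 2 + 1 / real (Suc m) / 2) * real n"
        using half by (intro mult_right_mono add_left_mono) auto
      ultimately show "(e / 2 + 1 / Suc (2 * m + 1)) * real n < s n z" by linarith
    qed
    have "\<bar>s n x - s n (S x)\<bar> \<le> 2 * C" for n using close[OF x, of n] by linarith
    then have "\<exists>\<^sub>F n in sequentially. (e / 2 + 1 / Suc (2 * m + 1)) * n < s n x"
      if "\<exists>\<^sub>F n in sequentially. (e / 2 + 1 / Suc m) * n < s n (S x)" for m
      using that by (intro shrink frequently_invariant[where x = "S x" and s = s]) auto
    moreover have "\<exists>\<^sub>F n in sequentially. (e / 2 + 1 / Suc (2 * m + 1)) * n < s n (S x)"
      if "\<exists>\<^sub>F n in sequentially. (e / 2 + 1 / Suc m) * n < s n x" for m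
      using that close[OF x] by (intro shrink frequently_invariant[where x = x and s = s]) auto
    ultimately show ?thesis
      using x measurable_space[OF S' x] unfolding A_def by blast
  qed
  have A_inv_pow: "(S ^^ k) x \<in> A \<longleftrightarrow> x \<in> A" if "x \<in> space N" for k x
    by (induction k) (use A_inv funpow_in_space[OF S' that] in auto)
  define h' where "h' = (\<lambda>x. (h x - e / 2) * indicator A x)"
  have h': "h' \<in> bounded_borel N" unfolding h'_def by (intro bounded_borel_closure h A)
  have sum_h': "(\<Sum>k<n. h' ((S ^^ k) x)) = (s n x - e / 2 * n) * indicator A x" if "x \<in> space N" for n x
    using A_inv_pow[OF that] by (simp add: h'_def s_def sum_subtractf indicator_def)
  have "{x \<in> space N. \<exists>n. 0 < (\<Sum>k<n. h' ((S ^^ k) x))} = A"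
  proof safe
    fix x n assume "x \<in> space N" "0 < (\<Sum>k<n. h' ((S ^^ k) x))"
    then show "x \<in> A" by (cases "x \<in> A") (auto simp: sum_h')
  next
    fix x assume x: "x \<in> A"
    then show xN: "x \<in> space N" by (simp add: A_def)
    obtain m n where n: "(e / 2 + 1 / Suc m) * real n < s n x"
      using x unfolding A_def by (auto dest: frequently_ex)
    have "e / 2 * n \<le> (e / 2 + 1 / Suc m) * n" by (simp add: algebra_simps)
    then have "e / 2 * n < s n x" using n by linarith
    then show "\<exists>n. 0 < (\<Sum>k<n. h' ((S ^^ k) x))"
      using x xN by (intro exI[of _ n]) (simp add: sum_h')
  qed
  then have "0 \<le> (\<integral>x. h' x * indicator A x \<partial>N)"
    using maximal_ergodic_inequality[OF assms(1) S h'] by simp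
  also have "\<dots> = (\<integral>x. h x * indicator A x - e / 2 * indicator A x \<partial>N)"
    by (intro Bochner_Integration.integral_cong) (auto simp: h'_def indicator_def)
  also have "\<dots> = (\<integral>x. h x * indicator A x \<partial>N) - e / 2 * measure N A"
    by (subst Bochner_Integration.integral_diff)
       (auto intro!: integrable_bounded_borel bounded_borel_closure h)
  also have "(\<integral>x. h x * indicator A x \<partial>N) = 0"
    by (rule zero) (use A A_inv in \<open>auto simp: sets_invariant_algebra\<close>)
  finally have "measure N A = 0"
    using \<open>0 < e\<close> measure_nonneg[of N A] by (simp add: mult_le_0_iff)
  then have "AE x in N. x \<notin> A"
    by (intro AE_not_in) (simp add: null_sets_def emeasure_eq_measure)
  then show ?thesis
    using AE_space
  proof eventually_elim
    case (elim x)
    obtain m where m: "1 / real (Suc m) < e / 2"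
      using \<open>0 < e\<close> nat_approx_posE[of "e / 2"] by auto
    have "\<forall>\<^sub>F n in sequentially. s n x \<le> (e / 2 + 1 / Suc m) * n"
      using elim by (auto simp: A_def not_frequently not_less)
    then show "\<forall>\<^sub>F n in sequentially. (\<Sum>k<n. h ((S ^^ k) x)) \<le> e * n"
    proof eventually_elim
      case (elim n)
      have "(e / 2 + 1 / Suc m) * real n \<le> e * n"
        using m by (intro mult_right_mono) auto
      then show ?case using elim by (simp add: s_def)
    qed
  qed
qed

lemma ergodic_averages_tendsto_zero:
  assumes "prob_space N" and S: "measure_preserving N S" and h: "h \<in> bounded_borel N"
    and zero: "\<And>A. A \<in> sets (invariant_algebra N S) \<Longrightarrow> (\<integral>x. h x * indicator A x \<partial>N) = 0"
  shows "AE x in N. (\<lambda>n. (\<Sum>k<n. h ((S ^^ k) x)) / n) \<longlonglongrightarrow> 0"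
proof -
  have h': "(\<lambda>x. - h x) \<in> bounded_borel N"
    using bounded_borel_diff[OF bounded_borel_const h, of 0] by simp
  have "AE x in N. \<forall>m. \<forall>\<^sub>F n in sequentially. (\<Sum>k<n. h ((S ^^ k) x)) \<le> (1 / Suc m) * n"
    by (subst AE_all_countable) (intro allI ergodic_averages_upper assms, auto)
  moreover have "AE x in N. \<forall>m. \<forall>\<^sub>F n in sequentially. (\<Sum>k<n. - h ((S ^^ k) x)) \<le> (1 / Suc m) * n"
    using zero by (subst AE_all_countable) (intro allI ergodic_averages_upper assms h', auto)
  ultimately show ?thesis
  proof eventually_elim
    case (elim x)
    show ?case
    proof (rule LIMSEQ_I)
      fix r :: real assume "0 < r"
      then obtain m where m: "1 / real (Suc m) < r" using nat_approx_posE by blast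
      have "\<forall>\<^sub>F n in sequentially. norm ((\<Sum>k<n. h ((S ^^ k) x)) / n - 0) < r"
        using elim(1)[rule_format, of m] elim(2)[rule_format, of m] eventually_gt_at_top[of 0]
      proof eventually_elim
        case (elim n)
        then have "\<bar>(\<Sum>k<n. h ((S ^^ k) x)) / n\<bar> \<le> 1 / Suc m"
          by (auto simp: abs_le_iff sum_negf field_simps)
        then show ?case using m by simp
      qed
      then show "\<exists>no. \<forall>n\<ge>no. norm ((\<Sum>k<n. h ((S ^^ k) x)) / n - 0) < r"
        by (simp add: eventually_sequentially)
    qed
  qed
qed

text \<open>
  The averages of \<open>g - E g\<close> tend to \<open>0\<close> almost everywhere by the preceding lemma, and \<open>E g\<close> does not
  change under averaging; dominated convergence does the rest.
\<close>

lemma ergodic_averages_integral: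
  assumes "prob_space N" and S: "measure_preserving N S"
    and f: "f \<in> bounded_borel N" and g: "g \<in> bounded_borel N"
  shows "(\<lambda>n. (\<Sum>k<n. \<integral>x. f x * g ((S ^^ k) x) \<partial>N) / n) \<longlonglongrightarrow>
    (\<integral>x. real_cond_exp N (invariant_algebra N S) f x * real_cond_exp N (invariant_algebra N S) g x \<partial>N)"
proof -
  interpret prob_space N by fact
  let ?J = "invariant_algebra N S"
  have S' [measurable]: "S \<in> measurable N N" using S by (rule measure_preserving_measurable)
  note sub = subalgebra_invariant_algebra[OF S']
  obtain Ef where Ef: "Ef \<in> borel_measurable ?J" "Ef \<in> bounded_borel N"
      "AE x in N. real_cond_exp N ?J f x = Ef x"
      "\<And>h. h \<in> borel_measurable ?J \<Longrightarrow> h \<in> bounded_borel N \<Longrightarrow> (\<integral>x. f x * h x \<partial>N) = (\<integral>x. Ef x * h x \<partial>N)"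
    using bounded_cond_exp_version[OF assms(1) sub f] by blast
  obtain Eg where Eg: "Eg \<in> borel_measurable ?J" "Eg \<in> bounded_borel N"
      "AE x in N. real_cond_exp N ?J g x = Eg x"
      "\<And>h. h \<in> borel_measurable ?J \<Longrightarrow> h \<in> bounded_borel N \<Longrightarrow> (\<integral>x. g x * h x \<partial>N) = (\<integral>x. Eg x * h x \<partial>N)"
    using bounded_cond_exp_version[OF assms(1) sub g] by blast
  have Sk: "(S ^^ k) \<in> measurable N N" for k
    using measure_preserving_funpow[OF S] by (rule measure_preserving_measurable)
  define h where "h = (\<lambda>x. g x - Eg x)"
  have h: "h \<in> bounded_borel N" unfolding h_def by (intro bounded_borel_closure g Eg)
  have Eg_inv: "AE x in N. \<forall>k. Eg ((S ^^ k) x) = Eg x"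
  proof -
    have "AE x in N. Eg (S x) = Eg x"
      using invariant_measurable_iff[OF S' bounded_borel_measurable[OF Eg(2)]] Eg(1) by simp
    then have "AE x in N. Eg (S ((S ^^ k) x)) = Eg ((S ^^ k) x)" for k
      by (rule measure_preserving_AE[OF measure_preserving_funpow[OF S]])
    then have "AE x in N. \<forall>k. Eg (S ((S ^^ k) x)) = Eg ((S ^^ k) x)"
      by (subst AE_all_countable) blast
    then show ?thesis
    proof eventually_elim
      case (elim x)
      show ?case
      proof
        fix k show "Eg ((S ^^ k) x) = Eg x" by (induction k) (use elim in auto)
      qed
    qed
  qed
  have "AE x in N. (\<lambda>n. (\<Sum>k<n. h ((S ^^ k) x)) / n) \<longlonglongrightarrow> 0"
  proof (rule ergodic_averages_tendsto_zero[OF assms(1) S h])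
    fix A assume A: "A \<in> sets ?J"
    then have AN: "A \<in> sets N" using sub by (auto simp: subalgebra_def)
    have "(\<integral>x. h x * indicator A x \<partial>N) = (\<integral>x. g x * indicator A x - Eg x * indicator A x \<partial>N)"
      by (simp add: h_def left_diff_distrib)
    also have "\<dots> = 0"
      using Eg(4)[of "indicator A"] A AN
      by (subst Bochner_Integration.integral_diff)
         (auto intro!: integrable_bounded_borel bounded_borel_closure g Eg)
    finally show "(\<integral>x. h x * indicator A x \<partial>N) = 0" .
  qed
  then have conv: "AE x in N. (\<lambda>n. f x * ((\<Sum>k<n. g ((S ^^ k) x)) / n)) \<longlonglongrightarrow> f x * Eg x"
    using Eg_inv
  proof eventually_elim
    case (elim x)
    have "(\<lambda>n. (\<Sum>k<n. h ((S ^^ k) x)) / n + Eg x) \<longlonglongrightarrow> 0 + Eg x"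
      by (intro tendsto_add elim(1) tendsto_const)
    moreover have "\<forall>\<^sub>F n in sequentially. (\<Sum>k<n. h ((S ^^ k) x)) / n + Eg x = (\<Sum>k<n. g ((S ^^ k) x)) / n"
      using eventually_gt_at_top[of 0]
      by eventually_elim (simp add: h_def sum_subtractf elim(2) field_simps)
    ultimately have "(\<lambda>n. (\<Sum>k<n. g ((S ^^ k) x)) / n) \<longlonglongrightarrow> Eg x"
      by (simp add: tendsto_cong)
    then show ?case by (intro tendsto_mult tendsto_const)
  qed
  obtain C where C: "0 < C" "\<And>x. x \<in> space N \<Longrightarrow> \<bar>g x\<bar> \<le> C"
    using g by (rule bounded_borelE) (rule that)
  have avg: "(\<lambda>x. f x * ((\<Sum>k<n. g ((S ^^ k) x)) / n)) \<in> bounded_borel N" for n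
    using bounded_borel_mult[OF f bounded_borel_mult[OF bounded_borel_sum[of "{..<n}" "\<lambda>k x. g ((S ^^ k) x)"] bounded_borel_const[of "1 / n"]]]
      bounded_borel_comp[OF g Sk] by simp
  have "(\<lambda>n. \<integral>x. f x * ((\<Sum>k<n. g ((S ^^ k) x)) / n) \<partial>N) \<longlonglongrightarrow> (\<integral>x. f x * Eg x \<partial>N)"
  proof (rule integral_dominated_convergence[where w = "\<lambda>x. \<bar>f x\<bar> * C"])
    show "AE x in N. norm (f x * ((\<Sum>k<n. g ((S ^^ k) x)) / n)) \<le> \<bar>f x\<bar> * C" for n
    proof (rule AE_I2)
      fix x assume x: "x \<in> space N"
      have "\<bar>\<Sum>k<n. g ((S ^^ k) x)\<bar> \<le> (\<Sum>k<n. C)"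
        by (rule order_trans[OF sum_abs sum_mono]) (use C(2) funpow_in_space[OF S' x] in auto)
      then have "\<bar>(\<Sum>k<n. g ((S ^^ k) x)) / n\<bar> \<le> C"
        using C(1) by (cases "n = 0") (auto simp: field_simps)
      then show "norm (f x * ((\<Sum>k<n. g ((S ^^ k) x)) / n)) \<le> \<bar>f x\<bar> * C"
        unfolding real_norm_def abs_mult by (intro mult_left_mono) auto
    qed
  qed (use conv bounded_borel_measurable[OF avg] bounded_borel_measurable[OF bounded_borel_mult[OF f Eg(2)]]
         integrable_bounded_borel[OF f] in auto)
  also have "(\<integral>x. f x * Eg x \<partial>N) = (\<integral>x. Ef x * Eg x \<partial>N)"
    by (rule Ef(4)[OF Eg(1,2)])
  also have "\<dots> = (\<integral>x. real_cond_exp N ?J f x * real_cond_exp N ?J g x \<partial>N)"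
    using Ef(3) Eg(3) bounded_borel_measurable[OF bounded_borel_mult[OF Ef(2) Eg(2)]]
    by (intro integral_cong_AE) auto
  also have "(\<lambda>n. \<integral>x. f x * ((\<Sum>k<n. g ((S ^^ k) x)) / n) \<partial>N)
      = (\<lambda>n. (\<Sum>k<n. \<integral>x. f x * g ((S ^^ k) x) \<partial>N) / n)"
  proof
    fix n
    have "(\<integral>x. f x * ((\<Sum>k<n. g ((S ^^ k) x)) / n) \<partial>N) = (\<integral>x. (\<Sum>k<n. f x * g ((S ^^ k) x)) / n \<partial>N)"
      by (simp add: sum_distrib_left)
    also have "\<dots> = (\<Sum>k<n. \<integral>x. f x * g ((S ^^ k) x) \<partial>N) / n"
      using integrable_bounded_borel[OF bounded_borel_mult[OF f bounded_borel_comp[OF g Sk]]]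
      by (simp add: Bochner_Integration.integral_sum)
    finally show "(\<integral>x. f x * ((\<Sum>k<n. g ((S ^^ k) x)) / n) \<partial>N) = (\<Sum>k<n. \<integral>x. f x * g ((S ^^ k) x) \<partial>N) / n" .
  qed
  finally show ?thesis .
qed

section \<open>Regular measures\<close>

definition regular_sets :: "'a topology \<Rightarrow> 'a measure \<Rightarrow> 'a set set" where
  "regular_sets X N = {A \<in> sets N. \<forall>e>0. \<exists>K U. K \<in> sets N \<and> U \<in> sets N \<and>
     compactin X K \<and> openin X U \<and> K \<subseteq> A \<and> A \<subseteq> U \<and> measure N (U - K) < e}"

text \<open>
  Relatively independent squares are constructed for regular measures. In contrast to completeness
  and separability of the space, regularity involves the measure, which makes it easy to transfer to
  a measure on a product.
\<close>

definition regular_measure :: "'a measure \<Rightarrow> bool" where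
  "regular_measure N \<longleftrightarrow> (\<exists>X. Hausdorff_space X \<and> topspace X = space N \<and> sets N \<subseteq> regular_sets X N)"

lemma regular_setsE:
  assumes "A \<in> regular_sets X N" "0 < e"
  obtains K U where "K \<in> sets N" "U \<in> sets N" "compactin X K" "openin X U"
    "K \<subseteq> A" "A \<subseteq> U" "measure N (U - K) < e"
  using assms unfolding regular_sets_def by blast

lemma (in finite_measure) measure_tail_small:
  assumes "range A \<subseteq> sets M" "0 < (e :: real)"
  obtains n :: nat where "measure M ((\<Union>i. A i) - (\<Union>i\<le>n. A i)) < e"
proof -
  have inc: "incseq (\<lambda>n. \<Union>i\<le>n. A i)" by (intro incseq_SucI) (auto simp: atMost_Suc)
  have "(\<lambda>n. measure M (\<Union>i\<le>n. A i)) \<longlonglongrightarrow> measure M (\<Union>n. \<Union>i\<le>n. A i)"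
    using assms(1) by (intro finite_Lim_measure_incseq inc) auto
  moreover have "(\<Union>n. \<Union>i\<le>n. A i) = (\<Union>i. A i)" by auto
  ultimately have "(\<lambda>n. measure M (\<Union>i. A i) - measure M (\<Union>i\<le>n. A i))
      \<longlonglongrightarrow> measure M (\<Union>i. A i) - measure M (\<Union>i. A i)"
    by (intro tendsto_diff tendsto_const) simp
  then have "(\<lambda>n. measure M (\<Union>i. A i) - measure M (\<Union>i\<le>n. A i)) \<longlonglongrightarrow> 0"
    by simp
  then obtain n where "measure M (\<Union>i. A i) - measure M (\<Union>i\<le>n. A i) < e"
    using order_tendstoD(2)[OF _ assms(2)] eventually_happens'[OF sequentially_bot] by blast
  moreover have "measure M ((\<Union>i. A i) - (\<Union>i\<le>n. A i)) = measure M (\<Union>i. A i) - measure M (\<Union>i\<le>n. A i)"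
    using assms(1) by (intro finite_measure_Diff) auto
  ultimately show thesis using that[of n] by simp
qed

text \<open>
  Complements exchange compact and open approximations, except that the complement of an open set
  has to be cut down to a compact set; this is why the whole space must be approximable.
\<close>

lemma sigma_algebra_regular_sets:
  assumes "finite_measure N" "Hausdorff_space X" "topspace X = space N"
    and space: "space N \<in> regular_sets X N"
  shows "sigma_algebra (space N) (regular_sets X N)"
proof -
  interpret finite_measure N by fact
  show ?thesis
    unfolding sigma_algebra_iff2
  proof (intro conjI ballI allI impI)
    show "regular_sets X N \<subseteq> Pow (space N)"
      by (auto simp: regular_sets_def dest: sets.sets_into_space)
    show "{} \<in> regular_sets X N"
      by (auto simp: regular_sets_def intro!: exI[of _ "{}"])
  next
    fix A assume A: "A \<in> regular_sets X N"
    have AN: "A \<in> sets N" using A by (simp add: regular_sets_def)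
    show "space N - A \<in> regular_sets X N"
      unfolding regular_sets_def
    proof (intro CollectI conjI allI impI)
      show "space N - A \<in> sets N" using AN by auto
      fix e :: real assume "0 < e"
      obtain K U where K: "K \<in> sets N" "U \<in> sets N" "compactin X K" "openin X U"
          "K \<subseteq> A" "A \<subseteq> U" "measure N (U - K) < e / 2"
        using regular_setsE[OF A, of "e / 2"] \<open>0 < e\<close> by auto
      obtain L where L: "L \<in> sets N" "compactin X L" "L \<subseteq> space N" "measure N (space N - L) < e / 2"
      proof -
        obtain L V where "L \<in> sets N" "V \<in> sets N" "compactin X L" "L \<subseteq> space N" "space N \<subseteq> V"
            "measure N (V - L) < e / 2"
          by (rule regular_setsE[OF space, of "e / 2"]) (use \<open>0 < e\<close> in auto)
        moreover then have "V = space N" by (auto dest: sets.sets_into_space)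
        ultimately show thesis using that by blast
      qed
      have "closedin X (topspace X - U)" using K(4) by blast
      then have "compactin X ((space N - U) \<inter> L)"
        using closed_Int_compactin L(2) assms(3) by metis
      moreover have "closedin X K" using assms(2) K(3) by (rule compactin_imp_closedin)
      then have "openin X (space N - K)" using assms(3) by (metis openin_diff openin_topspace)
      moreover have "measure N ((space N - K) - ((space N - U) \<inter> L)) < e"
      proof -
        have "measure N ((space N - K) - ((space N - U) \<inter> L)) \<le> measure N ((U - K) \<union> (space N - L))"
          using K L by (intro finite_measure_mono) auto
        also have "\<dots> \<le> measure N (U - K) + measure N (space N - L)"
          using K L by (intro measure_Un_le) auto
        finally show ?thesis using K L by linarith
      qed
      ultimately show "\<exists>K U. K \<in> sets N \<and> U \<in> sets N \<and> compactin X K \<and> openin X U \<and>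
          K \<subseteq> space N - A \<and> space N - A \<subseteq> U \<and> measure N (U - K) < e"
        using K L by (intro exI[of _ "(space N - U) \<inter> L"] exI[of _ "space N - K"]) auto
    qed
  next
    fix A :: "nat \<Rightarrow> 'a set" assume A: "range A \<subseteq> regular_sets X N"
    then have AN: "range A \<subseteq> sets N" by (auto simp: regular_sets_def)
    show "\<Union> (range A) \<in> regular_sets X N"
      unfolding regular_sets_def
    proof (intro CollectI conjI allI impI)
      show "\<Union> (range A) \<in> sets N" using AN by auto
      fix e :: real assume "0 < e"
      \<comment> \<open>The errors add up to \<open>e / 2\<close>; the other half pays for passing to finitely many \<open>K i\<close>.\<close>
      have "\<exists>K U. K \<in> sets N \<and> U \<in> sets N \<and> compactin X K \<and> openin X U \<and>
          K \<subseteq> A i \<and> A i \<subseteq> U \<and> measure N (U - K) < e / 2 * (1 / 2) ^ Suc i" for i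
      proof -
        have "A i \<in> regular_sets X N" "0 < e / 2 * (1 / 2) ^ Suc i" using A \<open>0 < e\<close> by auto
        from regular_setsE[OF this] show ?thesis by metis
      qed
      then obtain K U where K: "\<And>i. K i \<in> sets N" "\<And>i. U i \<in> sets N" "\<And>i. compactin X (K i)"
          "\<And>i. openin X (U i)" "\<And>i. K i \<subseteq> A i" "\<And>i. A i \<subseteq> U i"
          "\<And>i. measure N (U i - K i) < e / 2 * (1 / 2) ^ Suc i"
        by metis
      obtain n where n: "measure N ((\<Union>i. K i) - (\<Union>i\<le>n. K i)) < e / 2"
        using measure_tail_small[of K "e / 2"] K(1) \<open>0 < e\<close> by auto
      have geo: "(\<lambda>i. e / 2 * (1 / 2) ^ Suc i) sums (e / 2 * 1)"
        by (intro sums_mult power_half_series)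
      have sm: "summable (\<lambda>i. measure N (U i - K i))"
        by (rule summable_comparison_test'[OF sums_summable[OF geo], of 0])
         (simp only: real_norm_def abs_of_nonneg[OF measure_nonneg] K(7)[THEN less_imp_le])
      have "measure N (\<Union>i. U i - K i) \<le> (\<Sum>i. measure N (U i - K i))"
        using K by (intro finite_measure_subadditive_countably sm) auto
      also have "\<dots> \<le> (\<Sum>i. e / 2 * (1 / 2) ^ Suc i)"
        by (intro suminf_le sm sums_summable[OF geo] K(7)[THEN less_imp_le])
      also have "\<dots> = e / 2" using geo by (simp add: sums_iff)
      finally have U: "measure N (\<Union>i. U i - K i) \<le> e / 2" .
      have "measure N ((\<Union>i. U i) - (\<Union>i\<le>n. K i)) \<le> measure N ((\<Union>i. U i - K i) \<union> ((\<Union>i. K i) - (\<Union>i\<le>n. K i)))"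
        using K by (intro finite_measure_mono) auto
      also have "\<dots> \<le> measure N (\<Union>i. U i - K i) + measure N ((\<Union>i. K i) - (\<Union>i\<le>n. K i))"
        using K by (intro measure_Un_le) auto
      finally have "measure N ((\<Union>i. U i) - (\<Union>i\<le>n. K i)) < e" using U n by linarith
      moreover have "compactin X (\<Union>i\<le>n. K i)" using K(3) by (intro compactin_Union) auto
      moreover have "openin X (\<Union>i. U i)" using K(4) by auto
      moreover have "(\<Union>i\<le>n. K i) \<subseteq> \<Union> (range A)" using K(5) by blast
      moreover have "\<Union> (range A) \<subseteq> (\<Union>i. U i)" using K(6) by blast
      ultimately show "\<exists>K U. K \<in> sets N \<and> U \<in> sets N \<and> compactin X K \<and> openin X U \<and>
          K \<subseteq> \<Union> (range A) \<and> \<Union> (range A) \<subseteq> U \<and> measure N (U - K) < e"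
        using K(1,2) by (intro exI[of _ "\<Union>i\<le>n. K i"] exI[of _ "\<Union>i. U i"]) auto
    qed
  qed
qed

text \<open>
  Ulam's argument for tightness: for every \<open>n\<close> finitely many closed balls of radius \<open>1 / n\<close> carry
  almost the whole mass, and the intersection over \<open>n\<close> of their unions is closed and totally
  bounded, hence compact by completeness.
\<close>

lemma (in Metric_space) tight_of_complete_separable:
  assumes "finite_measure N" "space N = M" "sets N = sigma_sets M {U. openin mtopology U}"
    and "mcomplete" "second_countable mtopology" "0 < (e :: real)"
  obtains K where "K \<in> sets N" "compactin mtopology K" "measure N (M - K) < e"
proof -
  interpret N: finite_measure N by fact
  have opn: "openin mtopology U \<Longrightarrow> U \<in> sets N" for U using assms(3) by auto
  have cls: "closedin mtopology C \<Longrightarrow> C \<in> sets N" for C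
  proof -
    assume C: "closedin mtopology C"
    then have "M - C \<in> sets N" by (intro opn) (auto simp: closedin_def)
    then have "M - (M - C) \<in> sets N" using assms(2) by (metis sets.compl_sets)
    moreover have "C \<subseteq> M" using closedin_subset[OF C] by simp
    ultimately show ?thesis by (simp add: double_diff)
  qed
  obtain D where D: "countable D" "D \<subseteq> M" "mtopology closure_of D = M"
    using second_countable_imp_separable_space[OF assms(5)] by (auto simp: separable_space_def)
  have "\<exists>F. finite F \<and> F \<subseteq> M \<and> measure N (M - (\<Union>x\<in>F. mcball x (1 / Suc n))) < e / 2 * (1 / 2) ^ Suc n" for n
  proof (cases "D = {}")
    case True
    then have "M = {}" using D by auto
    then show ?thesis using \<open>0 < e\<close> by (intro exI[of _ "{}"]) auto
  next
    case False
    define B where "B i = mcball (from_nat_into D i) (1 / Suc n)" for i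
    have inD: "from_nat_into D i \<in> M" for i using from_nat_into[OF False, of i] D(2) by blast
    have B: "range B \<subseteq> sets N" unfolding B_def by (auto intro: cls)
    have cover: "(\<Union>i. B i) = M"
    proof
      show "(\<Union>i. B i) \<subseteq> M" unfolding B_def by auto
      show "M \<subseteq> (\<Union>i. B i)"
      proof
        fix x assume "x \<in> M"
        then have "x \<in> mtopology closure_of D" using D(3) by simp
        then obtain y where "y \<in> D" "y \<in> mball x (1 / Suc n)"
          unfolding metric_closure_of by (force dest!: spec[of _ "1 / Suc n"])
        moreover then obtain i where "y = from_nat_into D i" using from_nat_into_surj[OF D(1)] by metis
        ultimately show "x \<in> (\<Union>i. B i)" using commute[of x y] by (auto simp: B_def intro!: exI[of _ i])
      qed
    qed
    obtain k where "measure N ((\<Union>i. B i) - (\<Union>i\<le>k. B i)) < e / 2 * (1 / 2) ^ Suc n"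
      using N.measure_tail_small[OF B, of "e / 2 * (1 / 2) ^ Suc n"] \<open>0 < e\<close> by auto
    then show ?thesis using inD cover
      by (intro exI[of _ "from_nat_into D ` {..k}"]) (auto simp: B_def)
  qed
  then obtain F where F: "\<And>n. finite (F n)" "\<And>n. F n \<subseteq> M"
      "\<And>n. measure N (M - (\<Union>x\<in>F n. mcball x (1 / Suc n))) < e / 2 * (1 / 2) ^ Suc n"
    by metis
  define K where "K = (\<Inter>n. \<Union>x\<in>F n. mcball x (1 / Suc n))"
  have clF: "closedin mtopology (\<Union>x\<in>F n. mcball x (1 / Suc n))" for n
    using F(1) by (intro closedin_Union) auto
  then have clK: "closedin mtopology K" unfolding K_def by (intro closedin_Inter) auto
  have KM: "K \<subseteq> M" using closedin_subset[OF clK] by simp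
  have "mtotally_bounded K"
    unfolding mtotally_bounded_def
  proof (intro allI impI)
    fix r :: real assume "0 < r"
    then obtain n where n: "1 / real (Suc n) < r / 2" using nat_approx_posE[of "r / 2"] by auto
    define G where "G = {x \<in> F n. mcball x (1 / Suc n) \<inter> K \<noteq> {}}"
    have "\<forall>x\<in>G. \<exists>p. p \<in> mcball x (1 / Suc n) \<inter> K" by (auto simp: G_def)
    then obtain p where p: "\<And>x. x \<in> G \<Longrightarrow> p x \<in> mcball x (1 / Suc n) \<inter> K" by metis
    show "\<exists>P. finite P \<and> P \<subseteq> K \<and> K \<subseteq> (\<Union>x\<in>P. mball x r)"
    proof (intro exI[of _ "p ` G"] conjI)
      show "finite (p ` G)" using F(1) by (simp add: G_def)
      show "p ` G \<subseteq> K" using p by auto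
      show "K \<subseteq> (\<Union>x\<in>p ` G. mball x r)"
      proof
        fix y assume y: "y \<in> K"
        then obtain x where x: "x \<in> F n" "y \<in> mcball x (1 / Suc n)" by (auto simp: K_def)
        then have xG: "x \<in> G" using y by (auto simp: G_def)
        have "d (p x) y \<le> d (p x) x + d x y" using p[OF xG] x y KM by (intro triangle) auto
        also have "\<dots> < r" using p[OF xG] x n commute[of "p x" x] by auto
        finally show "y \<in> (\<Union>x\<in>p ` G. mball x r)" using xG p[OF xG] y KM by auto
      qed
    qed
  qed
  then have "compactin mtopology (mtopology closure_of K)"
    using mtotally_bounded_eq_compact_closure_of[OF assms(4)] by blast
  then have cpt: "compactin mtopology K" using clK by (simp add: closure_of_closedin)
  have geo: "(\<lambda>i. e / 2 * (1 / 2) ^ Suc i) sums (e / 2 * 1)"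
    by (intro sums_mult power_half_series)
  let ?R = "\<lambda>n. M - (\<Union>x\<in>F n. mcball x (1 / Suc n))"
  have R: "?R n \<in> sets N" for n
    using sets.compl_sets[OF cls[OF clF[of n]]] assms(2) by simp
  have sm: "summable (\<lambda>n. measure N (?R n))"
    by (rule summable_comparison_test'[OF sums_summable[OF geo], of 0])
         (simp only: real_norm_def abs_of_nonneg[OF measure_nonneg] F(3)[THEN less_imp_le])
  have MK: "M - K = (\<Union>n. ?R n)" by (auto simp: K_def)
  have "measure N (\<Union>n. ?R n) \<le> (\<Sum>n. measure N (?R n))"
    using R by (intro N.finite_measure_subadditive_countably sm) blast
  then have "measure N (M - K) \<le> (\<Sum>n. measure N (?R n))"
    unfolding MK .
  also have "\<dots> \<le> (\<Sum>i. e / 2 * (1 / 2) ^ Suc i)"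
    by (intro suminf_le sm sums_summable[OF geo] F(3)[THEN less_imp_le])
  also have "\<dots> = e / 2" using geo by (simp add: sums_iff)
  finally have "measure N (M - K) < e" using \<open>0 < e\<close> by linarith
  then show thesis using that cls[OF clK] cpt by blast
qed

lemma regular_measure_standard:
  assumes "standard_prob_space N"
  shows "regular_measure N"
proof -
  interpret prob_space N using assms by (simp add: standard_prob_space_def)
  obtain X where X: "completely_metrizable_space X" "second_countable X" "topspace X = space N"
      "sets N = sigma_sets (topspace X) {U. openin X U}"
    using assms by (auto simp: standard_prob_space_def)
  then have metr: "metrizable_space X" by (simp add: completely_metrizable_imp_metrizable_space)
  then have haus: "Hausdorff_space X" by (rule metrizable_imp_Hausdorff_space)
  have opn: "openin X U \<Longrightarrow> U \<in> sets N" for U using X(4) by auto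
  have tight: "\<exists>K. K \<in> sets N \<and> compactin X K \<and> measure N (space N - K) < e" if "0 < e" for e
  proof -
    obtain M d where "Metric_space M d" and md: "Metric_space.mcomplete M d" "X = Metric_space.mtopology M d"
      using X(1) by (auto simp: completely_metrizable_space_def)
    interpret Metric_space M d by fact
    have "topspace X = M" using md by simp
    then show ?thesis
      using tight_of_complete_separable[of N e] X md that finite_measure_axioms by metis
  qed
  have open_regular: "U \<in> regular_sets X N" if "openin X U" for U
    unfolding regular_sets_def
  proof (intro CollectI conjI allI impI)
    show UN: "U \<in> sets N" using that by (rule opn)
    fix e :: real assume "0 < e"
    obtain C :: "nat \<Rightarrow> 'a set" where C: "\<And>n. closedin X (C n)" "\<And>n. C n \<subseteq> C (Suc n)" "\<Union> (range C) = U"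
      using open_imp_fsigma_in[OF metr \<open>openin X U\<close>] unfolding fsigma_in_ascending by blast
    have CN: "C n \<in> sets N" for n
    proof -
      have "space N - (topspace X - C n) \<in> sets N" using C(1) by (intro sets.compl_sets opn) (simp add: closedin_def)
      then show ?thesis using X(3) closedin_subset[OF C(1)] by (simp add: double_diff)
    qed
    obtain n where n: "measure N ((\<Union>i. C i) - (\<Union>i\<le>n. C i)) < e / 2"
      using measure_tail_small[of C "e / 2"] CN \<open>0 < e\<close> by auto
    obtain K where K: "K \<in> sets N" "compactin X K" "measure N (space N - K) < e / 2"
      using tight[of "e / 2"] \<open>0 < e\<close> by auto
    have "closedin X (\<Union>i\<le>n. C i)" using C(1) by (intro closedin_Union) auto
    then have cpt: "compactin X ((\<Union>i\<le>n. C i) \<inter> K)" using K(2) by (rule closed_Int_compactin)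
    have "measure N (U - ((\<Union>i\<le>n. C i) \<inter> K)) \<le> measure N (((\<Union>i. C i) - (\<Union>i\<le>n. C i)) \<union> (space N - K))"
      using K CN UN C(3) sets.sets_into_space[OF UN] by (intro finite_measure_mono) auto
    also have "\<dots> \<le> measure N ((\<Union>i. C i) - (\<Union>i\<le>n. C i)) + measure N (space N - K)"
      using K CN by (intro measure_Un_le) auto
    finally have "measure N (U - ((\<Union>i\<le>n. C i) \<inter> K)) < e" using n K by linarith
    then show "\<exists>K V. K \<in> sets N \<and> V \<in> sets N \<and> compactin X K \<and> openin X V \<and>
        K \<subseteq> U \<and> U \<subseteq> V \<and> measure N (V - K) < e"
      using K CN UN C(3) cpt that by (intro exI[of _ "(\<Union>i\<le>n. C i) \<inter> K"] exI[of _ U]) auto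
  qed
  have "sigma_algebra (space N) (regular_sets X N)"
    using open_regular[OF openin_topspace] X(3)
    by (intro sigma_algebra_regular_sets haus) (auto simp: finite_measure_axioms)
  then have "sigma_sets (space N) {U. openin X U} \<subseteq> regular_sets X N"
    using open_regular by (intro sigma_algebra.sigma_sets_subset) auto
  then show ?thesis
    unfolding regular_measure_def using X haus by auto
qed

text \<open>
  Regularity of a measure on a finite product only depends on its marginals: products of compact
  sets are compact, so tightness is inherited from the marginals, and the cylinders over a single
  coordinate generate.
\<close>

lemma regular_measure_power:
  assumes "prob_space N" "sets N = sets (PiM I (\<lambda>_. M))" "finite I" "regular_measure M"
    and marg: "\<And>i. i \<in> I \<Longrightarrow> distr N M (\<lambda>x. x i) = M"
  shows "regular_measure N"
proof -
  interpret prob_space N by fact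
  obtain X where X: "Hausdorff_space X" "topspace X = space M" "sets M \<subseteq> regular_sets X M"
    using assms(4) by (auto simp: regular_measure_def)
  define Y where "Y = product_topology (\<lambda>_. X) I"
  have spN: "space N = (\<Pi>\<^sub>E i\<in>I. space M)"
    using sets_eq_imp_space_eq[OF assms(2)] by (simp add: space_PiM)
  have topY: "topspace Y = space N" by (simp add: Y_def spN X(2))
  have hausY: "Hausdorff_space Y" using X(1) by (simp add: Y_def Hausdorff_space_product_topology)
  have coord: "(\<lambda>x. x i) \<in> measurable N M" if "i \<in> I" for i
    using measurable_component_singleton[OF that, of "\<lambda>_. M"] measurable_cong_sets[OF assms(2) refl] by blast
  have cyl: "{x \<in> space N. x i \<in> A} \<in> sets N" if "i \<in> I" "A \<in> sets M" for i A
    using measurable_sets[OF coord[OF that(1)] that(2)] by (simp add: vimage_def Int_def conj_commute)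
  have marg_measure: "measure N {x \<in> space N. x i \<in> A} = measure M A" if "i \<in> I" "A \<in> sets M" for i A
  proof -
    have "measure (distr N M (\<lambda>x. x i)) A = measure N ((\<lambda>x. x i) -` A \<inter> space N)"
      using that coord by (intro measure_distr) auto
    then show ?thesis using marg[OF that(1)] by (simp add: vimage_def Int_def conj_commute)
  qed
  have box: "(\<Pi>\<^sub>E i\<in>I. K) \<in> sets N" if "K \<in> sets M" for K
    using assms(2,3) that by (simp add: sets_PiM_I_finite)
  have tight: "\<exists>K. K \<in> sets M \<and> compactin X K \<and> measure N (space N - (\<Pi>\<^sub>E i\<in>I. K)) < e" if "0 < e" for e
  proof -
    define e' where "e' = e / (card I + 1)"
    have e': "0 < e'" using \<open>0 < e\<close> by (simp add: e'_def)
    obtain K U where K: "K \<in> sets M" "U \<in> sets M" "compactin X K" "openin X U"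
        "K \<subseteq> space M" "space M \<subseteq> U" "measure M (U - K) < e'"
      by (rule regular_setsE[OF _ e', of "space M" X M]) (use X(3) in auto)
    then have "U = space M" by (auto dest: sets.sets_into_space)
    have "measure N (space N - (\<Pi>\<^sub>E i\<in>I. K)) \<le> measure N (\<Union>i\<in>I. {x \<in> space N. x i \<in> space M - K})"
    proof (intro finite_measure_mono)
      show "space N - (\<Pi>\<^sub>E i\<in>I. K) \<subseteq> (\<Union>i\<in>I. {x \<in> space N. x i \<in> space M - K})"
        using K(5) by (auto simp: spN PiE_def Pi_def)
      show "(\<Union>i\<in>I. {x \<in> space N. x i \<in> space M - K}) \<in> sets N"
        using K(1) assms(3) by (intro sets.finite_UN cyl) auto
    qed
    also have "\<dots> \<le> (\<Sum>i\<in>I. measure N {x \<in> space N. x i \<in> space M - K})"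
      using K cyl assms(3) by (intro measure_UNION_le) auto
    also have "\<dots> = (\<Sum>i\<in>I. measure M (space M - K))"
      using K by (intro sum.cong marg_measure) auto
    also have "\<dots> \<le> card I * e'"
      using K \<open>U = space M\<close> by (auto intro!: mult_left_mono)
    also have "\<dots> < e" using \<open>0 < e\<close> by (simp add: e'_def field_simps)
    finally show ?thesis using K by blast
  qed
  have cptbox: "compactin Y (\<Pi>\<^sub>E i\<in>I. K)" if "compactin X K" for K
    using that by (auto simp: Y_def compactin_PiE)
  have space: "space N \<in> regular_sets Y N"
    unfolding regular_sets_def
  proof (intro CollectI conjI allI impI)
    fix e :: real assume "0 < e"
    then obtain K where "K \<in> sets M" "compactin X K" "measure N (space N - (\<Pi>\<^sub>E i\<in>I. K)) < e"
      using tight by blast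
    then show "\<exists>K U. K \<in> sets N \<and> U \<in> sets N \<and> compactin Y K \<and> openin Y U \<and>
        K \<subseteq> space N \<and> space N \<subseteq> U \<and> measure N (U - K) < e"
      using box cptbox sets.sets_into_space[OF box] topY openin_topspace[of Y]
      by (intro exI[of _ "\<Pi>\<^sub>E i\<in>I. K"] exI[of _ "space N"]) auto
  qed auto
  have cylinder_regular: "{x \<in> space N. x i \<in> A} \<in> regular_sets Y N" if i: "i \<in> I" and A: "A \<in> sets M" for i A
    unfolding regular_sets_def
  proof (intro CollectI conjI allI impI)
    show "{x \<in> space N. x i \<in> A} \<in> sets N" using that by (rule cyl)
    fix e :: real assume "0 < e"
    obtain L where L: "L \<in> sets M" "compactin X L" "measure N (space N - (\<Pi>\<^sub>E i\<in>I. L)) < e / 2"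
      using tight[of "e / 2"] \<open>0 < e\<close> by auto
    obtain K U where K: "K \<in> sets M" "U \<in> sets M" "compactin X K" "openin X U"
        "K \<subseteq> A" "A \<subseteq> U" "measure M (U - K) < e / 2"
      by (rule regular_setsE[of A X M "e / 2"]) (use X(3) A \<open>0 < e\<close> in auto)
    have proj: "continuous_map Y X (\<lambda>x. x i)"
      unfolding Y_def using i by (rule continuous_map_product_projection)
    have "closedin Y {x \<in> topspace Y. x i \<in> K}"
      using proj compactin_imp_closedin[OF X(1) K(3)] by (rule closedin_continuous_map_preimage)
    then have cpt: "compactin Y ({x \<in> space N. x i \<in> K} \<inter> (\<Pi>\<^sub>E i\<in>I. L))"
      using cptbox[OF L(2)] topY by (auto intro: closed_Int_compactin)
    have "openin Y {x \<in> topspace Y. x i \<in> U}"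
      using proj K(4) by (rule openin_continuous_map_preimage)
    then have opn: "openin Y {x \<in> space N. x i \<in> U}" by (simp add: topY)
    have "measure N ({x \<in> space N. x i \<in> U} - ({x \<in> space N. x i \<in> K} \<inter> (\<Pi>\<^sub>E i\<in>I. L)))
        \<le> measure N ({x \<in> space N. x i \<in> U - K} \<union> (space N - (\<Pi>\<^sub>E i\<in>I. L)))"
      using K L cyl[OF i] box by (intro finite_measure_mono) auto
    also have "\<dots> \<le> measure N {x \<in> space N. x i \<in> U - K} + measure N (space N - (\<Pi>\<^sub>E i\<in>I. L))"
      using K L cyl[OF i, of "U - K"] box by (intro measure_Un_le) auto
    also have "\<dots> < e" using K L marg_measure[OF i, of "U - K"] by auto
    finally show "\<exists>K U. K \<in> sets N \<and> U \<in> sets N \<and> compactin Y K \<and> openin Y U \<and>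
        K \<subseteq> {x \<in> space N. x i \<in> A} \<and> {x \<in> space N. x i \<in> A} \<subseteq> U \<and> measure N (U - K) < e"
      using K L cpt opn cyl[OF i] box
      by (intro exI[of _ "{x \<in> space N. x i \<in> K} \<inter> (\<Pi>\<^sub>E i\<in>I. L)"] exI[of _ "{x \<in> space N. x i \<in> U}"]) auto
  qed
  have "sigma_algebra (space N) (regular_sets Y N)"
    by (intro sigma_algebra_regular_sets hausY topY space finite_measure_axioms)
  then have "sigma_sets (space N) {{f \<in> \<Pi>\<^sub>E i\<in>I. space M. f i \<in> A} |i A. i \<in> I \<and> A \<in> sets M} \<subseteq> regular_sets Y N"
    using cylinder_regular spN by (intro sigma_algebra.sigma_sets_subset) auto
  then show ?thesis
    unfolding regular_measure_def using hausY topY assms(2) spN by (auto simp: sets_PiM_single)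
qed

section \<open>Existence of relatively independent squares\<close>

text \<open>
  The mass that the relatively independent square over \<open>J\<close> has to give to \<open>A \<times> B\<close>. With only one of
  the two indicators replaced by its conditional expectation, the points of \<open>B\<close> remain visible, and
  coverings of \<open>A \<times> B\<close> can be analysed fibre by fibre.
\<close>

definition rectangle_mass :: "'a measure \<Rightarrow> 'a measure \<Rightarrow> 'a set \<Rightarrow> 'a set \<Rightarrow> real" where
  "rectangle_mass N J A B = (\<integral>x. real_cond_exp N J (indicator A) x * indicator B x \<partial>N)"

locale sub_prob = prob_space N for N :: "'a measure" +
  fixes J :: "'a measure"
  assumes sub: "subalgebra N J"
begin

sublocale finite_measure_subalgebra N J by standard (rule sub)

abbreviation cexp :: "('a \<Rightarrow> real) \<Rightarrow> 'a \<Rightarrow> real" where "cexp \<equiv> real_cond_exp N J"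

lemma cexp_measurable [measurable]: "cexp f \<in> borel_measurable N"
  using measurable_from_subalg[OF sub] by simp

lemma cexp_integrable_mult:
  assumes "f \<in> bounded_borel N" "g \<in> bounded_borel N"
  shows "integrable N (\<lambda>x. cexp f x * g x)"
proof -
  obtain h where h: "h \<in> bounded_borel N" "AE x in N. cexp f x = h x"
    using bounded_cond_exp_version[OF prob_space_axioms sub assms(1)] by metis
  have "integrable N (\<lambda>x. h x * g x)"
    using h assms by (intro integrable_bounded_borel bounded_borel_mult)
  moreover have "AE x in N. h x * g x = cexp f x * g x"
    using h(2) by eventually_elim simp
  ultimately show ?thesis
    using bounded_borel_measurable[OF h(1)] bounded_borel_measurable[OF assms(2)]
    by (subst integrable_cong_AE[where g = "\<lambda>x. h x * g x"]) auto
qed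

lemma cexp_selfadjoint:
  assumes f: "f \<in> bounded_borel N" and g: "g \<in> bounded_borel N"
  shows "(\<integral>x. cexp f x * g x \<partial>N) = (\<integral>x. f x * cexp g x \<partial>N)"
    and "(\<integral>x. cexp f x * cexp g x \<partial>N) = (\<integral>x. cexp f x * g x \<partial>N)"
proof -
  obtain Ef where Ef: "Ef \<in> borel_measurable J" "Ef \<in> bounded_borel N" "AE x in N. cexp f x = Ef x"
      "\<And>h. h \<in> borel_measurable J \<Longrightarrow> h \<in> bounded_borel N \<Longrightarrow> (\<integral>x. f x * h x \<partial>N) = (\<integral>x. Ef x * h x \<partial>N)"
    using bounded_cond_exp_version[OF prob_space_axioms sub f] by blast
  obtain Eg where Eg: "Eg \<in> borel_measurable J" "Eg \<in> bounded_borel N" "AE x in N. cexp g x = Eg x"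
      "\<And>h. h \<in> borel_measurable J \<Longrightarrow> h \<in> bounded_borel N \<Longrightarrow> (\<integral>x. g x * h x \<partial>N) = (\<integral>x. Eg x * h x \<partial>N)"
    using bounded_cond_exp_version[OF prob_space_axioms sub g] by blast
  note [measurable] = Ef(2)[THEN bounded_borel_measurable] Eg(2)[THEN bounded_borel_measurable]
    f[THEN bounded_borel_measurable] g[THEN bounded_borel_measurable]
  have 1: "(\<integral>x. cexp f x * g x \<partial>N) = (\<integral>x. Ef x * g x \<partial>N)"
    using Ef(3) by (intro integral_cong_AE) auto
  have 2: "(\<integral>x. f x * cexp g x \<partial>N) = (\<integral>x. f x * Eg x \<partial>N)"
    using Eg(3) by (intro integral_cong_AE) auto
  have 3: "(\<integral>x. cexp f x * cexp g x \<partial>N) = (\<integral>x. Ef x * Eg x \<partial>N)"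
    using Ef(3) Eg(3) by (intro integral_cong_AE) auto
  have 4: "(\<integral>x. f x * Eg x \<partial>N) = (\<integral>x. Ef x * Eg x \<partial>N)"
    by (rule Ef(4)[OF Eg(1,2)])
  have 5: "(\<integral>x. Ef x * g x \<partial>N) = (\<integral>x. Ef x * Eg x \<partial>N)"
    using Eg(4)[OF Ef(1,2)] by (simp add: mult.commute)
  show "(\<integral>x. cexp f x * g x \<partial>N) = (\<integral>x. f x * cexp g x \<partial>N)"
    and "(\<integral>x. cexp f x * cexp g x \<partial>N) = (\<integral>x. cexp f x * g x \<partial>N)"
    using 1 2 3 4 5 by simp_all
qed

text \<open>
  If finitely many rectangles cover \<open>K \<times> L\<close>, then over a point \<open>x\<close> of \<open>L\<close> the first sides of
  those whose second side contains \<open>x\<close> cover \<open>K\<close>. Only finitely many subfamilies occur, so the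
  resulting inequality between conditional probabilities holds almost everywhere at once.
\<close>

lemma rectangle_mass_cover:
  assumes I: "finite I" and [measurable]: "K \<in> sets N" "L \<in> sets N"
    and U: "\<And>i. U i \<in> sets N" and V: "\<And>i. V i \<in> sets N"
    and cover: "K \<times> L \<subseteq> (\<Union>i\<in>I. U i \<times> V i)"
  shows "rectangle_mass N J K L \<le> (\<Sum>i\<in>I. rectangle_mass N J (U i) (V i))"
proof -
  have fin: "finite (Pow I)" using I by simp
  have pattern: "AE x in N. \<forall>I'\<in>Pow I. K \<subseteq> (\<Union>i\<in>I'. U i) \<longrightarrow>
      cexp (indicator K) x \<le> (\<Sum>i\<in>I'. cexp (indicator (U i)) x)"
  proof (subst AE_finite_all[OF fin], rule ballI)
    fix I' assume I': "I' \<in> Pow I"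
    show "AE x in N. K \<subseteq> (\<Union>i\<in>I'. U i) \<longrightarrow>
        cexp (indicator K) x \<le> (\<Sum>i\<in>I'. cexp (indicator (U i)) x)"
    proof (cases "K \<subseteq> (\<Union>i\<in>I'. U i)")
      case True
      have finI': "finite I'" using I' I finite_subset by blast
      have int: "integrable N (indicator (U i) :: _ \<Rightarrow> real)" for i
        by (intro integrable_bounded_borel bounded_borel_indicator U)
      have le: "indicator K x \<le> (\<Sum>i\<in>I'. indicator (U i) x :: real)" for x
      proof (cases "x \<in> K")
        case True
        then obtain i where "i \<in> I'" "x \<in> U i" using \<open>K \<subseteq> _\<close> by auto
        then have "1 \<le> (\<Sum>i\<in>I'. indicator (U i) x :: real)"
          using finI' member_le_sum[of i I' "\<lambda>i. indicator (U i) x :: real"] by simp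
        then show ?thesis by (simp add: True)
      qed (simp add: sum_nonneg)
      have "AE x in N. cexp (indicator K) x \<le> cexp (\<lambda>x. \<Sum>i\<in>I'. indicator (U i) x) x"
        using le int by (intro real_cond_exp_mono) (auto intro!: Bochner_Integration.integrable_sum)
      moreover have "AE x in N. cexp (\<lambda>x. \<Sum>i\<in>I'. indicator (U i) x) x = (\<Sum>i\<in>I'. cexp (indicator (U i)) x)"
        by (rule real_cond_exp_sum[OF int])
      ultimately show ?thesis by eventually_elim simp
    qed simp
  qed
  have nonneg: "AE x in N. \<forall>i\<in>I. 0 \<le> cexp (indicator (U i)) x"
    using U by (subst AE_finite_all[OF I]) (auto intro!: real_cond_exp_pos)
  have "rectangle_mass N J K L \<le> (\<integral>x. (\<Sum>i\<in>I. cexp (indicator (U i)) x * indicator (V i) x) \<partial>N)"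
    unfolding rectangle_mass_def
  proof (rule integral_mono_AE)
    show "integrable N (\<lambda>x. cexp (indicator K) x * indicator L x)"
      by (intro cexp_integrable_mult bounded_borel_indicator) auto
    show "integrable N (\<lambda>x. \<Sum>i\<in>I. cexp (indicator (U i)) x * indicator (V i) x)"
      by (intro Bochner_Integration.integrable_sum cexp_integrable_mult bounded_borel_indicator U V)
    show "AE x in N. cexp (indicator K) x * indicator L x
        \<le> (\<Sum>i\<in>I. cexp (indicator (U i)) x * indicator (V i) x)"
      using pattern nonneg
    proof eventually_elim
      case (elim x)
      show ?case
      proof (cases "x \<in> L")
        case True
        define I' where "I' = {i\<in>I. x \<in> V i}"
        have "K \<subseteq> (\<Union>i\<in>I'. U i)" using cover True by (force simp: I'_def)
        then have "cexp (indicator K) x \<le> (\<Sum>i\<in>I'. cexp (indicator (U i)) x)"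
          using elim(1) by (auto simp: I'_def)
        also have "\<dots> = (\<Sum>i\<in>I. cexp (indicator (U i)) x * indicator (V i) x)"
          unfolding I'_def sum.inter_filter[OF I] by (intro sum.cong) auto
        finally show ?thesis using True by simp
      next
        case False
        then show ?thesis using elim(2) by (auto intro!: sum_nonneg)
      qed
    qed
  qed
  also have "\<dots> = (\<Sum>i\<in>I. rectangle_mass N J (U i) (V i))"
    unfolding rectangle_mass_def
    by (intro Bochner_Integration.integral_sum cexp_integrable_mult bounded_borel_indicator U V)
  finally show ?thesis .
qed

text \<open>
  The same argument for disjoint rectangles. A fibre over a point outside \<open>B\<close> is contained in the
  empty set instead of \<open>A\<close>, whence the two possible values of the set \<open>A'\<close> in the proof.
\<close>

lemma rectangle_mass_packing:
  assumes I: "finite I" and [measurable]: "A \<in> sets N" "B \<in> sets N"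
    and U: "\<And>i. U i \<in> sets N" and V: "\<And>i. V i \<in> sets N"
    and disj: "disjoint_family_on (\<lambda>i. U i \<times> V i) I" and inside: "\<And>i. i \<in> I \<Longrightarrow> U i \<times> V i \<subseteq> A \<times> B"
  shows "(\<Sum>i\<in>I. rectangle_mass N J (U i) (V i)) \<le> rectangle_mass N J A B"
proof -
  define A' where "A' b = (if b then A else {})" for b :: bool
  have A' [measurable]: "A' b \<in> sets N" for b by (simp add: A'_def)
  have fin: "finite (Pow I \<times> (UNIV :: bool set))" using I by simp
  have pattern: "AE x in N. \<forall>p\<in>Pow I \<times> UNIV. disjoint_family_on U (fst p) \<and> (\<Union>i\<in>fst p. U i) \<subseteq> A' (snd p) \<longrightarrow>
      (\<Sum>i\<in>fst p. cexp (indicator (U i)) x) \<le> cexp (indicator (A' (snd p))) x"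
  proof (subst AE_finite_all[OF fin], rule ballI)
    fix p assume p: "p \<in> Pow I \<times> (UNIV :: bool set)"
    obtain I' b where pe: "p = (I', b)" by (cases p)
    show "AE x in N. disjoint_family_on U (fst p) \<and> (\<Union>i\<in>fst p. U i) \<subseteq> A' (snd p) \<longrightarrow>
        (\<Sum>i\<in>fst p. cexp (indicator (U i)) x) \<le> cexp (indicator (A' (snd p))) x"
    proof (cases "disjoint_family_on U I' \<and> (\<Union>i\<in>I'. U i) \<subseteq> A' b")
      case True
      have I': "I' \<subseteq> I" using p pe by auto
      have finI': "finite I'" using I' I finite_subset by blast
      have int: "integrable N (indicator (U i) :: _ \<Rightarrow> real)" for i
        by (intro integrable_bounded_borel bounded_borel_indicator U)
      have le: "(\<Sum>i\<in>I'. indicator (U i) x :: real) \<le> indicator (A' b) x" for x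
      proof -
        have "(\<Sum>i\<in>I'. indicator (U i) x :: real) = indicator (\<Union>i\<in>I'. U i) x"
          using True finI' by (subst indicator_UN_disjoint) auto
        also have "\<dots> \<le> indicator (A' b) x" using True by (auto split: split_indicator)
        finally show ?thesis .
      qed
      have "AE x in N. cexp (\<lambda>x. \<Sum>i\<in>I'. indicator (U i) x) x \<le> cexp (indicator (A' b)) x"
        using le int by (intro real_cond_exp_mono) (auto intro!: Bochner_Integration.integrable_sum)
      moreover have "AE x in N. cexp (\<lambda>x. \<Sum>i\<in>I'. indicator (U i) x) x = (\<Sum>i\<in>I'. cexp (indicator (U i)) x)"
        by (rule real_cond_exp_sum[OF int])
      ultimately show ?thesis unfolding pe by eventually_elim simp
    next
      case False
      then show ?thesis unfolding pe by auto
    qed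
  qed
  have empty: "AE x in N. cexp (indicator {}) x = 0"
    using real_cond_exp_F_meas[of "indicator {}"] by simp
  have "(\<Sum>i\<in>I. rectangle_mass N J (U i) (V i))
      = (\<integral>x. (\<Sum>i\<in>I. cexp (indicator (U i)) x * indicator (V i) x) \<partial>N)"
    unfolding rectangle_mass_def
    by (intro Bochner_Integration.integral_sum[symmetric] cexp_integrable_mult bounded_borel_indicator U V)
  also have "\<dots> \<le> rectangle_mass N J A B"
    unfolding rectangle_mass_def
  proof (rule integral_mono_AE)
    show "integrable N (\<lambda>x. cexp (indicator A) x * indicator B x)"
      by (intro cexp_integrable_mult bounded_borel_indicator) auto
    show "integrable N (\<lambda>x. \<Sum>i\<in>I. cexp (indicator (U i)) x * indicator (V i) x)"
      by (intro Bochner_Integration.integrable_sum cexp_integrable_mult bounded_borel_indicator U V)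
    show "AE x in N. (\<Sum>i\<in>I. cexp (indicator (U i)) x * indicator (V i) x)
        \<le> cexp (indicator A) x * indicator B x"
      using pattern empty
    proof eventually_elim
      case (elim x)
      define I' where "I' = {i\<in>I. x \<in> V i}"
      have "disjoint_family_on U I'"
        using disj by (auto simp: disjoint_family_on_def I'_def)
      moreover have "(\<Union>i\<in>I'. U i) \<subseteq> A' (x \<in> B)"
        using inside by (auto simp: I'_def A'_def)
      ultimately have "(\<Sum>i\<in>I'. cexp (indicator (U i)) x) \<le> cexp (indicator (A' (x \<in> B))) x"
        using bspec[OF elim(1), of "(I', x \<in> B)"] by (auto simp: I'_def)
      moreover have "(\<Sum>i\<in>I'. cexp (indicator (U i)) x) = (\<Sum>i\<in>I. cexp (indicator (U i)) x * indicator (V i) x)"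
        unfolding I'_def sum.inter_filter[OF I] by (intro sum.cong) auto
      ultimately show ?case using elim(2) by (auto simp: A'_def split: if_splits)
    qed
  qed
  finally show ?thesis .
qed

lemma rectangle_mass_nonneg:
  assumes "A \<in> sets N" "B \<in> sets N" shows "0 \<le> rectangle_mass N J A B"
  using rectangle_mass_packing[of "{}" A B] assms by (simp add: disjoint_family_on_def)

lemma rectangle_mass_eq_prob:
  assumes [measurable]: "A \<in> sets N"
  shows "rectangle_mass N J A (space N) = prob A" "rectangle_mass N J (space N) A = prob A"
proof -
  have "rectangle_mass N J A (space N) = (\<integral>x. cexp (indicator A) x \<partial>N)"
    unfolding rectangle_mass_def by (intro Bochner_Integration.integral_cong) auto
  also have "\<dots> = (\<integral>x. indicator A x \<partial>N)"
    by (intro real_cond_exp_int integrable_bounded_borel bounded_borel_indicator) simp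
  finally show "rectangle_mass N J A (space N) = prob A" by simp
  have "(indicator (space J) :: _ \<Rightarrow> real) \<in> borel_measurable J" by simp
  moreover have "space J = space N" using sub by (simp add: subalgebra_def)
  ultimately have "AE x in N. cexp (indicator (space N)) x = indicator (space N) x"
    by (intro real_cond_exp_F_meas integrable_bounded_borel bounded_borel_indicator) simp_all
  then have "AE x in N. cexp (indicator (space N)) x = 1"
    using AE_space by eventually_elim simp
  then have "rectangle_mass N J (space N) A = (\<integral>x. indicator A x \<partial>N)"
    unfolding rectangle_mass_def by (intro integral_cong_AE) auto
  then show "rectangle_mass N J (space N) A = prob A" by simp
qed

lemma rectangle_mass_approx:
  assumes [measurable]: "A \<in> sets N" "B \<in> sets N" "A' \<in> sets N" "B' \<in> sets N"
  shows "rectangle_mass N J A B \<le> rectangle_mass N J A' B' + prob (A - A') + prob (B - B')"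
proof -
  define U where "U = (\<lambda>i :: nat. if i = 0 then A' else if i = 1 then A - A' else space N)"
  define V where "V = (\<lambda>i :: nat. if i = 0 then B' else if i = 1 then space N else B - B')"
  have "rectangle_mass N J A B \<le> (\<Sum>i\<in>{0, 1, 2}. rectangle_mass N J (U i) (V i))"
  proof (rule rectangle_mass_cover)
    show "A \<times> B \<subseteq> (\<Union>i\<in>{0, 1, 2}. U i \<times> V i)"
      using sets.sets_into_space[of A N] sets.sets_into_space[of B N] by (auto simp: U_def V_def)
  qed (auto simp: U_def V_def)
  also have "\<dots> = rectangle_mass N J A' B' + prob (A - A') + prob (B - B')"
    by (simp add: U_def V_def rectangle_mass_eq_prob)
  finally show ?thesis .
qed

text \<open>
  By regularity the rectangle can be replaced by a slightly smaller compact one and the covering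
  rectangles by slightly larger open ones; finitely many of these suffice, and the finite case
  applies.
\<close>

lemma rectangle_mass_countable_cover:
  assumes reg: "regular_measure N" and A: "A \<in> sets N" and B: "B \<in> sets N"
    and U: "\<And>n :: nat. U n \<in> sets N" and V: "\<And>n. V n \<in> sets N"
    and cover: "A \<times> B \<subseteq> (\<Union>n. U n \<times> V n)" and sm: "summable (\<lambda>n. rectangle_mass N J (U n) (V n))"
  shows "rectangle_mass N J A B \<le> (\<Sum>n. rectangle_mass N J (U n) (V n))"
proof (rule field_le_epsilon)
  fix e :: real assume "0 < e"
  obtain X where X: "topspace X = space N" "sets N \<subseteq> regular_sets X N"
    using reg by (auto simp: regular_measure_def)
  have inner: "\<exists>K. K \<in> sets N \<and> compactin X K \<and> K \<subseteq> C \<and> prob (C - K) < r"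
    if C: "C \<in> sets N" and r: "0 < r" for C r
  proof -
    have "C \<in> regular_sets X N" using C X by auto
    then obtain K O' where K: "K \<in> sets N" "O' \<in> sets N" "compactin X K" "K \<subseteq> C" "C \<subseteq> O'" "prob (O' - K) < r"
      by (rule regular_setsE[OF _ r]) (rule that)
    moreover have "prob (C - K) \<le> prob (O' - K)" using K C by (intro finite_measure_mono) auto
    ultimately show ?thesis by fastforce
  qed
  have outer: "\<exists>O'. O' \<in> sets N \<and> openin X O' \<and> C \<subseteq> O' \<and> prob (O' - C) < r"
    if C: "C \<in> sets N" and r: "0 < r" for C r
  proof -
    have "C \<in> regular_sets X N" using C X by auto
    then obtain K O' where K: "K \<in> sets N" "O' \<in> sets N" "openin X O'" "K \<subseteq> C" "C \<subseteq> O'" "prob (O' - K) < r"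
      by (rule regular_setsE[OF _ r]) (rule that)
    moreover have "prob (O' - C) \<le> prob (O' - K)" using K C by (intro finite_measure_mono) auto
    ultimately show ?thesis by fastforce
  qed
  obtain K L where K: "K \<in> sets N" "compactin X K" "K \<subseteq> A" "prob (A - K) < e / 4"
      and L: "L \<in> sets N" "compactin X L" "L \<subseteq> B" "prob (B - L) < e / 4"
    using inner[OF A, of "e / 4"] inner[OF B, of "e / 4"] \<open>0 < e\<close> by auto
  \<comment> \<open>Each of \<open>K\<close>, \<open>L\<close>, the family \<open>U'\<close> and the family \<open>V'\<close> may cost \<open>e / 4\<close> in total.\<close>
  define r where "r n = e / 4 * (1 / 2) ^ Suc n" for n
  have r: "0 < r n" for n using \<open>0 < e\<close> by (simp add: r_def)
  have "\<forall>n. \<exists>O'. O' \<in> sets N \<and> openin X O' \<and> U n \<subseteq> O' \<and> prob (O' - U n) < r n"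
    using outer[OF U r] by blast
  then obtain U' where U': "\<And>n. U' n \<in> sets N" "\<And>n. openin X (U' n)" "\<And>n. U n \<subseteq> U' n" "\<And>n. prob (U' n - U n) < r n"
    by metis
  have "\<forall>n. \<exists>O'. O' \<in> sets N \<and> openin X O' \<and> V n \<subseteq> O' \<and> prob (O' - V n) < r n"
    using outer[OF V r] by blast
  then obtain V' where V': "\<And>n. V' n \<in> sets N" "\<And>n. openin X (V' n)" "\<And>n. V n \<subseteq> V' n" "\<And>n. prob (V' n - V n) < r n"
    by metis
  have geo: "(\<lambda>n. e / 4 * (1 / 2) ^ Suc n) sums (e / 4 * 1)"
    by (intro sums_mult power_half_series)
  have r_sum: "summable r" "suminf r = e / 4"
    using geo by (simp_all add: sums_iff r_def[abs_def])
  have "compactin (prod_topology X X) (K \<times> L)" using K L by (simp add: compactin_Times)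
  moreover have "\<forall>O'\<in>range (\<lambda>n. U' n \<times> V' n). openin (prod_topology X X) O'"
    using U'(2) V'(2) by (auto simp: openin_prod_Times_iff)
  moreover have "K \<times> L \<subseteq> \<Union> (range (\<lambda>n. U' n \<times> V' n))"
  proof -
    have "K \<times> L \<subseteq> A \<times> B" using K(3) L(3) by (rule Sigma_mono)
    also have "\<dots> \<subseteq> (\<Union>n. U n \<times> V n)" by (rule cover)
    also have "\<dots> \<subseteq> (\<Union>n. U' n \<times> V' n)" using U'(3) V'(3) by (intro UN_mono Sigma_mono) auto
    finally show ?thesis .
  qed
  ultimately obtain \<F> where \<F>: "finite \<F>" "\<F> \<subseteq> range (\<lambda>n. U' n \<times> V' n)" "K \<times> L \<subseteq> \<Union> \<F>"
    unfolding compactin_def by meson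
  then obtain I where I: "finite I" "K \<times> L \<subseteq> (\<Union>i\<in>I. U' i \<times> V' i)"
    using finite_subset_image[OF \<F>(1,2)] by metis
  have "rectangle_mass N J A B \<le> rectangle_mass N J K L + prob (A - K) + prob (B - L)"
    using A B K L by (intro rectangle_mass_approx)
  also have "\<dots> \<le> rectangle_mass N J K L + e / 2" using K L by simp
  also have "rectangle_mass N J K L \<le> (\<Sum>i\<in>I. rectangle_mass N J (U' i) (V' i))"
    using K L U' V' I by (intro rectangle_mass_cover) auto
  also have "\<dots> \<le> (\<Sum>i\<in>I. rectangle_mass N J (U i) (V i) + r i + r i)"
  proof (rule sum_mono)
    fix i
    have "rectangle_mass N J (U' i) (V' i)
        \<le> rectangle_mass N J (U i) (V i) + prob (U' i - U i) + prob (V' i - V i)"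
      by (intro rectangle_mass_approx U V U' V')
    then show "rectangle_mass N J (U' i) (V' i) \<le> rectangle_mass N J (U i) (V i) + r i + r i"
      using U'(4)[of i] V'(4)[of i] by linarith
  qed
  also have "\<dots> = (\<Sum>i\<in>I. rectangle_mass N J (U i) (V i)) + 2 * sum r I"
    by (simp add: sum.distrib sum_distrib_left)
  also have "(\<Sum>i\<in>I. rectangle_mass N J (U i) (V i)) \<le> (\<Sum>n. rectangle_mass N J (U n) (V n))"
    using I U V by (intro sum_le_suminf sm rectangle_mass_nonneg) auto
  also have "sum r I \<le> e / 4"
    using sum_le_suminf[OF r_sum(1) I(1)] r r_sum(2) by (simp add: less_imp_le)
  finally show "rectangle_mass N J A B \<le> (\<Sum>n. rectangle_mass N J (U n) (V n)) + e"
    by simp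
qed

lemma rectangle_mass_suminf:
  assumes reg: "regular_measure N" and A: "A \<in> sets N" and B: "B \<in> sets N"
    and U: "\<And>n :: nat. U n \<in> sets N" and V: "\<And>n. V n \<in> sets N"
    and disj: "disjoint_family (\<lambda>n. U n \<times> V n)" and union: "(\<Union>n. U n \<times> V n) = A \<times> B"
  shows "(\<Sum>n. ennreal (rectangle_mass N J (U n) (V n))) = ennreal (rectangle_mass N J A B)"
proof -
  have nonneg: "0 \<le> rectangle_mass N J (U n) (V n)" for n using U V by (rule rectangle_mass_nonneg)
  have le: "(\<Sum>i<n. rectangle_mass N J (U i) (V i)) \<le> rectangle_mass N J A B" for n
  proof (rule rectangle_mass_packing)
    show "disjoint_family_on (\<lambda>i. U i \<times> V i) {..<n}"
      using disj by (auto simp: disjoint_family_on_def)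
    show "U i \<times> V i \<subseteq> A \<times> B" for i
      unfolding union[symmetric] by blast
  qed (simp_all add: A B U V)
  have sm: "summable (\<lambda>n. rectangle_mass N J (U n) (V n))"
    using nonneg le by (rule summableI_nonneg_bounded)
  have "(\<Sum>n. rectangle_mass N J (U n) (V n)) \<le> rectangle_mass N J A B"
    using sm le by (rule suminf_le_const)
  moreover have "rectangle_mass N J A B \<le> (\<Sum>n. rectangle_mass N J (U n) (V n))"
    using union by (intro rectangle_mass_countable_cover reg A B U V sm) auto
  ultimately have "(\<Sum>n. rectangle_mass N J (U n) (V n)) = rectangle_mass N J A B"
    by (rule order_antisym)
  then show ?thesis
    using suminf_ennreal_eq[OF nonneg summable_sums[OF sm]] by simp
qed

lemma semiring_rectangles:
  "semiring_of_sets (space N \<times> space N) {A \<times> B |A B. A \<in> sets N \<and> B \<in> sets N}"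
proof
  show "{A \<times> B |A B. A \<in> sets N \<and> B \<in> sets N} \<subseteq> Pow (space N \<times> space N)"
    using sets.sets_into_space by fastforce
  show "{} \<in> {A \<times> B |A B. A \<in> sets N \<and> B \<in> sets N}" by blast
  fix a b assume "a \<in> {A \<times> B |A B. A \<in> sets N \<and> B \<in> sets N}" "b \<in> {A \<times> B |A B. A \<in> sets N \<and> B \<in> sets N}"
  then obtain A B C D where ab: "a = A \<times> B" "b = C \<times> D" "A \<in> sets N" "B \<in> sets N" "C \<in> sets N" "D \<in> sets N"
    by blast
  then have "a \<inter> b = (A \<inter> C) \<times> (B \<inter> D)" by blast
  moreover have "A \<inter> C \<in> sets N" "B \<inter> D \<in> sets N" using ab by auto
  ultimately show "a \<inter> b \<in> {A \<times> B |A B. A \<in> sets N \<and> B \<in> sets N}" by blast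
  show "\<exists>Ca\<subseteq>{A \<times> B |A B. A \<in> sets N \<and> B \<in> sets N}. finite Ca \<and> disjoint Ca \<and> a - b = \<Union> Ca"
  proof (intro exI conjI)
    let ?C = "{(A - C) \<times> B, (A \<inter> C) \<times> (B - D)}"
    have "A - C \<in> sets N" "A \<inter> C \<in> sets N" "B - D \<in> sets N" using ab by auto
    then show "?C \<subseteq> {A \<times> B |A B. A \<in> sets N \<and> B \<in> sets N}" using ab(4) by blast
    show "finite ?C" by simp
    show "disjoint ?C" by (auto simp: disjoint_def)
    show "a - b = \<Union> ?C" using ab by auto
  qed
qed

lemma rel_product_exists:
  assumes reg: "regular_measure N"
  obtains P where "sets P = sets (N \<Otimes>\<^sub>M N)"
    "\<And>A B. A \<in> sets N \<Longrightarrow> B \<in> sets N \<Longrightarrow> emeasure P (A \<times> B) = ennreal (rectangle_mass N J A B)"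
proof -
  let ?R = "\<lambda>A B. A \<in> sets N \<and> B \<in> sets N"
  define P where "P = extend_measure (space N \<times> space N) {(A, B). ?R A B} (\<lambda>(A, B). A \<times> B)
    (\<lambda>(A, B). ennreal (rectangle_mass N J A B))"
  have zero: "rectangle_mass N J A B = 0" if "?R A B" "A \<times> B = {}" for A B
  proof -
    have "rectangle_mass N J A B \<le> (\<Sum>i\<in>({} :: nat set). rectangle_mass N J A B)"
      using that by (intro rectangle_mass_cover) auto
    then show ?thesis using rectangle_mass_nonneg[of A B] that by simp
  qed
  have em: "emeasure P (A \<times> B) = ennreal (rectangle_mass N J A B)" if "?R A B" for A B
  proof (rule extend_measure_caratheodory_pair[OF P_def that])
    show "semiring_of_sets (space N \<times> space N) {A \<times> B |A B. A \<in> sets N \<and> B \<in> sets N}"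
      by (rule semiring_rectangles)
    show "ennreal (rectangle_mass N J i j) = 0" if "?R i j" "i \<times> j = {}" for i j
      using zero[OF that] by simp
    show "ennreal (rectangle_mass N J i j) = ennreal (rectangle_mass N J k l)"
      if "?R i j" "?R k l" "i \<times> j = k \<times> l" for i j k l
    proof (cases "i \<times> j = {}")
      case True
      then show ?thesis using zero[OF that(1)] zero[OF that(2)] that(3) by metis
    next
      case False
      then show ?thesis using that(3) by (auto simp: times_eq_iff)
    qed
    show "(\<Sum>n. ennreal (rectangle_mass N J (A n) (B n))) = ennreal (rectangle_mass N J j k)"
      if "\<And>n. ?R (A n) (B n)" "?R j k" "disjoint_family (\<lambda>n. A n \<times> B n)" "(\<Union>i. A i \<times> B i) = j \<times> k"
      for A B :: "nat \<Rightarrow> 'a set" and j k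
      using that by (intro rectangle_mass_suminf reg) auto
  qed auto
  have "sets P = sets (N \<Otimes>\<^sub>M N)"
    unfolding P_def sets_pair_measure
    by (subst sets_extend_measure)
       (auto dest: sets.sets_into_space intro!: arg_cong2[where f = sigma_sets])
  then show thesis using that em by blast
qed

end

section \<open>Integration along measure preserving maps\<close>

text \<open>
  It suffices to test on indicators: after adding a constant, \<open>H\<close> and \<open>D\<close> are densities, and the
  image of the first measure under \<open>\<pi>\<close> is the second one.
\<close>

lemma integral_along_map_eq:
  assumes "prob_space P" "prob_space N" and \<pi> [measurable]: "\<pi> \<in> measurable P N" and push: "distr P N \<pi> = N"
    and H: "H \<in> bounded_borel P" and D: "D \<in> bounded_borel N"
    and sets_eq: "\<And>A. A \<in> sets N \<Longrightarrow> (\<integral>z. H z * indicator A (\<pi> z) \<partial>P) = (\<integral>x. D x * indicator A x \<partial>N)"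
    and a: "a \<in> bounded_borel N"
  shows "(\<integral>z. H z * a (\<pi> z) \<partial>P) = (\<integral>x. D x * a x \<partial>N)"
proof -
  interpret P: prob_space P by fact
  interpret N: prob_space N by fact
  obtain C1 where C1: "0 < C1" "\<And>x. x \<in> space P \<Longrightarrow> \<bar>H x\<bar> \<le> C1"
    using H by (rule bounded_borelE) (rule that)
  obtain C2 where C2: "0 < C2" "\<And>x. x \<in> space N \<Longrightarrow> \<bar>D x\<bar> \<le> C2"
    using D by (rule bounded_borelE) (rule that)
  define C where "C = C1 + C2"
  have posH: "0 \<le> H z + C" if "z \<in> space P" for z using C1(2)[OF that] C2(1) by (simp add: C_def)
  have posD: "0 \<le> D z + C" if "z \<in> space N" for z using C2(2)[OF that] C1(1) by (simp add: C_def)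
  note [measurable] = H[THEN bounded_borel_measurable] D[THEN bounded_borel_measurable]
    a[THEN bounded_borel_measurable]
  have a\<pi>: "(\<lambda>z. a (\<pi> z)) \<in> bounded_borel P" using bounded_borel_comp[OF a \<pi>] .
  have push_int: "(\<integral>z. b (\<pi> z) \<partial>P) = (\<integral>x. b x \<partial>N)" if "b \<in> borel_measurable N" for b :: "'b \<Rightarrow> real"
    using integral_distr[OF \<pi> that] push by simp
  have "distr (density P (\<lambda>z. ennreal (H z + C))) N \<pi> = density N (\<lambda>x. ennreal (D x + C))"
  proof (rule measure_eqI)
    fix A assume "A \<in> sets (distr (density P (\<lambda>z. ennreal (H z + C))) N \<pi>)"
    then have A [measurable]: "A \<in> sets N" by simp
    have ind: "(\<lambda>z. indicator A (\<pi> z) :: real) \<in> bounded_borel P"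
      using bounded_borel_comp[OF bounded_borel_indicator[OF A] \<pi>] .
    have "emeasure (distr (density P (\<lambda>z. ennreal (H z + C))) N \<pi>) A
        = (\<integral>\<^sup>+z. ennreal (H z + C) * indicator (\<pi> -` A \<inter> space P) z \<partial>P)"
      by (simp add: emeasure_distr emeasure_density)
    also have "\<dots> = (\<integral>\<^sup>+z. ennreal ((H z + C) * indicator A (\<pi> z)) \<partial>P)"
      by (intro nn_integral_cong) (auto split: split_indicator)
    also have "\<dots> = ennreal (\<integral>z. (H z + C) * indicator A (\<pi> z) \<partial>P)"
      using posH by (intro nn_integral_eq_integral P.integrable_bounded_borel bounded_borel_closure H ind) auto
    also have "(\<integral>z. (H z + C) * indicator A (\<pi> z) \<partial>P)
        = (\<integral>z. H z * indicator A (\<pi> z) + C * indicator A (\<pi> z) \<partial>P)"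
      by (simp add: distrib_right)
    also have "\<dots> = (\<integral>z. H z * indicator A (\<pi> z) \<partial>P) + (\<integral>z. C * indicator A (\<pi> z) \<partial>P)"
      by (intro Bochner_Integration.integral_add P.integrable_bounded_borel bounded_borel_closure H ind)
    also have "\<dots> = (\<integral>x. D x * indicator A x \<partial>N) + (\<integral>x. C * indicator A x \<partial>N)"
      using sets_eq[OF A] push_int[of "\<lambda>x. C * indicator A x"] by simp
    also have "\<dots> = (\<integral>x. D x * indicator A x + C * indicator A x \<partial>N)"
      by (intro Bochner_Integration.integral_add[symmetric] N.integrable_bounded_borel bounded_borel_closure D A)
    also have "\<dots> = (\<integral>x. (D x + C) * indicator A x \<partial>N)"
      by (simp add: distrib_right)
    also have "ennreal \<dots> = (\<integral>\<^sup>+x. ennreal ((D x + C) * indicator A x) \<partial>N)"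
      using posD by (intro nn_integral_eq_integral[symmetric] N.integrable_bounded_borel bounded_borel_closure D A) auto
    also have "\<dots> = emeasure (density N (\<lambda>x. ennreal (D x + C))) A"
      by (subst emeasure_density) (auto intro!: nn_integral_cong split: split_indicator)
    finally show "emeasure (distr (density P (\<lambda>z. ennreal (H z + C))) N \<pi>) A
        = emeasure (density N (\<lambda>x. ennreal (D x + C))) A" .
  qed simp
  moreover have "(\<integral>x. a x \<partial>distr (density P (\<lambda>z. ennreal (H z + C))) N \<pi>) = (\<integral>z. (H z + C) * a (\<pi> z) \<partial>P)"
    using posH by (simp add: integral_distr integral_density)
  moreover have "(\<integral>x. a x \<partial>density N (\<lambda>x. ennreal (D x + C))) = (\<integral>x. (D x + C) * a x \<partial>N)"
    using posD by (simp add: integral_density)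
  ultimately have eq: "(\<integral>z. (H z + C) * a (\<pi> z) \<partial>P) = (\<integral>x. (D x + C) * a x \<partial>N)"
    by simp
  have "(\<integral>z. (H z + C) * a (\<pi> z) \<partial>P) = (\<integral>z. H z * a (\<pi> z) + C * a (\<pi> z) \<partial>P)"
    by (simp add: distrib_right)
  also have "\<dots> = (\<integral>z. H z * a (\<pi> z) \<partial>P) + (\<integral>z. C * a (\<pi> z) \<partial>P)"
    by (intro Bochner_Integration.integral_add P.integrable_bounded_borel bounded_borel_closure H a\<pi>)
  also have "(\<integral>z. C * a (\<pi> z) \<partial>P) = (\<integral>x. C * a x \<partial>N)"
    by (intro push_int) simp
  finally have 1: "(\<integral>z. (H z + C) * a (\<pi> z) \<partial>P) = (\<integral>z. H z * a (\<pi> z) \<partial>P) + (\<integral>x. C * a x \<partial>N)" .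
  have "(\<integral>x. (D x + C) * a x \<partial>N) = (\<integral>x. D x * a x + C * a x \<partial>N)"
    by (simp add: distrib_right)
  also have "\<dots> = (\<integral>x. D x * a x \<partial>N) + (\<integral>x. C * a x \<partial>N)"
    by (intro Bochner_Integration.integral_add N.integrable_bounded_borel bounded_borel_closure D a)
  finally show ?thesis using eq 1 by simp
qed

text \<open>
  The value \<open>g z\<close> is the infimum of the rationals above it, and each set \<open>{g < q}\<close> is the preimage of
  a set \<open>A q\<close>; taking the infimum over all \<open>q\<close> with \<open>y \<in> A q\<close> defines \<open>D\<close>.
\<close>

lemma vimage_measurable_factor:
  fixes g :: "'a \<Rightarrow> real"
  assumes g: "g \<in> borel_measurable (vimage_algebra \<Omega> \<pi> N)" and \<pi>: "\<pi> \<in> \<Omega> \<rightarrow> space N"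
  obtains D where "D \<in> borel_measurable N" "\<And>z. z \<in> \<Omega> \<Longrightarrow> D (\<pi> z) = g z"
proof -
  have "\<exists>A. A \<in> sets N \<and> {z \<in> \<Omega>. g z < of_rat q} = \<pi> -` A \<inter> \<Omega>" for q
  proof -
    have "{z \<in> space (vimage_algebra \<Omega> \<pi> N). g z < of_rat q} \<in> sets (vimage_algebra \<Omega> \<pi> N)"
      using g by (simp only: borel_measurable_iff_less)
    then show ?thesis by (auto simp: sets_vimage_algebra2[OF \<pi>])
  qed
  then obtain A where A [measurable]: "\<And>q. A q \<in> sets N" and Aq: "\<And>q. {z \<in> \<Omega>. g z < of_rat q} = \<pi> -` A q \<inter> \<Omega>"
    by metis
  define E where "E y = (INF q. if y \<in> A q then ereal (of_rat q) else \<infinity>)" for y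
  have "E \<in> borel_measurable N" unfolding E_def by measurable
  then have "(\<lambda>y. real_of_ereal (E y)) \<in> borel_measurable N" by simp
  moreover have "real_of_ereal (E (\<pi> z)) = g z" if z: "z \<in> \<Omega>" for z
  proof -
    have iff: "\<pi> z \<in> A q \<longleftrightarrow> g z < of_rat q" for q using Aq[of q] z by blast
    have "E (\<pi> z) = ereal (g z)"
    proof (rule antisym)
      show "E (\<pi> z) \<le> ereal (g z)"
      proof (rule dense_ge)
        fix y assume "ereal (g z) < y"
        then obtain q where q: "ereal (g z) < ereal (of_rat q)" "ereal (of_rat q) < y"
          using ereal_dense3 by blast
        have "E (\<pi> z) \<le> (if \<pi> z \<in> A q then ereal (of_rat q) else \<infinity>)"
          unfolding E_def by (rule INF_lower) simp
        also have "\<dots> = ereal (of_rat q)" using q(1) by (simp add: iff)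
        finally show "E (\<pi> z) \<le> y" using q(2) by order
      qed
      show "ereal (g z) \<le> E (\<pi> z)"
        unfolding E_def by (rule INF_greatest) (simp add: iff)
    qed
    then show ?thesis by simp
  qed
  ultimately show thesis by (rule that)
qed

text \<open>
  The conditional expectation of \<open>H\<close> given \<open>\<pi>\<close> is measurable with respect to \<open>\<pi>\<close>, so it factors
  through \<open>\<pi>\<close>. The factor \<open>D\<close> lives on the target space, where it can be compared with other
  functions.
\<close>

lemma conditional_expectation_along_map:
  assumes "prob_space P" "prob_space N" and \<pi> [measurable]: "\<pi> \<in> measurable P N" and push: "distr P N \<pi> = N"
    and H: "H \<in> bounded_borel P"
  obtains D where "D \<in> bounded_borel N"
    "\<And>a. a \<in> bounded_borel N \<Longrightarrow> (\<integral>z. H z * a (\<pi> z) \<partial>P) = (\<integral>x. D x * a x \<partial>N)"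
proof -
  interpret P: prob_space P by fact
  let ?J = "vimage_algebra (space P) \<pi> N"
  have \<pi>': "\<pi> \<in> space P \<rightarrow> space N" using measurable_space[OF \<pi>] by auto
  have "subalgebra P ?J"
    unfolding subalgebra_def using \<pi>' measurable_sets[OF \<pi>] by (auto simp: sets_vimage_algebra2)
  then obtain g where g: "g \<in> borel_measurable ?J" "g \<in> bounded_borel P"
      "\<And>h. h \<in> borel_measurable ?J \<Longrightarrow> h \<in> bounded_borel P \<Longrightarrow> (\<integral>x. H x * h x \<partial>P) = (\<integral>x. g x * h x \<partial>P)"
    using bounded_cond_exp_version[OF assms(1) _ H] by metis
  obtain D0 where D0 [measurable]: "D0 \<in> borel_measurable N" and D0g: "\<And>z. z \<in> space P \<Longrightarrow> D0 (\<pi> z) = g z"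
    using vimage_measurable_factor[OF g(1) \<pi>'] by blast
  obtain C where C: "0 < C" "\<And>x. x \<in> space P \<Longrightarrow> \<bar>g x\<bar> \<le> C"
    using g(2) by (rule bounded_borelE) (rule that)
  define D where "D = (\<lambda>y. max (-C) (min C (D0 y)))"
  have [measurable]: "D \<in> borel_measurable N" unfolding D_def by measurable
  have D: "D \<in> bounded_borel N"
    using C(1) by (intro bounded_borelI[where C = C]) (auto simp: D_def)
  have Dg: "D (\<pi> z) = g z" if "z \<in> space P" for z
    using C(2)[OF that] D0g[OF that] by (auto simp: D_def)
  show thesis
  proof (rule that[OF D])
    fix a assume a: "a \<in> bounded_borel N"
    have aJ: "(\<lambda>z. a (\<pi> z)) \<in> borel_measurable ?J"
      using measurable_compose[OF measurable_vimage_algebra1[OF \<pi>'] bounded_borel_measurable[OF a]] .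
    have "(\<integral>z. H z * a (\<pi> z) \<partial>P) = (\<integral>z. g z * a (\<pi> z) \<partial>P)"
      by (rule g(3)[OF aJ bounded_borel_comp[OF a \<pi>]])
    also have "\<dots> = (\<integral>z. D (\<pi> z) * a (\<pi> z) \<partial>P)"
      by (intro Bochner_Integration.integral_cong) (auto simp: Dg)
    also have "\<dots> = (\<integral>x. D x * a x \<partial>distr P N \<pi>)"
      using bounded_borel_measurable[OF a] by (subst integral_distr) auto
    finally show "(\<integral>z. H z * a (\<pi> z) \<partial>P) = (\<integral>x. D x * a x \<partial>N)" by (simp add: push)
  qed
qed

section \<open>Relatively independent squares\<close>

text \<open>
  Two steps of the same kind, first with the second function an indicator and then with the first
  function fixed, extend the formula from rectangles to products of bounded functions.
\<close>

lemma (in sub_prob) rel_product_integral: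
  assumes sets_P: "sets P = sets (N \<Otimes>\<^sub>M N)"
    and em: "\<And>A B. A \<in> sets N \<Longrightarrow> B \<in> sets N \<Longrightarrow> emeasure P (A \<times> B) = ennreal (rectangle_mass N J A B)"
    and f: "f \<in> bounded_borel N" and g: "g \<in> bounded_borel N"
  shows "(\<integral>z. f (fst z) * g (snd z) \<partial>P) = (\<integral>x. cexp f x * cexp g x \<partial>N)"
proof -
  have space_P: "space P = space N \<times> space N"
    using sets_eq_imp_space_eq[OF sets_P] by (simp add: space_pair_measure)
  have [measurable]: "fst \<in> measurable P N" "snd \<in> measurable P N"
    using measurable_fst[of N N] measurable_snd[of N N] measurable_cong_sets[OF sets_P refl] by blast+
  have "emeasure P (space P) = 1"
    using em[of "space N" "space N"] rectangle_mass_eq_prob[of "space N"] by (simp add: space_P prob_space)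
  then interpret P: prob_space P by (rule prob_spaceI)
  have meas: "measure P (A \<times> B) = rectangle_mass N J A B" if "A \<in> sets N" "B \<in> sets N" for A B
    using em[OF that] rectangle_mass_nonneg[OF that] by (simp add: P.emeasure_eq_measure)
  have fst_push: "distr P N fst = N"
  proof (rule measure_eqI)
    fix A assume "A \<in> sets (distr P N fst)"
    then have A [measurable]: "A \<in> sets N" by simp
    have "fst -` A \<inter> space P = A \<times> space N" using sets.sets_into_space[OF A] by (auto simp: space_P)
    then show "emeasure (distr P N fst) A = emeasure N A"
      using em[OF A sets.top] rectangle_mass_eq_prob[OF A] by (simp add: emeasure_distr emeasure_eq_measure)
  qed simp
  have snd_push: "distr P N snd = N"
  proof (rule measure_eqI)
    fix A assume "A \<in> sets (distr P N snd)"
    then have A [measurable]: "A \<in> sets N" by simp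
    have "snd -` A \<inter> space P = space N \<times> A" using sets.sets_into_space[OF A] by (auto simp: space_P)
    then show "emeasure (distr P N snd) A = emeasure N A"
      using em[OF sets.top A] rectangle_mass_eq_prob[OF A] by (simp add: emeasure_distr emeasure_eq_measure)
  qed simp
  have fP: "(\<lambda>z. f (fst z)) \<in> bounded_borel P" by (rule bounded_borel_comp[OF f]) simp
  have version: "\<exists>D. D \<in> bounded_borel N \<and> (\<forall>b\<in>bounded_borel N. (\<integral>x. D x * b x \<partial>N) = (\<integral>x. cexp h x * b x \<partial>N))"
    if h: "h \<in> bounded_borel N" for h
  proof -
    obtain D where D: "D \<in> bounded_borel N" "AE x in N. cexp h x = D x"
      using bounded_cond_exp_version[OF prob_space_axioms sub h] by metis
    then show ?thesis
      using bounded_borel_measurable by (intro exI[of _ D] conjI ballI integral_cong_AE) (auto intro!: borel_measurable_times)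
  qed
  have step1: "(\<integral>z. f (fst z) * indicator B (snd z) \<partial>P) = (\<integral>x. cexp f x * indicator B x \<partial>N)"
    if B [measurable]: "B \<in> sets N" for B
  proof -
    have B': "(indicator B :: _ \<Rightarrow> real) \<in> bounded_borel N" by simp
    obtain D where D: "D \<in> bounded_borel N"
        "\<And>b. b \<in> bounded_borel N \<Longrightarrow> (\<integral>x. D x * b x \<partial>N) = (\<integral>x. cexp (indicator B) x * b x \<partial>N)"
      using version[OF B'] by blast
    have BP: "(\<lambda>z. indicator B (snd z) :: real) \<in> bounded_borel P"
      by (rule bounded_borel_comp[OF B']) simp
    have "(\<integral>z. indicator B (snd z) * f (fst z) \<partial>P) = (\<integral>x. D x * f x \<partial>N)"
    proof (rule integral_along_map_eq[OF P.prob_space_axioms prob_space_axioms _ fst_push BP D(1) _ f])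
      fix A assume A [measurable]: "A \<in> sets N"
      have "(\<integral>z. indicator B (snd z) * indicator A (fst z) \<partial>P) = (\<integral>z. indicator (A \<times> B) z \<partial>P :: real)"
        by (intro Bochner_Integration.integral_cong) (auto split: split_indicator)
      also have "\<dots> = measure P (A \<times> B)"
        using sets.sets_into_space[OF A] sets.sets_into_space[OF B] sets_P by (simp add: space_P inf.absorb1 Sigma_mono)
      also have "\<dots> = (\<integral>x. cexp (indicator A) x * indicator B x \<partial>N)"
        using meas[OF A B] by (simp add: rectangle_mass_def)
      also have "\<dots> = (\<integral>x. indicator A x * cexp (indicator B) x \<partial>N)"
        by (rule cexp_selfadjoint(1)) auto
      also have "\<dots> = (\<integral>x. D x * indicator A x \<partial>N)"
        using D(2)[of "indicator A"] by (simp add: mult.commute)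
      finally show "(\<integral>z. indicator B (snd z) * indicator A (fst z) \<partial>P) = (\<integral>x. D x * indicator A x \<partial>N)" .
    qed simp
    also have "\<dots> = (\<integral>x. cexp (indicator B) x * f x \<partial>N)" by (rule D(2)[OF f])
    also have "\<dots> = (\<integral>x. indicator B x * cexp f x \<partial>N)" by (rule cexp_selfadjoint(1)[OF B' f])
    finally show ?thesis by (simp add: mult.commute)
  qed
  obtain D where D: "D \<in> bounded_borel N"
      "\<And>b. b \<in> bounded_borel N \<Longrightarrow> (\<integral>x. D x * b x \<partial>N) = (\<integral>x. cexp f x * b x \<partial>N)"
    using version[OF f] by blast
  have "(\<integral>z. f (fst z) * g (snd z) \<partial>P) = (\<integral>x. D x * g x \<partial>N)"
    by (rule integral_along_map_eq[OF P.prob_space_axioms prob_space_axioms _ snd_push fP D(1) _ g])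
       (simp_all add: step1 D(2))
  also have "\<dots> = (\<integral>x. cexp f x * cexp g x \<partial>N)"
    using D(2)[OF g] cexp_selfadjoint(2)[OF f g] by simp
  finally show ?thesis .
qed

lemma pair_measure_eqI_rectangles:
  assumes "sets P = sets (N \<Otimes>\<^sub>M N)" "sets Q = sets (N \<Otimes>\<^sub>M N)" "prob_space P" "prob_space Q"
    and eq: "\<And>A B. A \<in> sets N \<Longrightarrow> B \<in> sets N \<Longrightarrow>
      (\<integral>z. indicator A (fst z) * indicator B (snd z) \<partial>P) = (\<integral>z. indicator A (fst z) * indicator B (snd z) \<partial>Q :: real)"
  shows "P = Q"
proof (rule measure_eqI_generator_eq[where E = "{A \<times> B |A B. A \<in> sets N \<and> B \<in> sets N}"
      and \<Omega> = "space N \<times> space N" and A = "\<lambda>_. space N \<times> space N"])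
  interpret P: prob_space P by fact
  interpret Q: prob_space Q by fact
  have sp: "space P = space N \<times> space N" "space Q = space N \<times> space N"
    using assms(1,2)[THEN sets_eq_imp_space_eq] by (simp_all add: space_pair_measure)
  have m: "(\<integral>z. indicator A (fst z) * indicator B (snd z) \<partial>R :: real) = measure R (A \<times> B)"
    if "A \<in> sets N" "B \<in> sets N" "space R = space N \<times> space N" for A B R
  proof -
    have "(\<integral>z. indicator A (fst z) * indicator B (snd z) \<partial>R :: real) = (\<integral>z. indicator (A \<times> B) z \<partial>R)"
      by (intro Bochner_Integration.integral_cong) (auto split: split_indicator)
    then show ?thesis
      using that sets.sets_into_space[OF that(1)] sets.sets_into_space[OF that(2)]
      by (simp add: inf.absorb1 Sigma_mono)
  qed
  show "Int_stable {A \<times> B |A B. A \<in> sets N \<and> B \<in> sets N}" by (rule Int_stable_pair_measure_generator)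
  show "{A \<times> B |A B. A \<in> sets N \<and> B \<in> sets N} \<subseteq> Pow (space N \<times> space N)"
    using sets.sets_into_space by fastforce
  show "sets P = sigma_sets (space N \<times> space N) {A \<times> B |A B. A \<in> sets N \<and> B \<in> sets N}"
    "sets Q = sigma_sets (space N \<times> space N) {A \<times> B |A B. A \<in> sets N \<and> B \<in> sets N}"
    using assms(1,2) by (simp_all add: sets_pair_measure)
  show "range (\<lambda>_. space N \<times> space N) \<subseteq> {A \<times> B |A B. A \<in> sets N \<and> B \<in> sets N}" by blast
  show "emeasure P X = emeasure Q X" if X: "X \<in> {A \<times> B |A B. A \<in> sets N \<and> B \<in> sets N}" for X
  proof -
    obtain A B where "X = A \<times> B" "A \<in> sets N" "B \<in> sets N" using X by blast
    then show ?thesis using m[of A B P] m[of A B Q] eq[of A B] sp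
      by (simp add: P.emeasure_eq_measure Q.emeasure_eq_measure)
  qed
  show "emeasure P (space N \<times> space N) \<noteq> \<infinity>" by simp
qed simp

definition is_rel_square :: "'a measure \<Rightarrow> ('a \<Rightarrow> 'a) \<Rightarrow> ('a \<times> 'a) measure \<Rightarrow> bool" where
  "is_rel_square N S P \<longleftrightarrow> sets P = sets (N \<Otimes>\<^sub>M N) \<and>
     (\<forall>f\<in>bounded_borel N. \<forall>f'\<in>bounded_borel N. (\<integral>z. f (fst z) * f' (snd z) \<partial>P) =
        (\<integral>y. real_cond_exp N (invariant_algebra N S) f y *
              real_cond_exp N (invariant_algebra N S) f' y \<partial>N))"

lemma is_rel_square_prob:
  assumes "prob_space N" "S \<in> measurable N N" "is_rel_square N S P"
  shows "prob_space P"
proof -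
  interpret sub_prob N "invariant_algebra N S"
    using assms subalgebra_invariant_algebra by (simp add: sub_prob_def sub_prob_axioms_def)
  have one: "(\<lambda>_. 1) \<in> bounded_borel N" by simp
  have "(\<integral>z. 1 * 1 \<partial>P) = (\<integral>y. cexp (\<lambda>_. 1) y * cexp (\<lambda>_. 1) y \<partial>N)"
    by (rule assms(3)[unfolded is_rel_square_def, THEN conjunct2, rule_format, OF one one])
  also have "\<dots> = (\<integral>y. cexp (\<lambda>_. 1) y * 1 \<partial>N)"
    by (rule cexp_selfadjoint(2)[OF one one])
  also have "\<dots> = 1" using real_cond_exp_int(2)[of "\<lambda>_. 1"] by (simp add: prob_space)
  finally have one': "measure P (space P) = 1" by simp
  then have "emeasure P (space P) \<noteq> \<top>" by (auto simp: measure_def)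
  then have "emeasure P (space P) = 1"
    using emeasure_eq_ennreal_measure[of P "space P"] one' by simp
  then show ?thesis by (rule prob_spaceI)
qed

lemma is_rel_square_rel_square:
  assumes "prob_space N" "regular_measure N" "S \<in> measurable N N"
  shows "is_rel_square N S (rel_square N S)"
proof -
  interpret sub_prob N "invariant_algebra N S"
    using assms subalgebra_invariant_algebra by (simp add: sub_prob_def sub_prob_axioms_def)
  obtain P where P: "sets P = sets (N \<Otimes>\<^sub>M N)"
      "\<And>A B. A \<in> sets N \<Longrightarrow> B \<in> sets N \<Longrightarrow>
        emeasure P (A \<times> B) = ennreal (rectangle_mass N (invariant_algebra N S) A B)"
    using rel_product_exists[OF assms(2)] by blast
  have ex: "is_rel_square N S P"
    unfolding is_rel_square_def using P rel_product_integral[OF P] by blast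
  have unique: "Q = P" if Q: "is_rel_square N S Q" for Q
  proof (rule pair_measure_eqI_rectangles)
    show "sets Q = sets (N \<Otimes>\<^sub>M N)" using Q by (simp add: is_rel_square_def)
    show "prob_space Q" "prob_space P" using is_rel_square_prob assms Q ex by blast+
    show "(\<integral>z. indicator A (fst z) * indicator B (snd z) \<partial>Q)
        = (\<integral>z. indicator A (fst z) * indicator B (snd z) \<partial>P :: real)"
      if "A \<in> sets N" "B \<in> sets N" for A B
      using Q ex bounded_borel_indicator[OF that(1)] bounded_borel_indicator[OF that(2)]
      unfolding is_rel_square_def by metis
  qed (fact P(1))
  have "rel_square N S = (THE P. is_rel_square N S P)"
    unfolding rel_square_def is_rel_square_def
    by (intro arg_cong[where f = The] ext) (auto simp: bounded_borel_iff)
  then show ?thesis using theI[of "is_rel_square N S", OF ex unique] by simp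
qed

lemma averages_const: "(\<lambda>n :: nat. (\<Sum>k<n. c) / real n) \<longlonglongrightarrow> (c :: real)"
proof (rule tendsto_eventually)
  show "\<forall>\<^sub>F n :: nat in sequentially. (\<Sum>k<n. c) / real n = c"
    using eventually_gt_at_top[of 0] by eventually_elim simp
qed

lemma measure_preservingI_integral:
  assumes "prob_space P" and R [measurable]: "R \<in> measurable P P" and sets_P: "sets P = sets (N \<Otimes>\<^sub>M N)"
    and eq: "\<And>A B. A \<in> sets N \<Longrightarrow> B \<in> sets N \<Longrightarrow>
      (\<integral>z. indicator A (fst (R z)) * indicator B (snd (R z)) \<partial>P)
      = (\<integral>z. indicator A (fst z) * indicator B (snd z) \<partial>P :: real)"
  shows "measure_preserving P R"
proof -
  interpret prob_space P by fact
  have [measurable]: "fst \<in> measurable P N" "snd \<in> measurable P N"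
    using measurable_fst[of N N] measurable_snd[of N N] measurable_cong_sets[OF sets_P refl] by blast+
  have "distr P P R = P"
  proof (rule pair_measure_eqI_rectangles)
    show "prob_space (distr P P R)" using R by (rule prob_space_distr)
    fix A B assume [measurable]: "A \<in> sets N" "B \<in> sets N"
    show "(\<integral>z. indicator A (fst z) * indicator B (snd z) \<partial>distr P P R)
        = (\<integral>z. indicator A (fst z) * indicator B (snd z) \<partial>P :: real)"
      by (subst integral_distr) (auto simp: eq)
  qed (simp_all add: sets_P prob_space_axioms)
  then show ?thesis by (simp add: measure_preserving_def)
qed

locale relative_square = prob_space N for N :: "'a measure" +
  fixes S :: "'a \<Rightarrow> 'a" and P :: "('a \<times> 'a) measure"
  assumes S: "measure_preserving N S" and square: "is_rel_square N S P"
begin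

lemma S_measurable [measurable]: "S \<in> measurable N N"
  using S by (rule measure_preserving_measurable)

sublocale sub_prob N "invariant_algebra N S"
  by unfold_locales (rule subalgebra_invariant_algebra[OF S_measurable])

sublocale P: prob_space P
  using is_rel_square_prob[OF prob_space_axioms S_measurable square] .

lemma sets_P: "sets P = sets (N \<Otimes>\<^sub>M N)"
  using square by (simp add: is_rel_square_def)

lemma space_P: "space P = space N \<times> space N"
  using sets_eq_imp_space_eq[OF sets_P] by (simp add: space_pair_measure)

lemma fst_measurable [measurable]: "fst \<in> measurable P N"
  and snd_measurable [measurable]: "snd \<in> measurable P N"
  using measurable_fst[of N N] measurable_snd[of N N] measurable_cong_sets[OF sets_P refl] by blast+

lemma bounded_borel_fst: "f \<in> bounded_borel N \<Longrightarrow> (\<lambda>z. f (fst z)) \<in> bounded_borel P"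
  by (rule bounded_borel_comp[OF _ fst_measurable])

lemma bounded_borel_snd: "f \<in> bounded_borel N \<Longrightarrow> (\<lambda>z. f (snd z)) \<in> bounded_borel P"
  by (rule bounded_borel_comp[OF _ snd_measurable])

lemma integral_square:
  assumes "f \<in> bounded_borel N" "g \<in> bounded_borel N"
  shows "(\<integral>z. f (fst z) * g (snd z) \<partial>P) = (\<integral>x. cexp f x * cexp g x \<partial>N)"
  using square assms by (simp add: is_rel_square_def)

lemma square_averages:
  assumes "f \<in> bounded_borel N" "g \<in> bounded_borel N"
  shows "(\<lambda>n. (\<Sum>k<n. \<integral>x. f x * g ((S ^^ k) x) \<partial>N) / real n) \<longlonglongrightarrow> (\<integral>z. f (fst z) * g (snd z) \<partial>P)"
  unfolding integral_square[OF assms] by (rule ergodic_averages_integral[OF prob_space_axioms S assms])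

lemma square_symmetric:
  assumes "f \<in> bounded_borel N" "g \<in> bounded_borel N"
  shows "(\<integral>z. f (fst z) * g (snd z) \<partial>P) = (\<integral>z. g (fst z) * f (snd z) \<partial>P)"
  unfolding integral_square[OF assms] integral_square[OF assms(2,1)] by (simp add: mult.commute)

lemma square_nonneg: "f \<in> bounded_borel N \<Longrightarrow> 0 \<le> (\<integral>z. f (fst z) * f (snd z) \<partial>P)"
  by (simp add: integral_square)

text \<open>
  A bounded version \<open>D\<close> of the conditional expectation of \<open>g\<close>. It turns integrals over the square
  into integrals over \<open>N\<close>, where the invariance of \<open>D\<close> can be exploited.
\<close>

lemma square_kernel:
  assumes g: "g \<in> bounded_borel N"
  obtains D where "D \<in> bounded_borel N" "AE x in N. D (S x) = D x"
    "\<And>f. f \<in> bounded_borel N \<Longrightarrow> (\<integral>z. f (fst z) * g (snd z) \<partial>P) = (\<integral>x. f x * D x \<partial>N)"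
    "\<And>h. h \<in> bounded_borel N \<Longrightarrow> AE x in N. h (S x) = h x \<Longrightarrow> (\<integral>x. g x * h x \<partial>N) = (\<integral>x. D x * h x \<partial>N)"
proof -
  obtain D where D: "D \<in> borel_measurable (invariant_algebra N S)" "D \<in> bounded_borel N"
      "AE x in N. cexp g x = D x"
      "\<And>h. h \<in> borel_measurable (invariant_algebra N S) \<Longrightarrow> h \<in> bounded_borel N \<Longrightarrow>
        (\<integral>x. g x * h x \<partial>N) = (\<integral>x. D x * h x \<partial>N)"
    using bounded_cond_exp_version[OF prob_space_axioms sub g] by blast
  note [measurable] = bounded_borel_measurable[OF D(2)]
  show thesis
  proof (rule that[OF D(2)])
    show "AE x in N. D (S x) = D x"
      using invariant_measurable_iff[of S N D] D(1) by simp
    fix f assume f: "f \<in> bounded_borel N"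
    have "(\<integral>z. f (fst z) * g (snd z) \<partial>P) = (\<integral>x. f x * cexp g x \<partial>N)"
      using integral_square[OF f g] cexp_selfadjoint[OF f g] by simp
    also have "\<dots> = (\<integral>x. f x * D x \<partial>N)"
      using D(3) bounded_borel_measurable[OF f] by (intro integral_cong_AE) auto
    finally show "(\<integral>z. f (fst z) * g (snd z) \<partial>P) = (\<integral>x. f x * D x \<partial>N)" .
  next
    fix h assume h: "h \<in> bounded_borel N" "AE x in N. h (S x) = h x"
    then have "h \<in> borel_measurable (invariant_algebra N S)"
      using invariant_measurable_iff[OF S_measurable bounded_borel_measurable[OF h(1)]] by simp
    then show "(\<integral>x. g x * h x \<partial>N) = (\<integral>x. D x * h x \<partial>N)" using h(1) by (rule D(4))
  qed
qed

lemma integral_fst: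
  assumes f: "f \<in> bounded_borel N"
  shows "(\<integral>z. f (fst z) \<partial>P) = (\<integral>x. f x \<partial>N)"
proof -
  have one: "(\<lambda>_. 1) \<in> bounded_borel N" by simp
  have "(\<lambda>n :: nat. (\<Sum>k<n. \<integral>x. f x * 1 \<partial>N) / real n) \<longlonglongrightarrow> (\<integral>z. f (fst z) * 1 \<partial>P)"
    by (rule square_averages[OF f one])
  moreover have "(\<lambda>n :: nat. (\<Sum>k<n. \<integral>x. f x * 1 \<partial>N) / real n) \<longlonglongrightarrow> (\<integral>x. f x \<partial>N)"
    using averages_const[of "\<integral>x. f x \<partial>N"] by simp
  ultimately show ?thesis using LIMSEQ_unique by simp
qed

lemma integral_snd:
  assumes f: "f \<in> bounded_borel N"
  shows "(\<integral>z. f (snd z) \<partial>P) = (\<integral>x. f x \<partial>N)"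
  using square_symmetric[OF f bounded_borel_const[of 1]] integral_fst[OF f] by simp

lemma distr_fst: "distr P N fst = N"
  and distr_snd: "distr P N snd = N"
proof -
  have "distr P N fst = N \<and> distr P N snd = N"
  proof (intro conjI measure_eqI)
    fix A assume "A \<in> sets (distr P N fst)"
    then have A [measurable]: "A \<in> sets N" by simp
    have "measure P (fst -` A \<inter> space P) = (\<integral>z. indicator A (fst z) \<partial>P)"
      by (subst Bochner_Integration.integral_indicator[symmetric])
         (auto intro!: Bochner_Integration.integral_cong split: split_indicator simp flip: Bochner_Integration.integral_indicator)
    also have "\<dots> = measure N A" using integral_fst[of "indicator A"] by simp
    finally show "emeasure (distr P N fst) A = emeasure N A"
      by (simp add: emeasure_distr P.emeasure_eq_measure emeasure_eq_measure)
  next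
    fix A assume "A \<in> sets (distr P N snd)"
    then have A [measurable]: "A \<in> sets N" by simp
    have "measure P (snd -` A \<inter> space P) = (\<integral>z. indicator A (snd z) \<partial>P)"
      by (subst Bochner_Integration.integral_indicator[symmetric])
         (auto intro!: Bochner_Integration.integral_cong split: split_indicator simp flip: Bochner_Integration.integral_indicator)
    also have "\<dots> = measure N A" using integral_snd[of "indicator A"] by simp
    finally show "emeasure (distr P N snd) A = emeasure N A"
      by (simp add: emeasure_distr P.emeasure_eq_measure emeasure_eq_measure)
  qed simp_all
  then show "distr P N fst = N" "distr P N snd = N" by blast+
qed

lemmas AE_fst = AE_along_map[OF fst_measurable distr_fst]
lemmas AE_snd = AE_along_map[OF snd_measurable distr_snd]

lemma AE_from_fst:
  assumes "AE z in P. Q (fst z)" "{x \<in> space N. Q x} \<in> sets N"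
  shows "AE x in N. Q x"
proof -
  have "AE x in distr P N fst. Q x" using assms by (subst AE_distr_iff) auto
  then show ?thesis by (simp only: distr_fst)
qed

text \<open>
  Expanding the nonnegative square of \<open>f - c g\<close> with \<open>c = \<integral>f(u) g(v)\<close>.
\<close>

lemma square_Cauchy_Schwarz:
  assumes f: "f \<in> bounded_borel N" and g: "g \<in> bounded_borel N" and g1: "\<And>x. x \<in> space N \<Longrightarrow> \<bar>g x\<bar> \<le> 1"
  shows "(\<integral>z. f (fst z) * g (snd z) \<partial>P)\<^sup>2 \<le> (\<integral>z. f (fst z) * f (snd z) \<partial>P)"
proof -
  define c where "c = (\<integral>z. f (fst z) * g (snd z) \<partial>P)"
  define h where "h = (\<lambda>x. f x - c * g x)"
  have h: "h \<in> bounded_borel N" unfolding h_def by (intro bounded_borel_closure f g)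
  have gg: "(\<integral>z. g (fst z) * g (snd z) \<partial>P) \<le> 1"
  proof -
    have "(\<integral>z. g (fst z) * g (snd z) \<partial>P) \<le> (\<integral>z. 1 \<partial>P)"
    proof (rule integral_mono)
      fix z assume "z \<in> space P"
      then have "\<bar>g (fst z)\<bar> \<le> 1" "\<bar>g (snd z)\<bar> \<le> 1" using g1 by (auto simp: space_P)
      then have "\<bar>g (fst z) * g (snd z)\<bar> \<le> 1" unfolding abs_mult by (intro mult_le_one) auto
      then show "g (fst z) * g (snd z) \<le> 1" by linarith
    qed (auto intro!: P.integrable_bounded_borel bounded_borel_mult bounded_borel_fst bounded_borel_snd g)
    then show ?thesis by (simp add: P.prob_space)
  qed
  have "(\<integral>z. h (fst z) * h (snd z) \<partial>P)
      = (\<integral>z. f (fst z) * f (snd z) - c * (f (fst z) * g (snd z)) - c * (g (fst z) * f (snd z))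
            + c * c * (g (fst z) * g (snd z)) \<partial>P)"
    by (intro Bochner_Integration.integral_cong) (auto simp: h_def algebra_simps)
  also have "\<dots> = (\<integral>z. f (fst z) * f (snd z) \<partial>P) - c * (\<integral>z. f (fst z) * g (snd z) \<partial>P)
      - c * (\<integral>z. g (fst z) * f (snd z) \<partial>P) + c * c * (\<integral>z. g (fst z) * g (snd z) \<partial>P)"
    by (simp add: Bochner_Integration.integral_add Bochner_Integration.integral_diff
        P.integrable_bounded_borel bounded_borel_closure bounded_borel_fst bounded_borel_snd f g)
  also have "\<dots> = (\<integral>z. f (fst z) * f (snd z) \<partial>P) - 2 * c\<^sup>2 + c\<^sup>2 * (\<integral>z. g (fst z) * g (snd z) \<partial>P)"
    using square_symmetric[OF f g] by (simp add: c_def power2_eq_square)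
  also have "\<dots> \<le> (\<integral>z. f (fst z) * f (snd z) \<partial>P) - 2 * c\<^sup>2 + c\<^sup>2 * 1"
    using gg by (intro add_left_mono mult_left_mono) auto
  finally show ?thesis using square_nonneg[OF h] by (simp add: c_def)
qed

lemma map_prod_measurable_P:
  assumes "R \<in> measurable N N" "R' \<in> measurable N N"
  shows "map_prod R R' \<in> measurable P P"
proof -
  have "(\<lambda>z. (R (fst z), R' (snd z))) \<in> measurable P (N \<Otimes>\<^sub>M N)"
    using assms by measurable
  then have "(\<lambda>z. (R (fst z), R' (snd z))) \<in> measurable P P"
    using measurable_cong_sets[OF refl sets_P] by blast
  then show ?thesis by (simp add: map_prod_def case_prod_beta')
qed

lemma funpow_commute_on_space:
  assumes "R \<in> measurable N N" "\<And>x. x \<in> space N \<Longrightarrow> R (S x) = S (R x)" "x \<in> space N"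
  shows "(S ^^ k) (R x) = R ((S ^^ k) x)"
  using assms funpow_in_space[OF S_measurable assms(3)] by (induction k) auto

text \<open>
  A map that commutes with \<open>S\<close> preserves each integral \<open>\<integral>f (g \<circ> S\<^sup>k)\<close>, hence also the limit of
  their averages, which is the integral over the square.
\<close>

lemma measure_preserving_both:
  assumes R: "measure_preserving N R" and comm: "\<And>x. x \<in> space N \<Longrightarrow> R (S x) = S (R x)"
  shows "measure_preserving P (map_prod R R)"
proof (rule measure_preservingI_integral[OF P.prob_space_axioms _ sets_P])
  have R' [measurable]: "R \<in> measurable N N" using R by (rule measure_preserving_measurable)
  show "map_prod R R \<in> measurable P P" by (intro map_prod_measurable_P R')
  fix A B assume A [measurable]: "A \<in> sets N" and B [measurable]: "B \<in> sets N"
  let ?f = "indicator A :: _ \<Rightarrow> real" and ?g = "indicator B :: _ \<Rightarrow> real"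
  have fg: "?f \<in> bounded_borel N" "?g \<in> bounded_borel N" by auto
  have fgR: "(\<lambda>x. ?f (R x)) \<in> bounded_borel N" "(\<lambda>x. ?g (R x)) \<in> bounded_borel N"
    using bounded_borel_comp[OF fg(1) R'] bounded_borel_comp[OF fg(2) R'] by auto
  have [measurable]: "(S ^^ k) \<in> measurable N N" for k
    using measure_preserving_funpow[OF S] by (rule measure_preserving_measurable)
  have "(\<integral>x. ?f (R x) * ?g (R ((S ^^ k) x)) \<partial>N) = (\<integral>x. ?f x * ?g ((S ^^ k) x) \<partial>N)" for k
  proof -
    have "(\<integral>x. ?f (R x) * ?g (R ((S ^^ k) x)) \<partial>N) = (\<integral>x. ?f (R x) * ?g ((S ^^ k) (R x)) \<partial>N)"
      by (intro Bochner_Integration.integral_cong) (simp_all add: funpow_commute_on_space R' comm)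
    also have "\<dots> = (\<integral>x. ?f x * ?g ((S ^^ k) x) \<partial>N)"
      by (rule measure_preserving_integral[OF R]) measurable
    finally show ?thesis .
  qed
  then have "(\<lambda>n. (\<Sum>k<n. \<integral>x. ?f x * ?g ((S ^^ k) x) \<partial>N) / real n)
      \<longlonglongrightarrow> (\<integral>z. ?f (R (fst z)) * ?g (R (snd z)) \<partial>P)"
    using square_averages[OF fgR] by simp
  then have "(\<integral>z. ?f (R (fst z)) * ?g (R (snd z)) \<partial>P) = (\<integral>z. ?f (fst z) * ?g (snd z) \<partial>P)"
    using square_averages[OF fg] by (rule LIMSEQ_unique)
  then show "(\<integral>z. ?f (fst (map_prod R R z)) * ?g (snd (map_prod R R z)) \<partial>P) = (\<integral>z. ?f (fst z) * ?g (snd z) \<partial>P)"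
    by simp
qed

lemma integral_square_shift:
  assumes f: "f \<in> bounded_borel N" and g: "g \<in> bounded_borel N"
  shows "(\<integral>z. f (S (fst z)) * g (snd z) \<partial>P) = (\<integral>z. f (fst z) * g (snd z) \<partial>P)"
proof -
  obtain D where D: "D \<in> bounded_borel N" "AE x in N. D (S x) = D x"
      "\<And>f. f \<in> bounded_borel N \<Longrightarrow> (\<integral>z. f (fst z) * g (snd z) \<partial>P) = (\<integral>x. f x * D x \<partial>N)"
    using square_kernel[OF g] by metis
  note [measurable] = bounded_borel_measurable[OF D(1)] bounded_borel_measurable[OF f]
  have "(\<integral>z. f (S (fst z)) * g (snd z) \<partial>P) = (\<integral>x. f (S x) * D x \<partial>N)"
    by (rule D(3)) (rule bounded_borel_comp[OF f S_measurable])
  also have "\<dots> = (\<integral>x. f (S x) * D (S x) \<partial>N)"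
    using D(2) by (intro integral_cong_AE) auto
  also have "\<dots> = (\<integral>x. f x * D x \<partial>N)"
    by (rule measure_preserving_integral[OF S]) measurable
  finally show ?thesis using D(3)[OF f] by simp
qed

lemma measure_preserving_first: "measure_preserving P (map_prod S id)"
proof (rule measure_preservingI_integral[OF P.prob_space_axioms _ sets_P])
  show "map_prod S id \<in> measurable P P" by (intro map_prod_measurable_P) auto
  fix A B assume "A \<in> sets N" "B \<in> sets N"
  then show "(\<integral>z. indicator A (fst (map_prod S id z)) * indicator B (snd (map_prod S id z)) \<partial>P)
      = (\<integral>z. indicator A (fst z) * indicator B (snd z) \<partial>P :: real)"
    using integral_square_shift[of "indicator A" "indicator B"] by simp
qed

lemma measure_preserving_second: "measure_preserving P (map_prod id S)"
proof (rule measure_preservingI_integral[OF P.prob_space_axioms _ sets_P])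
  show "map_prod id S \<in> measurable P P" by (intro map_prod_measurable_P) auto
  fix A B assume AB: "A \<in> sets N" "B \<in> sets N"
  let ?f = "indicator A :: _ \<Rightarrow> real" and ?g = "indicator B :: _ \<Rightarrow> real"
  have fg: "?f \<in> bounded_borel N" "?g \<in> bounded_borel N" using AB by auto
  have "(\<integral>z. ?f (fst z) * ?g (S (snd z)) \<partial>P) = (\<integral>z. ?g (S (fst z)) * ?f (snd z) \<partial>P)"
    by (rule square_symmetric[OF fg(1) bounded_borel_comp[OF fg(2) S_measurable]])
  also have "\<dots> = (\<integral>z. ?g (fst z) * ?f (snd z) \<partial>P)"
    by (rule integral_square_shift[OF fg(2,1)])
  also have "\<dots> = (\<integral>z. ?f (fst z) * ?g (snd z) \<partial>P)"
    by (rule square_symmetric[OF fg(2,1)])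
  finally show "(\<integral>z. ?f (fst (map_prod id S z)) * ?g (snd (map_prod id S z)) \<partial>P)
      = (\<integral>z. ?f (fst z) * ?g (snd z) \<partial>P)" by simp
qed

lemma AE_invariant_funpow:
  assumes "AE x in N. H (S x) = H x"
  shows "AE x in N. H ((S ^^ k) x) = H x"
proof (induction k)
  case (Suc k)
  have "AE x in N. H (S ((S ^^ k) x)) = H ((S ^^ k) x)"
    using assms by (rule measure_preserving_AE[OF measure_preserving_funpow[OF S]])
  then show ?case using Suc by eventually_elim simp
qed simp

text \<open>
  For invariant \<open>H\<close> the averages of \<open>\<integral>H (H \<circ> S\<^sup>k)\<close> are constant, so that \<open>\<integral>H(u) H(v) = \<integral>H\<^sup>2\<close> and
  the integral of \<open>(H(u) - H(v))\<^sup>2\<close> vanishes.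
\<close>

lemma invariant_coordinates_agree:
  assumes H: "H \<in> bounded_borel N" and inv: "AE x in N. H (S x) = H x"
  shows "AE z in P. H (fst z) = H (snd z)"
proof -
  have [measurable]: "H \<in> borel_measurable N" using H by (rule bounded_borel_measurable)
  have [measurable]: "(S ^^ k) \<in> measurable N N" for k
    using measure_preserving_funpow[OF S] by (rule measure_preserving_measurable)
  define G where "G = (\<lambda>z. H (fst z) - H (snd z))"
  have HH: "(\<lambda>x. H x * H x) \<in> bounded_borel N" by (intro bounded_borel_closure H)
  have G: "G \<in> bounded_borel P"
    unfolding G_def by (intro bounded_borel_closure bounded_borel_fst bounded_borel_snd H)
  have "(\<integral>x. H x * H ((S ^^ k) x) \<partial>N) = (\<integral>x. H x * H x \<partial>N)" for k
    using AE_invariant_funpow[OF inv, of k] by (intro integral_cong_AE) auto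
  then have "(\<lambda>n :: nat. (\<Sum>k<n. \<integral>x. H x * H x \<partial>N) / real n) \<longlonglongrightarrow> (\<integral>z. H (fst z) * H (snd z) \<partial>P)"
    using square_averages[OF H H] by simp
  moreover have "(\<lambda>n :: nat. (\<Sum>k<n. \<integral>x. H x * H x \<partial>N) / real n) \<longlonglongrightarrow> (\<integral>x. H x * H x \<partial>N)"
    by (rule averages_const)
  ultimately have cross: "(\<integral>z. H (fst z) * H (snd z) \<partial>P) = (\<integral>x. H x * H x \<partial>N)"
    by (rule LIMSEQ_unique)
  have "(\<integral>z. G z * G z \<partial>P)
      = (\<integral>z. H (fst z) * H (fst z) + H (snd z) * H (snd z) - 2 * (H (fst z) * H (snd z)) \<partial>P)"
    by (intro Bochner_Integration.integral_cong) (auto simp: G_def algebra_simps)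
  also have "\<dots> = (\<integral>z. H (fst z) * H (fst z) \<partial>P) + (\<integral>z. H (snd z) * H (snd z) \<partial>P)
      - 2 * (\<integral>z. H (fst z) * H (snd z) \<partial>P)"
    by (simp add: Bochner_Integration.integral_add Bochner_Integration.integral_diff
        P.integrable_bounded_borel bounded_borel_closure bounded_borel_fst bounded_borel_snd H)
  also have "\<dots> = 0"
    using integral_fst[OF HH] integral_snd[OF HH] cross by simp
  finally have "AE z in P. G z = 0"
    by (rule AE_zero_of_square_integral[OF P.prob_space_axioms G])
  then show ?thesis by (simp add: G_def)
qed

text \<open>
  Averaging over \<open>id \<times> S\<close> leaves \<open>B\<close> unchanged and replaces a function of \<open>v\<close> by its conditional
  expectation, which has the same value at \<open>u\<close> as at \<open>v\<close>. So \<open>B\<close> integrates against products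
  \<open>a(u) b(v)\<close> as its conditional expectation given \<open>u\<close> does.
\<close>

lemma invariant_second_factor:
  assumes B: "B \<in> bounded_borel P" and inv: "AE z in P. B (map_prod id S z) = B z"
  obtains D where "D \<in> bounded_borel N" "AE z in P. B z = D (fst z)"
proof -
  have [measurable]: "B \<in> borel_measurable P" using B by (rule bounded_borel_measurable)
  have Sk [measurable]: "(S ^^ k) \<in> measurable N N" for k
    using measure_preserving_funpow[OF S] by (rule measure_preserving_measurable)
  have idSk: "map_prod id S ^^ k = map_prod id (S ^^ k)" for k
    by (induction k) (auto simp: fun_eq_iff map_prod_def)
  have mpk: "measure_preserving P (map_prod id (S ^^ k))" for k
    using measure_preserving_funpow[OF measure_preserving_second, of k] by (simp add: idSk)
  have inv_k: "AE z in P. B (map_prod id (S ^^ k) z) = B z" for k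
  proof (induction k)
    case 0
    then show ?case by (simp add: map_prod_def)
  next
    case (Suc k)
    have "AE z in P. B (map_prod id S (map_prod id (S ^^ k) z)) = B (map_prod id (S ^^ k) z)"
      using inv by (rule measure_preserving_AE[OF mpk])
    then show ?case using Suc by eventually_elim (simp add: map_prod_def split_beta)
  qed
  obtain D where D: "D \<in> bounded_borel N"
      "\<And>a. a \<in> bounded_borel N \<Longrightarrow> (\<integral>z. B z * a (fst z) \<partial>P) = (\<integral>x. D x * a x \<partial>N)"
    using conditional_expectation_along_map[OF P.prob_space_axioms prob_space_axioms fst_measurable distr_fst B]
    by metis
  define G where "G = (\<lambda>z. B z - D (fst z))"
  have G: "G \<in> bounded_borel P"
    unfolding G_def by (intro bounded_borel_closure bounded_borel_fst B D)
  have test: "(\<integral>z. B z * (a (fst z) * b (snd z)) \<partial>P) = (\<integral>z. D (fst z) * (a (fst z) * b (snd z)) \<partial>P)"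
    if a: "a \<in> bounded_borel N" and b: "b \<in> bounded_borel N" for a b
  proof -
    note [measurable] = a[THEN bounded_borel_measurable] b[THEN bounded_borel_measurable]
      D(1)[THEN bounded_borel_measurable]
    have Ba: "(\<lambda>z. B z * a (fst z)) \<in> bounded_borel P"
      by (intro bounded_borel_closure bounded_borel_fst B a)
    have Da: "(\<lambda>x. D x * a x) \<in> bounded_borel N" by (intro bounded_borel_closure D a)
    obtain Eb where Eb: "Eb \<in> bounded_borel N" "AE x in N. Eb (S x) = Eb x"
        "\<And>f. f \<in> bounded_borel N \<Longrightarrow> (\<integral>z. f (fst z) * b (snd z) \<partial>P) = (\<integral>x. f x * Eb x \<partial>N)"
      using square_kernel[OF b] by metis
    note [measurable] = Eb(1)[THEN bounded_borel_measurable]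
    obtain D' where D': "D' \<in> bounded_borel N"
        "\<And>c. c \<in> bounded_borel N \<Longrightarrow> (\<integral>z. B z * a (fst z) * c (snd z) \<partial>P) = (\<integral>x. D' x * c x \<partial>N)"
      using conditional_expectation_along_map[OF P.prob_space_axioms prob_space_axioms snd_measurable distr_snd Ba]
      by metis
    have const: "(\<integral>x. D' x * b ((S ^^ k) x) \<partial>N) = (\<integral>z. B z * a (fst z) * b (snd z) \<partial>P)" for k
    proof -
      have "(\<integral>x. D' x * b ((S ^^ k) x) \<partial>N) = (\<integral>z. B z * a (fst z) * b ((S ^^ k) (snd z)) \<partial>P)"
        using D'(2)[OF bounded_borel_comp[OF b Sk[of k]]] by simp
      also have "\<dots> = (\<integral>z. B (map_prod id (S ^^ k) z) * a (fst (map_prod id (S ^^ k) z)) * b (snd (map_prod id (S ^^ k) z)) \<partial>P)"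
        using inv_k[of k] mpk[of k, THEN measure_preserving_measurable] by (intro integral_cong_AE) auto
      also have "\<dots> = (\<integral>z. B z * a (fst z) * b (snd z) \<partial>P)"
        by (rule measure_preserving_integral[OF mpk]) measurable
      finally show ?thesis .
    qed
    have "(\<lambda>n :: nat. (\<Sum>k<n. \<integral>z. B z * a (fst z) * b (snd z) \<partial>P) / real n) \<longlonglongrightarrow> (\<integral>z. D' (fst z) * b (snd z) \<partial>P)"
      using square_averages[OF D'(1) b] const by simp
    moreover have "(\<lambda>n :: nat. (\<Sum>k<n. \<integral>z. B z * a (fst z) * b (snd z) \<partial>P) / real n)
        \<longlonglongrightarrow> (\<integral>z. B z * a (fst z) * b (snd z) \<partial>P)"
      by (rule averages_const)
    ultimately have "(\<integral>z. B z * a (fst z) * b (snd z) \<partial>P) = (\<integral>z. D' (fst z) * b (snd z) \<partial>P)"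
      using LIMSEQ_unique by blast
    also have "\<dots> = (\<integral>x. D' x * Eb x \<partial>N)" by (rule Eb(3)[OF D'(1)])
    also have "\<dots> = (\<integral>z. B z * a (fst z) * Eb (snd z) \<partial>P)" by (rule D'(2)[OF Eb(1), symmetric])
    also have "\<dots> = (\<integral>z. B z * (a (fst z) * Eb (fst z)) \<partial>P)"
      using invariant_coordinates_agree[OF Eb(1,2)] by (intro integral_cong_AE) auto
    also have "\<dots> = (\<integral>x. D x * (a x * Eb x) \<partial>N)"
      by (rule D(2)) (intro bounded_borel_closure a Eb)
    also have "\<dots> = (\<integral>x. D x * a x * Eb x \<partial>N)" by (simp add: mult.assoc)
    also have "\<dots> = (\<integral>z. D (fst z) * a (fst z) * b (snd z) \<partial>P)"
      by (rule Eb(3)[OF Da, symmetric])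
    finally show ?thesis by (simp add: mult.assoc)
  qed
  have "AE z in P. G z = 0"
  proof (rule AE_zero_on_generator[OF P.prob_space_axioms G])
    show "Int_stable {A \<times> C |A C. A \<in> sets N \<and> C \<in> sets N}" by (rule Int_stable_pair_measure_generator)
    show "{A \<times> C |A C. A \<in> sets N \<and> C \<in> sets N} \<subseteq> Pow (space P)"
      using sets.sets_into_space by (fastforce simp: space_P)
    show "space P \<in> {A \<times> C |A C. A \<in> sets N \<and> C \<in> sets N}" by (auto simp: space_P)
    show "sets P = sigma_sets (space P) {A \<times> C |A C. A \<in> sets N \<and> C \<in> sets N}"
      by (simp add: sets_P space_P sets_pair_measure)
    fix R assume "R \<in> {A \<times> C |A C. A \<in> sets N \<and> C \<in> sets N}"
    then obtain A C where R: "R = A \<times> C" and AC: "A \<in> sets N" "C \<in> sets N" by blast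
    then have ac: "(indicator A :: _ \<Rightarrow> real) \<in> bounded_borel N" "(indicator C :: _ \<Rightarrow> real) \<in> bounded_borel N" by auto
    have "(\<integral>z. G z * indicator R z \<partial>P)
        = (\<integral>z. B z * (indicator A (fst z) * indicator C (snd z)) - D (fst z) * (indicator A (fst z) * indicator C (snd z)) \<partial>P)"
      unfolding R by (intro Bochner_Integration.integral_cong) (auto simp: G_def split: split_indicator)
    also have "\<dots> = 0"
      using test[OF ac]
      by (subst Bochner_Integration.integral_diff)
         (auto intro!: P.integrable_bounded_borel bounded_borel_mult bounded_borel_fst bounded_borel_snd B D(1) AC)
    finally show "(\<integral>z. G z * indicator R z \<partial>P) = 0" .
  qed
  then have "AE z in P. B z = D (fst z)" by (simp add: G_def)
  then show thesis using D(1) that by blast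
qed

end

section \<open>Cubes and their faces\<close>

lemma finite_cube [simp]: "finite (cube k)"
  using finite_lists_length_eq[of "UNIV :: bool set" k] by (simp add: cube_def)

lemma cube_0: "cube 0 = {[]}"
  by (auto simp: cube_def)

lemma snoc_in_cube [simp]: "\<eta> @ [b] \<in> cube (Suc k) \<longleftrightarrow> \<eta> \<in> cube k"
  by (simp add: cube_def)

lemma replicate_in_cube [simp]: "replicate k b \<in> cube k"
  by (simp add: cube_def)

lemma cube_SucE:
  assumes "\<epsilon> \<in> cube (Suc k)"
  obtains \<eta> b where "\<epsilon> = \<eta> @ [b]" "\<eta> \<in> cube k"
  using assms by (cases \<epsilon> rule: rev_cases) (auto simp: cube_def)

lemma cube_Suc: "cube (Suc k) = (\<lambda>\<eta>. \<eta> @ [False]) ` cube k \<union> (\<lambda>\<eta>. \<eta> @ [True]) ` cube k"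
proof safe
  fix \<epsilon> assume "\<epsilon> \<in> cube (Suc k)" "\<epsilon> \<notin> (\<lambda>\<eta>. \<eta> @ [True]) ` cube k"
  then show "\<epsilon> \<in> (\<lambda>\<eta>. \<eta> @ [False]) ` cube k"
    by (elim cube_SucE) (metis (full_types) imageI)
qed auto

lemma prod_cube_Suc:
  "(\<Prod>\<epsilon>\<in>cube (Suc k). h \<epsilon>) = (\<Prod>\<eta>\<in>cube k. h (\<eta> @ [False])) * (\<Prod>\<eta>\<in>cube k. h (\<eta> @ [True]) :: real)"
  unfolding cube_Suc
  by (subst prod.union_disjoint) (auto simp: prod.reindex inj_on_def)

lemma glue_snoc: "\<eta> \<in> cube k \<Longrightarrow> glue k z (\<eta> @ [b]) = (if b then snd z \<eta> else fst z \<eta>)"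
  by (simp add: glue_def)

text \<open>
  Diagonal maps, side transformations and their mirror images are all of the following form.
\<close>

definition face_map :: "nat \<Rightarrow> ('a \<Rightarrow> 'a) \<Rightarrow> bool list set \<Rightarrow> (bool list \<Rightarrow> 'a) \<Rightarrow> (bool list \<Rightarrow> 'a)" where
  "face_map k S A x = (\<lambda>\<epsilon>\<in>cube k. if \<epsilon> \<in> A then S (x \<epsilon>) else x \<epsilon>)"

lemma face_map_apply: "\<epsilon> \<in> cube k \<Longrightarrow> face_map k S A x \<epsilon> = (if \<epsilon> \<in> A then S (x \<epsilon>) else x \<epsilon>)"
  by (simp add: face_map_def)

lemma diagonal_map_eq: "diagonal_map k S = face_map k S UNIV"
  by (simp add: fun_eq_iff diagonal_map_def face_map_def)

lemma side_map_eq: "side_map d T i = face_map d (T i) {\<epsilon>. \<epsilon> ! i = False}"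
  by (auto simp: fun_eq_iff side_map_def face_map_def restrict_def)

lemma face_map_cong: "(\<And>\<epsilon>. \<epsilon> \<in> cube k \<Longrightarrow> \<epsilon> \<in> A \<longleftrightarrow> \<epsilon> \<in> A') \<Longrightarrow> face_map k S A = face_map k S A'"
  by (auto simp: fun_eq_iff face_map_def restrict_def)

lemma face_map_measurable:
  assumes "S \<in> measurable M M"
  shows "face_map k S A \<in> measurable (PiM (cube k) (\<lambda>_. M)) (PiM (cube k) (\<lambda>_. M))"
  unfolding face_map_def
proof (rule measurable_restrict)
  fix \<epsilon> assume "\<epsilon> \<in> cube k"
  then have "(\<lambda>x. x \<epsilon>) \<in> measurable (PiM (cube k) (\<lambda>_. M)) M" by (rule measurable_component_singleton)
  then show "(\<lambda>x. if \<epsilon> \<in> A then S (x \<epsilon>) else x \<epsilon>) \<in> measurable (PiM (cube k) (\<lambda>_. M)) M"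
    using assms by (cases "\<epsilon> \<in> A") (auto intro: measurable_compose)
qed

lemma face_map_commute:
  assumes "\<And>y. y \<in> space M \<Longrightarrow> S (S' y) = S' (S y)" "x \<in> space (PiM (cube k) (\<lambda>_. M))"
  shows "face_map k S A (face_map k S' A' x) = face_map k S' A' (face_map k S A x)"
  using assms by (auto simp: fun_eq_iff face_map_def restrict_def space_PiM PiE_mem)

lemma face_map_empty:
  assumes "x \<in> space (PiM (cube k) (\<lambda>_. M))"
  shows "face_map k S {} x = x"
  using assms by (auto simp: face_map_def space_PiM PiE_def extensional_def restrict_def fun_eq_iff)

lemma face_map_glue:
  "face_map (Suc k) S A (glue k z)
    = glue k (map_prod (face_map k S {\<eta>. \<eta> @ [False] \<in> A}) (face_map k S {\<eta>. \<eta> @ [True] \<in> A}) z)"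
proof
  fix \<epsilon>
  show "face_map (Suc k) S A (glue k z) \<epsilon>
    = glue k (map_prod (face_map k S {\<eta>. \<eta> @ [False] \<in> A}) (face_map k S {\<eta>. \<eta> @ [True] \<in> A}) z) \<epsilon>"
  proof (cases "\<epsilon> \<in> cube (Suc k)")
    case True
    then show ?thesis by (elim cube_SucE) (simp add: face_map_apply glue_snoc)
  qed (simp add: face_map_def glue_def)
qed

lemma face_map_funpow:
  assumes "S \<in> measurable M M" "x \<in> space (PiM (cube k) (\<lambda>_. M))" "\<epsilon> \<in> cube k"
  shows "(diagonal_map k S ^^ n) x \<epsilon> = (S ^^ n) (x \<epsilon>)"
  using assms(3) by (induction n) (auto simp: diagonal_map_def)

lemma glue_measurable:
  assumes sets_N: "sets N = sets (PiM (cube k) (\<lambda>_. M))"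
    and "fst \<in> measurable P N" "snd \<in> measurable P N"
  shows "glue k \<in> measurable P (PiM (cube (Suc k)) (\<lambda>_. M))"
  unfolding glue_def
proof (rule measurable_restrict)
  fix \<epsilon> assume "\<epsilon> \<in> cube (Suc k)"
  then obtain \<eta> b where \<epsilon>: "\<epsilon> = \<eta> @ [b]" "\<eta> \<in> cube k" by (rule cube_SucE)
  have "(\<lambda>x. x \<eta>) \<in> measurable N M"
    using measurable_component_singleton[OF \<epsilon>(2), of "\<lambda>_. M"] measurable_cong_sets[OF sets_N refl] by blast
  then show "(\<lambda>z. if last \<epsilon> then snd z (butlast \<epsilon>) else fst z (butlast \<epsilon>)) \<in> measurable P M"
    using measurable_compose[OF assms(2)] measurable_compose[OF assms(3)] by (cases b) (simp_all add: \<epsilon>)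
qed

lemma measure_preserving_distr:
  assumes R: "measure_preserving P R" and [measurable]: "g \<in> measurable P Q" "\<Phi> \<in> measurable Q Q"
    and comm: "\<And>z. z \<in> space P \<Longrightarrow> \<Phi> (g z) = g (R z)"
  shows "measure_preserving (distr P Q g) \<Phi>"
proof -
  have [measurable]: "R \<in> measurable P P" using R by (rule measure_preserving_measurable)
  have "distr (distr P Q g) (distr P Q g) \<Phi> = distr (distr P Q g) Q \<Phi>"
    by (rule distr_cong) auto
  also have "\<dots> = distr P Q (\<Phi> \<circ> g)" by (rule distr_distr) auto
  also have "\<dots> = distr P Q (g \<circ> R)" using comm by (intro distr_cong) auto
  also have "\<dots> = distr (distr P P R) Q g" by (rule distr_distr[symmetric]) auto
  also have "\<dots> = distr P Q g" using R by (simp add: measure_preserving_def)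
  finally show ?thesis by (simp add: measure_preserving_def)
qed

lemma measure_preserving_cong_space:
  assumes "measure_preserving N R" "\<And>x. x \<in> space N \<Longrightarrow> R x = R' x"
  shows "measure_preserving N R'"
  using assms distr_cong[of N N N N R R'] measurable_cong[of N R R' N] by (auto simp: measure_preserving_def)

section \<open>The structure of box measures\<close>

locale commuting_system = prob_space M for M :: "'a measure" +
  fixes T :: "nat \<Rightarrow> 'a \<Rightarrow> 'a" and d :: nat
  assumes regular: "regular_measure M"
    and preserving: "\<And>i. i < d \<Longrightarrow> measure_preserving M (T i)"
    and commute: "\<And>i j x. i < d \<Longrightarrow> j < d \<Longrightarrow> x \<in> space M \<Longrightarrow> T i (T j x) = T j (T i x)"
begin

abbreviation box :: "nat \<Rightarrow> (bool list \<Rightarrow> 'a) measure" where "box k \<equiv> box_measure M T k"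

abbreviation square :: "nat \<Rightarrow> ((bool list \<Rightarrow> 'a) \<times> (bool list \<Rightarrow> 'a)) measure" where
  "square k \<equiv> rel_square (box k) (diagonal_map k (T k))"

lemma T_measurable: "i < d \<Longrightarrow> T i \<in> measurable M M"
  using preserving by (rule measure_preserving_measurable)

lemma face_map_commute_diagonal:
  assumes "i < d" "j < d" "x \<in> space (PiM (cube k) (\<lambda>_. M))"
  shows "face_map k (T i) A (diagonal_map k (T j) x) = diagonal_map k (T j) (face_map k (T i) A x)"
  unfolding diagonal_map_eq using commute[OF assms(1,2)] assms(3) by (intro face_map_commute) auto

text \<open>
  These statements need each other: the marginals make the measure regular, regularity and the
  invariance under the diagonal map make the next square exist, and the commutation relations make
  the square invariant under the diagonal maps.
\<close>

lemma box_structure: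
  assumes "k \<le> d"
  shows "prob_space (box k) \<and> sets (box k) = sets (PiM (cube k) (\<lambda>_. M)) \<and>
    (\<forall>\<epsilon>\<in>cube k. distr (box k) M (\<lambda>x. x \<epsilon>) = M) \<and>
    (\<forall>j<d. measure_preserving (box k) (diagonal_map k (T j)))"
  using assms
proof (induction k)
  case 0
  let ?\<phi> = "\<lambda>x. \<lambda>\<epsilon>\<in>cube 0. (x :: 'a)"
  have \<phi> [measurable]: "?\<phi> \<in> measurable M (PiM (cube 0) (\<lambda>_. M))"
    by (rule measurable_restrict) simp
  have "prob_space (box 0)" using prob_space_distr[OF \<phi>] by simp
  moreover have "distr (box 0) M (\<lambda>x. x \<epsilon>) = M" if "\<epsilon> \<in> cube 0" for \<epsilon>
  proof -
    have [measurable]: "(\<lambda>x. x \<epsilon>) \<in> measurable (PiM (cube 0) (\<lambda>_. M)) M"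
      using that by (rule measurable_component_singleton)
    have "distr (box 0) M (\<lambda>x. x \<epsilon>) = distr M M ((\<lambda>x. x \<epsilon>) \<circ> ?\<phi>)"
      by (simp add: distr_distr)
    also have "\<dots> = distr M M (\<lambda>x. x)" using that by (intro distr_cong) auto
    finally show ?thesis by (simp add: distr_id)
  qed
  moreover have "measure_preserving (box 0) (diagonal_map 0 (T j))" if "j < d" for j
    unfolding box_measure.simps diagonal_map_eq
    by (rule measure_preserving_distr[OF preserving[OF that] \<phi> face_map_measurable[OF T_measurable[OF that]]])
       (auto simp: fun_eq_iff face_map_def)
  ultimately show ?case by simp
next
  case (Suc k)
  then have k: "k < d" and IH: "prob_space (box k)" "sets (box k) = sets (PiM (cube k) (\<lambda>_. M))"
      "\<And>\<epsilon>. \<epsilon> \<in> cube k \<Longrightarrow> distr (box k) M (\<lambda>x. x \<epsilon>) = M"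
      "\<And>j. j < d \<Longrightarrow> measure_preserving (box k) (diagonal_map k (T j))"
    by auto
  have reg: "regular_measure (box k)"
    by (rule regular_measure_power[OF IH(1,2) finite_cube regular IH(3)])
  interpret R: relative_square "box k" "diagonal_map k (T k)" "square k"
    using IH(1) IH(4)[OF k] is_rel_square_rel_square[OF IH(1) reg] measure_preserving_measurable
    by (auto simp: relative_square_def relative_square_axioms_def)
  note glue [measurable] = glue_measurable[OF IH(2) R.fst_measurable R.snd_measurable]
  have "prob_space (box (Suc k))" using R.P.prob_space_distr[OF glue] by simp
  moreover have "distr (box (Suc k)) M (\<lambda>x. x \<epsilon>) = M" if \<epsilon>: "\<epsilon> \<in> cube (Suc k)" for \<epsilon>
  proof -
    obtain \<eta> b where \<eta>: "\<epsilon> = \<eta> @ [b]" "\<eta> \<in> cube k" using \<epsilon> by (rule cube_SucE)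
    have [measurable]: "(\<lambda>x. x \<epsilon>) \<in> measurable (PiM (cube (Suc k)) (\<lambda>_. M)) M"
      using \<epsilon> by (rule measurable_component_singleton)
    have coord [measurable]: "(\<lambda>x. x \<eta>) \<in> measurable (box k) M"
      using measurable_component_singleton[OF \<eta>(2), of "\<lambda>_. M"] measurable_cong_sets[OF IH(2) refl] by blast
    have 1: "distr (square k) M ((\<lambda>x. x \<eta>) \<circ> fst) = M"
      using distr_distr[OF coord R.fst_measurable] IH(3)[OF \<eta>(2)] R.distr_fst by simp
    have 2: "distr (square k) M ((\<lambda>x. x \<eta>) \<circ> snd) = M"
      using distr_distr[OF coord R.snd_measurable] IH(3)[OF \<eta>(2)] R.distr_snd by simp
    have "distr (box (Suc k)) M (\<lambda>x. x \<epsilon>) = distr (square k) M ((\<lambda>x. x \<epsilon>) \<circ> glue k)"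
      by (simp add: distr_distr)
    also have "\<dots> = distr (square k) M ((\<lambda>x. x \<eta>) \<circ> (if b then snd else fst))"
      using \<eta> by (intro distr_cong) (auto simp: glue_snoc)
    also have "\<dots> = M" using 1 2 by (cases b) simp_all
    finally show ?thesis .
  qed
  moreover have "measure_preserving (box (Suc k)) (diagonal_map (Suc k) (T j))" if j: "j < d" for j
    unfolding box_measure.simps diagonal_map_eq
  proof (rule measure_preserving_distr)
    show "measure_preserving (rel_square (box k) (face_map k (T k) UNIV))
        (map_prod (diagonal_map k (T j)) (diagonal_map k (T j)))"
      unfolding diagonal_map_eq[symmetric]
    proof (rule R.measure_preserving_both[OF IH(4)[OF j]])
      fix x assume "x \<in> space (box k)"
      then have "x \<in> space (PiM (cube k) (\<lambda>_. M))" using sets_eq_imp_space_eq[OF IH(2)] by simp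
      then show "diagonal_map k (T j) (diagonal_map k (T k) x) = diagonal_map k (T k) (diagonal_map k (T j) x)"
        using face_map_commute_diagonal[OF j k, of x k UNIV] by (simp add: diagonal_map_eq)
    qed
    show "glue k \<in> measurable (rel_square (box k) (face_map k (T k) UNIV)) (PiM (cube (Suc k)) (\<lambda>_. M))"
      using glue by (simp add: diagonal_map_eq)
    show "face_map (Suc k) (T j) UNIV \<in> measurable (PiM (cube (Suc k)) (\<lambda>_. M)) (PiM (cube (Suc k)) (\<lambda>_. M))"
      by (rule face_map_measurable[OF T_measurable[OF j]])
  qed (simp add: face_map_glue diagonal_map_eq)
  ultimately show ?case by simp
qed

lemma prob_box: "k \<le> d \<Longrightarrow> prob_space (box k)"
  and sets_box: "k \<le> d \<Longrightarrow> sets (box k) = sets (PiM (cube k) (\<lambda>_. M))"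
  and distr_box: "k \<le> d \<Longrightarrow> \<epsilon> \<in> cube k \<Longrightarrow> distr (box k) M (\<lambda>x. x \<epsilon>) = M"
  and diagonal_preserving: "k \<le> d \<Longrightarrow> j < d \<Longrightarrow> measure_preserving (box k) (diagonal_map k (T j))"
  using box_structure by blast+

lemma space_box: "k \<le> d \<Longrightarrow> space (box k) = space (PiM (cube k) (\<lambda>_. M))"
  using sets_box sets_eq_imp_space_eq by blast

lemma coord_in_space: "k \<le> d \<Longrightarrow> \<epsilon> \<in> cube k \<Longrightarrow> x \<in> space (box k) \<Longrightarrow> x \<epsilon> \<in> space M"
  by (auto simp: space_box space_PiM)

lemma coord_measurable: "k \<le> d \<Longrightarrow> \<epsilon> \<in> cube k \<Longrightarrow> (\<lambda>x. x \<epsilon>) \<in> measurable (box k) M"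
  using measurable_component_singleton[of \<epsilon> "cube k" "\<lambda>_. M"] measurable_cong_sets[OF sets_box refl, of k M]
  by blast

lemma bounded_borel_coord:
  "k \<le> d \<Longrightarrow> \<epsilon> \<in> cube k \<Longrightarrow> f \<in> bounded_borel M \<Longrightarrow> (\<lambda>x. f (x \<epsilon>)) \<in> bounded_borel (box k)"
  by (rule bounded_borel_comp[OF _ coord_measurable])

lemma regular_box: "k \<le> d \<Longrightarrow> regular_measure (box k)"
  by (rule regular_measure_power[OF prob_box sets_box finite_cube regular distr_box])

lemma AE_coord:
  "k \<le> d \<Longrightarrow> \<epsilon> \<in> cube k \<Longrightarrow> AE x in M. Q x \<Longrightarrow> AE x in box k. Q (x \<epsilon>)"
  by (rule AE_along_map[OF coord_measurable distr_box])

lemma relative_square_box: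
  assumes "k < d"
  shows "relative_square (box k) (diagonal_map k (T k)) (square k)"
proof -
  have k: "k \<le> d" using assms by simp
  have mp: "measure_preserving (box k) (diagonal_map k (T k))" by (rule diagonal_preserving[OF k assms])
  have "is_rel_square (box k) (diagonal_map k (T k)) (square k)"
    by (rule is_rel_square_rel_square[OF prob_box[OF k] regular_box[OF k] measure_preserving_measurable[OF mp]])
  then show ?thesis
    using prob_box[OF k] mp by (simp add: relative_square_def relative_square_axioms_def)
qed

lemma glue_measurable_square: "k < d \<Longrightarrow> glue k \<in> measurable (square k) (PiM (cube (Suc k)) (\<lambda>_. M))"
  using glue_measurable[OF sets_box relative_square.fst_measurable relative_square.snd_measurable] relative_square_box
  by (metis less_imp_le)

lemma bounded_borel_glue:
  assumes "k < d" "f \<in> bounded_borel (box (Suc k))"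
  shows "(\<lambda>z. f (glue k z)) \<in> bounded_borel (square k)"
proof (rule bounded_borel_comp[OF assms(2)])
  show "glue k \<in> measurable (square k) (box (Suc k))"
    using glue_measurable_square[OF assms(1)] measurable_cong_sets[OF refl sets_box, of "Suc k" "square k"] assms(1)
    by simp
qed

lemma integral_box_Suc:
  assumes "k < d" "f \<in> borel_measurable (box (Suc k))"
  shows "(\<integral>x. f x \<partial>box (Suc k)) = (\<integral>z. (f (glue k z) :: real) \<partial>square k)"
proof -
  have "f \<in> borel_measurable (PiM (cube (Suc k)) (\<lambda>_. M))"
    using assms sets_box[of "Suc k"] measurable_cong_sets[OF sets_box refl, of "Suc k" borel] by simp
  then show ?thesis
    using glue_measurable_square[OF assms(1)] by (simp add: integral_distr)
qed

lemma AE_box_Suc: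
  assumes "k < d" "{x \<in> space (box (Suc k)). Q x} \<in> sets (box (Suc k))"
  shows "(AE x in box (Suc k). Q x) \<longleftrightarrow> (AE z in square k. Q (glue k z))"
proof -
  have "{x \<in> space (PiM (cube (Suc k)) (\<lambda>_. M)). Q x} \<in> sets (PiM (cube (Suc k)) (\<lambda>_. M))"
    using assms sets_box[of "Suc k"] space_box[of "Suc k"] by simp
  then show ?thesis
    unfolding box_measure.simps by (rule AE_distr_iff[OF glue_measurable_square[OF assms(1)]])
qed

lemma face_map_measurable_box:
  assumes "k \<le> d" "i < d"
  shows "face_map k (T i) A \<in> measurable (box k) (box k)"
  using face_map_measurable[OF T_measurable[OF assms(2)], of k A]
    measurable_cong_sets[OF sets_box[OF assms(1)] sets_box[OF assms(1)]] by blast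

text \<open>
  The transformations of the faces \<open>\<epsilon>\<^sub>i = b\<close>. When digit \<open>i\<close> is the last one, only one of the two
  halves of the cube moves; otherwise both halves move in the same way.
\<close>

lemma face_preserving:
  assumes "k \<le> d" "i < k"
  shows "measure_preserving (box k) (face_map k (T i) {\<epsilon>. \<epsilon> ! i = b})"
  using assms
proof (induction k)
  case (Suc k)
  then have k: "k < d" and i: "i < d" by auto
  interpret R: relative_square "box k" "diagonal_map k (T k)" "square k"
    by (rule relative_square_box[OF k])
  have sp: "space (box k) = space (PiM (cube k) (\<lambda>_. M))" using k space_box by simp
  let ?A = "{\<epsilon>. \<epsilon> ! i = b}"
  have mp: "measure_preserving (square k)
      (map_prod (face_map k (T i) {\<eta>. \<eta> @ [False] \<in> ?A}) (face_map k (T i) {\<eta>. \<eta> @ [True] \<in> ?A}))"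
  proof (cases "i = k")
    case True
    have eq: "face_map k (T i) {\<eta>. \<eta> @ [c] \<in> ?A} = face_map k (T k) (if c = b then UNIV else {})" for c
      unfolding True by (rule face_map_cong) (auto simp: cube_def nth_append)
    have "measure_preserving (square k) (if b then map_prod id (diagonal_map k (T k)) else map_prod (diagonal_map k (T k)) id)"
      using R.measure_preserving_first R.measure_preserving_second by simp
    then show ?thesis
      unfolding eq
      by (rule measure_preserving_cong_space)
         (cases b; auto simp: R.space_P sp face_map_empty simp flip: diagonal_map_eq)
  next
    case False
    then have ik: "i < k" using Suc by simp
    have eq: "face_map k (T i) {\<eta>. \<eta> @ [c] \<in> ?A} = face_map k (T i) ?A" for c
      using ik by (intro face_map_cong) (auto simp: cube_def nth_append)
    show ?thesis
      unfolding eq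
    proof (rule R.measure_preserving_both)
      show "measure_preserving (box k) (face_map k (T i) ?A)" using Suc ik by simp
      fix x assume "x \<in> space (box k)"
      then show "face_map k (T i) ?A (diagonal_map k (T k) x) = diagonal_map k (T k) (face_map k (T i) ?A x)"
        using face_map_commute_diagonal[OF i k] by (simp add: sp)
    qed
  qed
  show ?case
    unfolding box_measure.simps
    by (rule measure_preserving_distr[OF mp glue_measurable_square[OF k] face_map_measurable[OF T_measurable[OF i]]])
       (rule face_map_glue)
qed simp

text \<open>
  When \<open>i\<close> is the last digit, \<open>h(x\<^sub>\<eta>)\<close> is an invariant function on the half cube and has the same
  value on both halves; the other digits are inherited from the marginals.
\<close>

lemma invariant_function_coordinates:
  assumes h: "h \<in> bounded_borel M" and inv: "AE x in M. h (T i x) = h x"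
    and "k \<le> d" "i < k" "\<epsilon> \<in> cube k"
  shows "AE x in box k. h (x \<epsilon>) = h (x (\<epsilon>[i := b]))"
  using assms(3-5)
proof (induction k arbitrary: \<epsilon>)
  case (Suc k)
  then have k: "k < d" and kd: "k \<le> d" and i: "i < d" by auto
  interpret R: relative_square "box k" "diagonal_map k (T k)" "square k"
    by (rule relative_square_box[OF k])
  obtain \<eta> c where \<eta>: "\<epsilon> = \<eta> @ [c]" "\<eta> \<in> cube k" using Suc.prems(3) by (rule cube_SucE)
  have len: "length \<eta> = k" using \<eta>(2) by (simp add: cube_def)
  have upd: "\<epsilon>[i := b] \<in> cube (Suc k)" using Suc.prems(3) by (simp add: cube_def)
  have meas: "{x \<in> space (box (Suc k)). h (x \<epsilon>) = h (x (\<epsilon>[i := b]))} \<in> sets (box (Suc k))"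
  proof -
    have "(\<lambda>x. h (x \<epsilon>)) \<in> borel_measurable (box (Suc k))"
      "(\<lambda>x. h (x (\<epsilon>[i := b]))) \<in> borel_measurable (box (Suc k))"
      using bounded_borel_coord[OF Suc.prems(1) _ h] Suc.prems(3) upd bounded_borel_measurable by blast+
    then show ?thesis by measurable
  qed
  have "AE z in square k. h (glue k z \<epsilon>) = h (glue k z (\<epsilon>[i := b]))"
  proof (cases "i = k")
    case True
    have e: "(\<eta> @ [c])[i := b] = \<eta> @ [b]" using len True by (simp add: list_update_append)
    have "AE x in box k. h (diagonal_map k (T k) x \<eta>) = h (x \<eta>)"
      using AE_coord[OF kd \<eta>(2) inv] by eventually_elim (use \<eta>(2) True in \<open>simp add: diagonal_map_def\<close>)
    then have "AE z in square k. h (fst z \<eta>) = h (snd z \<eta>)"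
      using R.invariant_coordinates_agree[OF bounded_borel_coord[OF kd \<eta>(2) h]] by simp
    then show ?thesis
      unfolding \<eta>(1) e by eventually_elim (simp add: glue_snoc \<eta>(2))
  next
    case False
    then have ik: "i < k" using Suc.prems by simp
    have e: "(\<eta> @ [c])[i := b] = \<eta>[i := b] @ [c]" using len ik by (simp add: list_update_append)
    have \<eta>': "\<eta>[i := b] \<in> cube k" using \<eta>(2) by (simp add: cube_def)
    have IH: "AE x in box k. h (x \<eta>) = h (x (\<eta>[i := b]))"
      using Suc.IH[OF kd ik \<eta>(2)] .
    show ?thesis
      using R.AE_fst[OF IH] R.AE_snd[OF IH]
      unfolding \<eta>(1) e by eventually_elim (simp add: glue_snoc \<eta>(2) \<eta>')
  qed
  then show ?case using AE_box_Suc[OF k meas] by simp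
qed simp

text \<open>
  A function that is invariant under the transformations of all upper faces \<open>\<epsilon>\<^sub>i = 1\<close> loses its
  dependence on the upper half of the cube in each direction in turn, beginning with the last one;
  only the vertex with all digits \<open>0\<close> is left.
\<close>

lemma upper_invariant_function:
  assumes "k \<le> d" "f \<in> bounded_borel (box k)"
    and "\<And>i. i < k \<Longrightarrow> AE x in box k. f (face_map k (T i) {\<epsilon>. \<epsilon> ! i = True} x) = f x"
  obtains D where "D \<in> bounded_borel M" "AE x in box k. f x = D (x (replicate k False))"
proof -
  have "\<exists>D. D \<in> bounded_borel M \<and> (AE x in box k. f x = D (x (replicate k False)))"
    using assms
  proof (induction k arbitrary: f)
    case 0
    have "(\<lambda>x. \<lambda>\<epsilon>\<in>cube 0. x) \<in> measurable M (PiM (cube 0) (\<lambda>_. M))"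
      by (rule measurable_restrict) simp
    then have \<phi>: "(\<lambda>x. \<lambda>\<epsilon>\<in>cube 0. x) \<in> measurable M (box 0)"
      using measurable_cong_sets[OF refl sets_box, of 0 M] by simp
    have "f x = f (\<lambda>\<epsilon>\<in>cube 0. x [])" if "x \<in> space (box 0)" for x
    proof -
      have "x = (\<lambda>\<epsilon>\<in>cube 0. x [])"
        using that by (auto simp: fun_eq_iff cube_0 space_PiM PiE_def extensional_def)
      then show ?thesis by simp
    qed
    then have "AE x in box 0. f x = f (\<lambda>\<epsilon>\<in>cube 0. x (replicate 0 False))"
      by (intro AE_I2) simp
    then show ?case
      using bounded_borel_comp[OF 0(2) \<phi>] by blast
  next
    case (Suc k)
    then have k: "k < d" and kd: "k \<le> d" by auto
    interpret R: relative_square "box k" "diagonal_map k (T k)" "square k"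
      by (rule relative_square_box[OF k])
    have sp: "space (box k) = space (PiM (cube k) (\<lambda>_. M))" using kd space_box by simp
    have inv_glue: "AE z in square k. f (face_map (Suc k) (T i) {\<epsilon>. \<epsilon> ! i = True} (glue k z)) = f (glue k z)"
      if i: "i < Suc k" for i
    proof -
      have [measurable]: "f \<in> borel_measurable (box (Suc k))" using Suc.prems(2) by (rule bounded_borel_measurable)
      have [measurable]: "face_map (Suc k) (T i) {\<epsilon>. \<epsilon> ! i = True} \<in> measurable (box (Suc k)) (box (Suc k))"
        using i Suc.prems(1) by (intro face_map_measurable_box) auto
      have "{x \<in> space (box (Suc k)). f (face_map (Suc k) (T i) {\<epsilon>. \<epsilon> ! i = True} x) = f x} \<in> sets (box (Suc k))"
        by measurable
      from AE_box_Suc[OF k this] show ?thesis using Suc.prems(3)[OF i] by simp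
    qed
    have fg: "(\<lambda>z. f (glue k z)) \<in> bounded_borel (square k)"
      by (rule bounded_borel_glue[OF k Suc.prems(2)])
    have top: "AE z in square k. f (glue k (map_prod id (diagonal_map k (T k)) z)) = f (glue k z)"
      using inv_glue[OF lessI] AE_space
    proof eventually_elim
      case (elim z)
      have "face_map k (T k) {\<eta>. \<eta> @ [c] \<in> {\<epsilon>. \<epsilon> ! k = True}} = face_map k (T k) (if c then UNIV else {})" for c
        by (rule face_map_cong) (auto simp: cube_def nth_append)
      from this[of False] this[of True]
      have "map_prod (face_map k (T k) {\<eta>. \<eta> @ [False] \<in> {\<epsilon>. \<epsilon> ! k = True}})
          (face_map k (T k) {\<eta>. \<eta> @ [True] \<in> {\<epsilon>. \<epsilon> ! k = True}}) z = map_prod id (diagonal_map k (T k)) z"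
        using elim(2) by (cases z) (auto simp: R.space_P sp face_map_empty simp flip: diagonal_map_eq)
      then show ?case using elim(1) by (simp only: face_map_glue)
    qed
    obtain D where D: "D \<in> bounded_borel (box k)" "AE z in square k. f (glue k z) = D (fst z)"
      using R.invariant_second_factor[OF fg top] by blast
    have "AE x in box k. D (face_map k (T i) {\<epsilon>. \<epsilon> ! i = True} x) = D x" if i: "i < k" for i
    proof (rule R.AE_from_fst)
      let ?U = "face_map k (T i) {\<epsilon>. \<epsilon> ! i = True}"
      have id: "i < d" using i k by simp
      have U: "measure_preserving (box k) ?U" by (rule face_preserving[OF kd i])
      have UU: "measure_preserving (square k) (map_prod ?U ?U)"
        using face_map_commute_diagonal[OF id k] sp by (intro R.measure_preserving_both[OF U]) auto
      have eq: "face_map k (T i) {\<eta>. \<eta> @ [c] \<in> {\<epsilon>. \<epsilon> ! i = True}} = ?U" for c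
        using i by (intro face_map_cong) (auto simp: cube_def nth_append)
      have "AE z in square k. f (glue k (map_prod ?U ?U z)) = D (fst (map_prod ?U ?U z))"
        by (rule measure_preserving_AE[OF UU D(2)])
      moreover have "AE z in square k. f (glue k (map_prod ?U ?U z)) = f (glue k z)"
        using inv_glue[of i] i by (simp only: face_map_glue eq)
      ultimately show "AE z in square k. D (?U (fst z)) = D (fst z)"
        using D(2) by eventually_elim simp
      have [measurable]: "D \<in> borel_measurable (box k)" "?U \<in> measurable (box k) (box k)"
        using D(1) U by (auto intro: bounded_borel_measurable measure_preserving_measurable)
      show "{x \<in> space (box k). D (?U x) = D x} \<in> sets (box k)" by measurable
    qed
    then obtain D' where D': "D' \<in> bounded_borel M" "AE x in box k. D x = D' (x (replicate k False))"
      using Suc.IH[OF kd D(1)] by blast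
    have rep: "replicate (Suc k) False = replicate k False @ [False]"
      by (simp add: replicate_append_same)
    have "AE z in square k. f (glue k z) = D' (glue k z (replicate (Suc k) False))"
      using D(2) R.AE_fst[OF D'(2)] unfolding rep by eventually_elim (simp add: glue_snoc)
    moreover have "{x \<in> space (box (Suc k)). f x = D' (x (replicate (Suc k) False))} \<in> sets (box (Suc k))"
    proof -
      have [measurable]: "f \<in> borel_measurable (box (Suc k))"
        "(\<lambda>x. D' (x (replicate (Suc k) False))) \<in> borel_measurable (box (Suc k))"
        by (rule bounded_borel_measurable[OF Suc.prems(2)],
            rule bounded_borel_measurable[OF bounded_borel_coord[OF Suc.prems(1) replicate_in_cube D'(1)]])
      show ?thesis by measurable
    qed
    ultimately have "AE x in box (Suc k). f x = D' (x (replicate (Suc k) False))"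
      by (subst AE_box_Suc[OF k])
    then show ?case using D'(1) by blast
  qed
  then show thesis using that by blast
qed

end

section \<open>Multilinear forms on the cube\<close>

definition box_form :: "'a measure \<Rightarrow> (nat \<Rightarrow> 'a \<Rightarrow> 'a) \<Rightarrow> nat \<Rightarrow> (bool list \<Rightarrow> 'a \<Rightarrow> real) \<Rightarrow> real" where
  "box_form M T k F = (\<integral>x. (\<Prod>\<epsilon>\<in>cube k. F \<epsilon> (x \<epsilon>)) \<partial>box_measure M T k)"

lemma average_power_le:
  fixes a :: "nat \<Rightarrow> real"
  shows "((\<Sum>m<n. \<bar>a m\<bar>) / real n) ^ (2 ^ j) \<le> (\<Sum>m<n. \<bar>a m\<bar> ^ (2 ^ j)) / real n"
proof (induction j)
  case (Suc j)
  have "((\<Sum>m<n. \<bar>a m\<bar>) / real n) ^ (2 ^ Suc j) = (((\<Sum>m<n. \<bar>a m\<bar>) / real n) ^ (2 ^ j))\<^sup>2"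
    by (simp add: power_mult[symmetric] mult.commute)
  also have "\<dots> \<le> ((\<Sum>m<n. \<bar>a m\<bar> ^ (2 ^ j)) / real n)\<^sup>2"
    using Suc by (intro power_mono zero_le_power divide_nonneg_nonneg sum_nonneg) auto
  also have "\<dots> = (\<Sum>m<n. \<bar>a m\<bar> ^ (2 ^ j))\<^sup>2 / (real n)\<^sup>2"
    by (simp add: power_divide)
  also have "\<dots> \<le> ((\<Sum>m<n. (\<bar>a m\<bar> ^ (2 ^ j))\<^sup>2) * real n) / (real n)\<^sup>2"
    using sum_squared_le_sum_of_squares[of "\<lambda>m. \<bar>a m\<bar> ^ (2 ^ j)" "{..<n}"]
    by (intro divide_right_mono) auto
  also have "\<dots> = (\<Sum>m<n. \<bar>a m\<bar> ^ (2 ^ Suc j)) / real n"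
  proof -
    have "(y ^ (2 ^ j))\<^sup>2 = y ^ (2 ^ Suc j)" for y :: real
      by (simp add: power_mult[symmetric] mult.commute)
    then show ?thesis by (simp add: power2_eq_square)
  qed
  finally show ?case .
qed simp

context commuting_system
begin

lemma box_form_cong:
  assumes "k \<le> d" "\<And>\<epsilon> x. \<epsilon> \<in> cube k \<Longrightarrow> x \<in> space M \<Longrightarrow> F \<epsilon> x = G \<epsilon> x"
  shows "box_form M T k F = box_form M T k G"
  unfolding box_form_def
  by (intro Bochner_Integration.integral_cong prod.cong refl assms(2) coord_in_space[OF assms(1)])

lemma bounded_borel_cube_prod:
  assumes "k \<le> d" "I \<subseteq> cube k" "\<And>\<epsilon>. \<epsilon> \<in> I \<Longrightarrow> F \<epsilon> \<in> bounded_borel M"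
  shows "(\<lambda>x. \<Prod>\<epsilon>\<in>I. F \<epsilon> (x \<epsilon>)) \<in> bounded_borel (box k)"
  using assms by (intro bounded_borel_prod bounded_borel_coord) auto

lemma box_form_0:
  assumes "F [] \<in> bounded_borel M"
  shows "box_form M T 0 F = (\<integral>x. F [] x \<partial>M)"
proof -
  have "(\<integral>x. F [] x \<partial>distr (box 0) M (\<lambda>x. x [])) = (\<integral>x. F [] (x []) \<partial>box 0)"
    using coord_measurable[of 0 "[]"] bounded_borel_measurable[OF assms]
    by (intro integral_distr) (auto simp: cube_0)
  then show ?thesis using distr_box[of 0 "[]"] by (simp add: box_form_def cube_0)
qed

lemma box_form_Suc:
  assumes k: "k < d" and F: "\<And>\<epsilon>. F \<epsilon> \<in> bounded_borel M"
  shows "box_form M T (Suc k) F = (\<integral>z. (\<Prod>\<eta>\<in>cube k. F (\<eta> @ [False]) (fst z \<eta>)) *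
    (\<Prod>\<eta>\<in>cube k. F (\<eta> @ [True]) (snd z \<eta>)) \<partial>square k)"
proof -
  have "(\<lambda>x. \<Prod>\<epsilon>\<in>cube (Suc k). F \<epsilon> (x \<epsilon>)) \<in> bounded_borel (box (Suc k))"
    using k by (intro bounded_borel_cube_prod F) auto
  then have "box_form M T (Suc k) F = (\<integral>z. (\<Prod>\<epsilon>\<in>cube (Suc k). F \<epsilon> (glue k z \<epsilon>)) \<partial>square k)"
    unfolding box_form_def by (intro integral_box_Suc[OF k] bounded_borel_measurable)
  then show ?thesis
    by (simp add: prod_cube_Suc glue_snoc cong: prod.cong)
qed

text \<open>
  This recursion is the ergodic theorem for the diagonal map. Along it identities and inequalities
  pass from one level to the next without reference to the conditional expectations that define the
  measures.
\<close>

lemma box_form_averages: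
  assumes k: "k < d" and F: "\<And>\<epsilon>. F \<epsilon> \<in> bounded_borel M"
  shows "(\<lambda>n. (\<Sum>m<n. box_form M T k (\<lambda>\<eta> x. F (\<eta> @ [False]) x * F (\<eta> @ [True]) ((T k ^^ m) x))) / real n)
    \<longlonglongrightarrow> box_form M T (Suc k) F"
proof -
  interpret R: relative_square "box k" "diagonal_map k (T k)" "square k"
    by (rule relative_square_box[OF k])
  have kd: "k \<le> d" using k by simp
  let ?f = "\<lambda>b x. \<Prod>\<eta>\<in>cube k. F (\<eta> @ [b]) (x \<eta>)"
  have f: "?f b \<in> bounded_borel (box k)" for b
    by (rule bounded_borel_cube_prod[OF kd order_refl F])
  have "(\<integral>x. ?f False x * ?f True ((diagonal_map k (T k) ^^ m) x) \<partial>box k)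
      = box_form M T k (\<lambda>\<eta> x. F (\<eta> @ [False]) x * F (\<eta> @ [True]) ((T k ^^ m) x))" for m
    unfolding box_form_def
    using space_box[OF kd]
    by (intro Bochner_Integration.integral_cong)
       (simp_all add: prod.distrib face_map_funpow[OF T_measurable[OF k]] cong: prod.cong)
  then show ?thesis
    unfolding box_form_Suc[where F = F, OF k F]
    using R.square_averages[OF f[of False] f[of True]] by simp
qed

lemma funpow_T_measurable: "k < d \<Longrightarrow> (T k ^^ m) \<in> measurable M M"
  using measure_preserving_funpow[OF preserving] measure_preserving_measurable by blast

text \<open>
  The Cauchy-Schwarz inequality in the last digit makes all functions with the same first digits
  equal; the recursion then turns the form into averages of forms of one level less, whose function
  at the initial vertex is \<open>f \<cdot> f \<circ> T\<^sup>m\<close>.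
\<close>

lemma box_form_le_diagonal:
  assumes "k < d" and F: "\<And>\<epsilon>. F \<epsilon> \<in> bounded_borel M" and F1: "\<And>\<epsilon> x. x \<in> space M \<Longrightarrow> \<bar>F \<epsilon> x\<bar> \<le> 1"
  shows "\<bar>box_form M T (Suc k) F\<bar> ^ (2 ^ Suc k) \<le> box_form M T (Suc k) (\<lambda>_. F (replicate (Suc k) False))"
  using assms
proof (induction k arbitrary: F)
  case (0 F)
  interpret R: relative_square "box 0" "diagonal_map 0 (T 0)" "square 0"
    by (rule relative_square_box[OF 0(1)])
  have f: "(\<lambda>x. F [b] (x [])) \<in> bounded_borel (box 0)" for b
    by (rule bounded_borel_coord) (auto simp: cube_0 0)
  have "(\<integral>z. F [False] (fst z []) * F [True] (snd z []) \<partial>square 0)\<^sup>2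
      \<le> (\<integral>z. F [False] (fst z []) * F [False] (snd z []) \<partial>square 0)"
    using 0(3) coord_in_space[of 0 "[]"] by (intro R.square_Cauchy_Schwarz f) (auto simp: cube_0)
  then show ?case
    using box_form_Suc[where F = F, OF 0(1,2)] box_form_Suc[where F = "\<lambda>_. F [False]", OF 0(1,2)]
    by (simp add: cube_0)
next
  case (Suc k F)
  let ?k = "Suc k"
  let ?zero = "replicate ?k False"
  have kd: "?k \<le> d" using Suc.prems(1) by simp
  interpret R: relative_square "box ?k" "diagonal_map ?k (T ?k)" "square ?k"
    by (rule relative_square_box[OF Suc.prems(1)])
  \<comment> \<open>The functions after the Cauchy-Schwarz inequality: the upper half copies the lower half.\<close>
  define F' where "F' \<epsilon> = F (butlast \<epsilon> @ [False])" for \<epsilon>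
  let ?f = "\<lambda>b x. \<Prod>\<eta>\<in>cube ?k. F (\<eta> @ [b]) (x \<eta>)"
  have f: "?f b \<in> bounded_borel (box ?k)" for b
    by (rule bounded_borel_cube_prod[OF kd order_refl Suc.prems(2)])
  have f1: "\<bar>?f True x\<bar> \<le> 1" if "x \<in> space (box ?k)" for x
    unfolding abs_prod using Suc.prems(3) coord_in_space[OF kd _ that] by (intro prod_le_1) auto
  have "(box_form M T (Suc ?k) F)\<^sup>2 \<le> box_form M T (Suc ?k) F'"
    unfolding box_form_Suc[where F = F, OF Suc.prems(1,2)]
      box_form_Suc[where F = F', OF Suc.prems(1) Suc.prems(2)[of "butlast _ @ [False]", folded F'_def]]
    using R.square_Cauchy_Schwarz[OF f f f1] by (simp add: F'_def)
  then have "((box_form M T (Suc ?k) F)\<^sup>2) ^ (2 ^ ?k) \<le> \<bar>box_form M T (Suc ?k) F'\<bar> ^ (2 ^ ?k)"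
    by (intro power_mono) auto
  then have 1: "\<bar>box_form M T (Suc ?k) F\<bar> ^ (2 ^ Suc ?k) \<le> \<bar>box_form M T (Suc ?k) F'\<bar> ^ (2 ^ ?k)"
    by (simp add: power_mult power_even_abs)
  define G where "G m \<eta> x = F (\<eta> @ [False]) x * F (\<eta> @ [False]) ((T ?k ^^ m) x)" for m \<eta> x
  let ?a = "\<lambda>m. box_form M T ?k (G m)"
  let ?b = "\<lambda>m. box_form M T ?k (\<lambda>_. G m ?zero)"
  have G: "G m \<eta> \<in> bounded_borel M" for m \<eta>
    unfolding G_def using Suc.prems(1,2)
    by (intro bounded_borel_mult bounded_borel_comp[OF _ funpow_T_measurable]) auto
  have G1: "\<bar>G m \<eta> x\<bar> \<le> 1" if "x \<in> space M" for m \<eta> x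
    unfolding G_def abs_mult
    using Suc.prems(3) that measurable_space[OF funpow_T_measurable[OF Suc.prems(1)] that]
    by (intro mult_le_one) auto
  have lim_a: "(\<lambda>n. (\<Sum>m<n. ?a m) / real n) \<longlonglongrightarrow> box_form M T (Suc ?k) F'"
    using box_form_averages[OF Suc.prems(1), of F'] Suc.prems(2) by (simp add: F'_def G_def[abs_def])
  have rep: "replicate (Suc ?k) False = ?zero @ [False]"
    by (simp add: replicate_append_same)
  have lim_b: "(\<lambda>n. (\<Sum>m<n. ?b m) / real n) \<longlonglongrightarrow> box_form M T (Suc ?k) (\<lambda>_. F (replicate (Suc ?k) False))"
    using box_form_averages[OF Suc.prems(1), of "\<lambda>_. F (replicate (Suc ?k) False)"] Suc.prems(2)
    unfolding rep by (simp add: G_def[abs_def])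
  have step: "\<bar>(\<Sum>m<n. ?a m) / real n\<bar> ^ (2 ^ ?k) \<le> (\<Sum>m<n. ?b m) / real n" for n
  proof -
    have "\<bar>(\<Sum>m<n. ?a m) / real n\<bar> \<le> (\<Sum>m<n. \<bar>?a m\<bar>) / real n"
      by (simp add: abs_divide divide_right_mono sum_abs)
    then have "\<bar>(\<Sum>m<n. ?a m) / real n\<bar> ^ (2 ^ ?k) \<le> ((\<Sum>m<n. \<bar>?a m\<bar>) / real n) ^ (2 ^ ?k)"
      by (intro power_mono) auto
    also have "\<dots> \<le> (\<Sum>m<n. \<bar>?a m\<bar> ^ (2 ^ ?k)) / real n"
      by (rule average_power_le)
    also have "\<dots> \<le> (\<Sum>m<n. ?b m) / real n"
      using Suc.prems(1) G G1 by (intro divide_right_mono sum_mono Suc.IH) auto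
    finally show ?thesis .
  qed
  have "\<bar>box_form M T (Suc ?k) F'\<bar> ^ (2 ^ ?k) \<le> box_form M T (Suc ?k) (\<lambda>_. F (replicate (Suc ?k) False))"
    by (rule LIMSEQ_le[OF tendsto_power[OF tendsto_rabs[OF lim_a]] lim_b]) (use step in auto)
  then show ?case using 1 by linarith
qed

lemma box_form_cmult:
  "box_form M T k (\<lambda>\<epsilon> x. c * F \<epsilon> x) = c ^ (2 ^ k) * box_form M T k F"
proof -
  have "card (cube k) = 2 ^ k"
    using card_lists_length_eq[of "UNIV :: bool set" k] by (simp add: cube_def)
  then show ?thesis by (simp add: box_form_def prod.distrib)
qed

text \<open>
  The functions are scaled to be bounded by \<open>1\<close>, so that the previous inequality applies.
\<close>

lemma box_form_vanishes:
  assumes "0 < d" and F: "\<And>\<epsilon>. F \<epsilon> \<in> bounded_borel M"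
    and zero: "box_form M T d (\<lambda>_. F (replicate d False)) = 0"
  shows "box_form M T d F = 0"
proof -
  have "\<forall>\<epsilon>. \<exists>C. \<forall>x\<in>space M. \<bar>F \<epsilon> x\<bar> \<le> C" using F by (simp add: bounded_borel_def)
  then obtain C where C: "\<And>\<epsilon> x. x \<in> space M \<Longrightarrow> \<bar>F \<epsilon> x\<bar> \<le> C \<epsilon>" by metis
  define c where "c = Max (insert 1 (C ` cube d))"
  have c1: "1 \<le> c" unfolding c_def by (intro Max_ge) auto
  have cC: "C \<epsilon> \<le> c" if "\<epsilon> \<in> cube d" for \<epsilon> unfolding c_def using that by (intro Max_ge) auto
  define G where "G \<epsilon> x = (if \<epsilon> \<in> cube d then 1 / c * F \<epsilon> x else 0)" for \<epsilon> x
  have G: "G \<epsilon> \<in> bounded_borel M" for \<epsilon>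
    unfolding G_def using bounded_borel_mult[OF bounded_borel_const F, of "1 / c" \<epsilon>]
    by (cases "\<epsilon> \<in> cube d") simp_all
  have G1: "\<bar>G \<epsilon> x\<bar> \<le> 1" if "x \<in> space M" for \<epsilon> x
    using C[OF that, of \<epsilon>] cC[of \<epsilon>] c1 by (auto simp: G_def abs_mult divide_le_eq)
  obtain k where k: "d = Suc k" using assms(1) gr0_implies_Suc by blast
  have "box_form M T d (\<lambda>_. G (replicate d False)) = box_form M T d (\<lambda>_ x. 1 / c * F (replicate d False) x)"
    by (rule box_form_cong) (auto simp: G_def)
  also have "\<dots> = 0" unfolding box_form_cmult[of d "1 / c" "\<lambda>_. F (replicate d False)"] zero by simp
  finally have "\<bar>box_form M T d G\<bar> ^ (2 ^ d) \<le> 0"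
    using box_form_le_diagonal[of k G] G G1 by (simp only: k lessI)
  then have "box_form M T d G = 0"
    using zero_le_power[of "\<bar>box_form M T d G\<bar>" "2 ^ d"] by (simp add: order_antisym_conv)
  moreover have "box_form M T d G = box_form M T d (\<lambda>\<epsilon> x. 1 / c * F \<epsilon> x)"
    by (rule box_form_cong) (auto simp: G_def)
  ultimately have "(1 / c) ^ (2 ^ d) * box_form M T d F = 0"
    using box_form_cmult[of d "1 / c" F] by simp
  then show ?thesis using c1 by simp
qed

end

text \<open>
  At level \<open>0\<close> the form is an integral over the base space, which a factor map preserves; the
  recursion carries the identity to all levels.
\<close>

lemma box_form_factor:
  assumes "commuting_system M T d" "commuting_system M' T' d" "k \<le> d"
    and \<pi>: "\<pi> \<in> measurable M' M" "distr M' M \<pi> = M"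
    and equiv: "\<And>i x. i < d \<Longrightarrow> x \<in> space M' \<Longrightarrow> \<pi> (T' i x) = T i (\<pi> x)"
    and F: "\<And>\<epsilon>. F \<epsilon> \<in> bounded_borel M"
  shows "box_form M' T' k (\<lambda>\<epsilon> x. F \<epsilon> (\<pi> x)) = box_form M T k F"
  using assms(3) F
proof (induction k arbitrary: F)
  case (0 F)
  interpret M: commuting_system M T d by fact
  interpret M': commuting_system M' T' d by fact
  have "(\<integral>x. F [] (\<pi> x) \<partial>M') = (\<integral>x. F [] x \<partial>distr M' M \<pi>)"
    using \<pi>(1) bounded_borel_measurable[OF 0(2)] by (rule integral_distr[symmetric])
  then show ?case
    using M.box_form_0[of F] M'.box_form_0[of "\<lambda>\<epsilon> x. F \<epsilon> (\<pi> x)"] 0(2) bounded_borel_comp[OF 0(2) \<pi>(1)]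
    by (simp add: \<pi>(2))
next
  case (Suc k F)
  interpret M: commuting_system M T d by fact
  interpret M': commuting_system M' T' d by fact
  have k: "k < d" "k \<le> d" using Suc.prems(1) by auto
  have pow: "\<pi> ((T' k ^^ m) x) = (T k ^^ m) (\<pi> x)" if "x \<in> space M'" for m x
    by (induction m) (use that equiv[OF k(1) funpow_in_space[OF M'.T_measurable[OF k(1)] that]] in simp_all)
  have "box_form M' T' k (\<lambda>\<eta> x. F (\<eta> @ [False]) (\<pi> x) * F (\<eta> @ [True]) (\<pi> ((T' k ^^ m) x)))
      = box_form M T k (\<lambda>\<eta> x. F (\<eta> @ [False]) x * F (\<eta> @ [True]) ((T k ^^ m) x))" for m
  proof -
    have "box_form M' T' k (\<lambda>\<eta> x. F (\<eta> @ [False]) (\<pi> x) * F (\<eta> @ [True]) (\<pi> ((T' k ^^ m) x)))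
        = box_form M' T' k (\<lambda>\<eta> x. F (\<eta> @ [False]) (\<pi> x) * F (\<eta> @ [True]) ((T k ^^ m) (\<pi> x)))"
      by (rule M'.box_form_cong[OF k(2)]) (simp add: pow)
    also have "\<dots> = box_form M T k (\<lambda>\<eta> x. F (\<eta> @ [False]) x * F (\<eta> @ [True]) ((T k ^^ m) x))"
      by (rule Suc.IH[OF k(2)])
         (intro bounded_borel_mult Suc.prems(2) bounded_borel_comp[OF _ M.funpow_T_measurable[OF k(1)]])
    finally show ?thesis .
  qed
  then have "(\<lambda>n. (\<Sum>m<n. box_form M T k (\<lambda>\<eta> x. F (\<eta> @ [False]) x * F (\<eta> @ [True]) ((T k ^^ m) x))) / real n)
      \<longlonglongrightarrow> box_form M' T' (Suc k) (\<lambda>\<epsilon> x. F \<epsilon> (\<pi> x))"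
    using M'.box_form_averages[OF k(1), of "\<lambda>\<epsilon> x. F \<epsilon> (\<pi> x)"] bounded_borel_comp[OF Suc.prems(2) \<pi>(1)] by simp
  then show ?case
    using M.box_form_averages[OF k(1), of F] Suc.prems(2) LIMSEQ_unique by blast
qed

section \<open>The side transformations\<close>

text \<open>
  Since \<open>e \<circ> U\<close> is again measurable with respect to \<open>W\<close>, both \<open>\<integral>e (e \<circ> U)\<close> and \<open>\<integral>e\<^sup>2\<close> can be
  computed with \<open>h\<close> in place of one factor \<open>e\<close>; they coincide, so \<open>\<integral>(e \<circ> U - e)\<^sup>2 = 0\<close>.
\<close>

lemma cond_exp_invariant:
  assumes "prob_space N" "subalgebra N W" and U: "measure_preserving N U" and UW: "U \<in> measurable W W"
    and h: "h \<in> bounded_borel N" and hU: "AE x in N. h (U x) = h x"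
    and e: "e \<in> borel_measurable W" "e \<in> bounded_borel N"
    and he: "\<And>g. g \<in> borel_measurable W \<Longrightarrow> g \<in> bounded_borel N \<Longrightarrow> (\<integral>x. h x * g x \<partial>N) = (\<integral>x. e x * g x \<partial>N)"
  shows "AE x in N. e (U x) = e x"
proof -
  interpret prob_space N by fact
  have [measurable]: "U \<in> measurable N N" using U by (rule measure_preserving_measurable)
  have eU: "(\<lambda>x. e (U x)) \<in> bounded_borel N" using e(2) by (rule bounded_borel_comp) simp
  have eUW: "(\<lambda>x. e (U x)) \<in> borel_measurable W" using UW e(1) by (rule measurable_compose)
  note [measurable] = h[THEN bounded_borel_measurable] e(2)[THEN bounded_borel_measurable]
  define G where "G = (\<lambda>x. e (U x) - e x)"
  have G: "G \<in> bounded_borel N" unfolding G_def by (intro bounded_borel_closure eU e(2))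
  have "(\<integral>x. e x * e (U x) \<partial>N) = (\<integral>x. h x * e (U x) \<partial>N)"
    by (rule he[OF eUW eU, symmetric])
  also have "\<dots> = (\<integral>x. h (U x) * e (U x) \<partial>N)"
    using hU by (intro integral_cong_AE) auto
  also have "\<dots> = (\<integral>x. h x * e x \<partial>N)"
    by (rule measure_preserving_integral[OF U]) measurable
  also have "\<dots> = (\<integral>x. e x * e x \<partial>N)" by (rule he[OF e])
  finally have cross: "(\<integral>x. e x * e (U x) \<partial>N) = (\<integral>x. e x * e x \<partial>N)" .
  have same: "(\<integral>x. e (U x) * e (U x) \<partial>N) = (\<integral>x. e x * e x \<partial>N)"
    by (rule measure_preserving_integral[OF U]) measurable
  have "(\<integral>x. G x * G x \<partial>N) = (\<integral>x. e (U x) * e (U x) + e x * e x - 2 * (e x * e (U x)) \<partial>N)"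
    by (intro Bochner_Integration.integral_cong) (auto simp: G_def algebra_simps)
  also have "\<dots> = (\<integral>x. e (U x) * e (U x) \<partial>N) + (\<integral>x. e x * e x \<partial>N) - 2 * (\<integral>x. e x * e (U x) \<partial>N)"
    by (simp add: Bochner_Integration.integral_add Bochner_Integration.integral_diff
        integrable_bounded_borel bounded_borel_closure e(2) eU)
  also have "\<dots> = 0" using cross same by simp
  finally have "AE x in N. G x = 0"
    by (rule AE_zero_of_square_integral[OF assms(1) G])
  then show ?thesis by (simp add: G_def)
qed

lemma sets_join_invariant_algebras:
  "sets (join_invariant_algebras N S d) = sigma_sets (space N) (\<Union>i<d. sets (invariant_algebra N (S i)))"
  and space_join_invariant_algebras: "space (join_invariant_algebras N S d) = space N"
  unfolding join_invariant_algebras_def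
  using sets.sets_into_space[of _ "invariant_algebra N (S _)"] by (auto intro!: sets_measure_of space_measure_of)

context commuting_system
begin

abbreviation side :: "nat \<Rightarrow> (bool list \<Rightarrow> 'a) \<Rightarrow> bool list \<Rightarrow> 'a" where "side \<equiv> side_map d T"

abbreviation side_join :: "(bool list \<Rightarrow> 'a) measure" where
  "side_join \<equiv> join_invariant_algebras (box d) side d"

abbreviation zero :: "bool list" where "zero \<equiv> replicate d False"

lemma side_preserving: "i < d \<Longrightarrow> measure_preserving (box d) (side i)"
  unfolding side_map_eq by (rule face_preserving) auto

lemma side_commute_face:
  assumes "i < d" "j < d" "x \<in> space (box d)"
  shows "side i (face_map d (T j) A x) = face_map d (T j) A (side i x)"
  unfolding side_map_eq using assms commute by (intro face_map_commute) (auto simp: space_box)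

lemma commuting_system_side: "commuting_system (box d) side d"
proof -
  interpret B: prob_space "box d" by (rule prob_box) simp
  show ?thesis
  proof
    show "regular_measure (box d)" by (rule regular_box) simp
    show "measure_preserving (box d) (side i)" if "i < d" for i using that by (rule side_preserving)
    show "side i (side j x) = side j (side i x)" if "i < d" "j < d" "x \<in> space (box d)" for i j x
      using side_commute_face[OF that] by (simp add: side_map_eq)
  qed
qed

lemma side_measurable: "i < d \<Longrightarrow> side i \<in> measurable (box d) (box d)"
  using side_preserving by (rule measure_preserving_measurable)

lemma subalgebra_side_join: "subalgebra (box d) side_join"
proof -
  have "sets (invariant_algebra (box d) (side i)) \<subseteq> sets (box d)" if "i < d" for i
    using subalgebra_invariant_algebra[OF side_measurable[OF that]] by (simp add: subalgebra_def)
  then have "sets side_join \<subseteq> sets (box d)"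
    unfolding sets_join_invariant_algebras by (intro sets.sigma_sets_subset) auto
  then show ?thesis by (simp add: subalgebra_def space_join_invariant_algebras)
qed

lemma side_join_measurable:
  fixes h :: "(bool list \<Rightarrow> 'a) \<Rightarrow> real"
  assumes "i < d" "h \<in> borel_measurable (box d)" "AE x in box d. h (side i x) = h x"
  shows "h \<in> borel_measurable side_join"
proof -
  have "h \<in> borel_measurable (invariant_algebra (box d) (side i))"
    using invariant_measurable_iff[OF side_measurable[OF assms(1)] assms(2)] assms(3) by simp
  moreover have "sets (invariant_algebra (box d) (side i)) \<subseteq> sets side_join"
    unfolding sets_join_invariant_algebras using assms(1) by (auto intro: sigma_sets.Basic)
  ultimately show ?thesis
    using measurable_mono[of borel borel "invariant_algebra (box d) (side i)" side_join]
    by (auto simp: space_join_invariant_algebras)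
qed

lemma other_coordinate_measurable:
  assumes "\<epsilon> \<in> cube d" "\<epsilon> \<noteq> zero" "g \<in> bounded_borel M"
  shows "(\<lambda>x. g (x \<epsilon>)) \<in> borel_measurable side_join"
proof -
  obtain i where i: "i < d" "\<epsilon> ! i"
    using assms(1,2) by (auto simp: cube_def list_eq_iff_nth_eq)
  show ?thesis
  proof (rule side_join_measurable[OF i(1)])
    show "(\<lambda>x. g (x \<epsilon>)) \<in> borel_measurable (box d)"
      by (rule bounded_borel_measurable[OF bounded_borel_coord[OF order_refl assms(1,3)]])
    show "AE x in box d. g (side i x \<epsilon>) = g (x \<epsilon>)"
      using i assms(1) by (simp add: side_map_def)
  qed
qed

lemma upper_face_measurable_side_join:
  assumes j: "j < d"
  shows "face_map d (T j) {\<epsilon>. \<epsilon> ! j = True} \<in> measurable side_join side_join" (is "?U \<in> _")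
proof -
  have Ump: "measure_preserving (box d) ?U" by (rule face_preserving[OF order_refl j])
  have U: "?U \<in> measurable (box d) (box d)" using Ump by (rule measure_preserving_measurable)
  have "?U -` A \<inter> space (box d) \<in> sets side_join"
    if i: "i < d" and A: "A \<in> sets (invariant_algebra (box d) (side i))" for i A
  proof -
    have A': "A \<in> sets (box d)" "AE x in box d. side i x \<in> A \<longleftrightarrow> x \<in> A"
      using A by (simp_all add: sets_invariant_algebra[OF side_measurable[OF i]])
    have "AE x in box d. side i (?U x) \<in> A \<longleftrightarrow> ?U x \<in> A"
      using A'(2) by (rule measure_preserving_AE[OF Ump])
    then have "AE x in box d. side i x \<in> ?U -` A \<inter> space (box d) \<longleftrightarrow> x \<in> ?U -` A \<inter> space (box d)"
      using AE_space
    proof eventually_elim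
      case (elim x)
      then show ?case
        using side_commute_face[OF i j elim(2)] measurable_space[OF side_measurable[OF i] elim(2)] by simp
    qed
    then have "?U -` A \<inter> space (box d) \<in> sets (invariant_algebra (box d) (side i))"
      using A'(1) U by (simp add: sets_invariant_algebra[OF side_measurable[OF i]])
    then show ?thesis
      unfolding sets_join_invariant_algebras using i by (auto intro: sigma_sets.Basic)
  qed
  moreover have "?U \<in> space (box d) \<rightarrow> space (box d)" using measurable_space[OF U] by auto
  ultimately show ?thesis
    by (intro measurable_sigma_sets[OF sets_join_invariant_algebras])
       (auto simp: space_join_invariant_algebras dest: sets.sets_into_space[THEN subsetD])
qed

text \<open>
  The function \<open>f(x\<^sub>0)\<close> and the algebra \<open>side_join\<close> are invariant under the transformations of
  the upper faces, which commute with the side transformations; hence so is the conditional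
  expectation.
\<close>

lemma cond_exp_initial_coordinate:
  assumes f: "f \<in> bounded_borel M"
  obtains f' where "f' \<in> bounded_borel M"
    "\<And>h. h \<in> borel_measurable side_join \<Longrightarrow> h \<in> bounded_borel (box d) \<Longrightarrow>
      (\<integral>x. f (x zero) * h x \<partial>box d) = (\<integral>x. f' (x zero) * h x \<partial>box d)"
    "\<exists>e. e \<in> borel_measurable side_join \<and> e \<in> bounded_borel (box d) \<and> (AE x in box d. e x = f' (x zero))"
proof -
  have fb: "(\<lambda>x. f (x zero)) \<in> bounded_borel (box d)" using f by (intro bounded_borel_coord) auto
  obtain e where e: "e \<in> borel_measurable side_join" "e \<in> bounded_borel (box d)"
      "\<And>h. h \<in> borel_measurable side_join \<Longrightarrow> h \<in> bounded_borel (box d) \<Longrightarrow>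
        (\<integral>x. f (x zero) * h x \<partial>box d) = (\<integral>x. e x * h x \<partial>box d)"
    using bounded_cond_exp_version[OF prob_box[OF order_refl] subalgebra_side_join fb] by blast
  have inv: "AE x in box d. e (face_map d (T j) {\<epsilon>. \<epsilon> ! j = True} x) = e x" if j: "j < d" for j
  proof (rule cond_exp_invariant[OF prob_box[OF order_refl] subalgebra_side_join
        face_preserving[OF order_refl j] upper_face_measurable_side_join[OF j] fb _ e])
    show "AE x in box d. f (face_map d (T j) {\<epsilon>. \<epsilon> ! j = True} x zero) = f (x zero)"
      using j by (simp add: face_map_apply)
  qed
  obtain f' where f': "f' \<in> bounded_borel M" "AE x in box d. e x = f' (x zero)"
    using upper_invariant_function[OF order_refl e(2) inv] by blast
  show thesis
  proof (rule that[OF f'(1)])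
    fix h assume h: "h \<in> borel_measurable side_join" "h \<in> bounded_borel (box d)"
    have "(\<lambda>x. f' (x zero)) \<in> bounded_borel (box d)" using f'(1) by (intro bounded_borel_coord) auto
    then show "(\<integral>x. f (x zero) * h x \<partial>box d) = (\<integral>x. f' (x zero) * h x \<partial>box d)"
      unfolding e(3)[OF h] using f'(2) e(2) h(2)
      by (intro integral_cong_AE borel_measurable_times bounded_borel_measurable) auto
  next
    show "\<exists>e. e \<in> borel_measurable side_join \<and> e \<in> bounded_borel (box d) \<and> (AE x in box d. e x = f' (x zero))"
      using e f' by blast
  qed
qed

lemma box_form_side_coordinate:
  assumes f: "f \<in> bounded_borel M"
  shows "box_form (box d) side d (\<lambda>_ x. f (x zero)) = box_form M T d (\<lambda>_. f)"
proof (rule box_form_factor[OF commuting_system_axioms commuting_system_side order_refl])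
  show "(\<lambda>x. x zero) \<in> measurable (box d) M" by (rule coord_measurable) auto
  show "distr (box d) M (\<lambda>x. x zero) = M" by (rule distr_box) auto
  show "side i x zero = T i (x zero)" if "i < d" for i x using that by (simp add: side_map_def)
qed (rule f)

text \<open>
  A power of the seminorm of \<open>f\<close> is the integral of \<open>f(x\<^sub>0)\<close> against a function of the other coordinates, which
  is measurable with respect to \<open>side_join\<close>; so it vanishes, over \<open>X\<close> and over \<open>X\<^sup>*\<close>.
\<close>

lemma box_form_orthogonal:
  assumes f: "f \<in> bounded_borel M" and d: "0 < d"
    and orth: "\<And>h. h \<in> borel_measurable side_join \<Longrightarrow> h \<in> bounded_borel (box d) \<Longrightarrow>
      (\<integral>x. f (x zero) * h x \<partial>box d) = 0"
    and F: "\<And>\<eta>. F \<eta> \<in> bounded_borel (box d)" and F0: "F zero = (\<lambda>x. f (x zero))"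
  shows "box_form (box d) side d F = 0"
proof -
  interpret side: commuting_system "box d" side d by (rule commuting_system_side)
  have h: "(\<lambda>x. \<Prod>\<epsilon>\<in>cube d - {zero}. f (x \<epsilon>)) \<in> borel_measurable side_join"
    using f by (intro borel_measurable_prod other_coordinate_measurable) auto
  have "box_form M T d (\<lambda>_. f) = (\<integral>x. f (x zero) * (\<Prod>\<epsilon>\<in>cube d - {zero}. f (x \<epsilon>)) \<partial>box d)"
    unfolding box_form_def by (simp add: prod.remove[of "cube d" zero])
  also have "\<dots> = 0"
    using f by (intro orth h bounded_borel_cube_prod) auto
  finally have "box_form (box d) side d (\<lambda>_. F zero) = 0"
    unfolding F0 using box_form_side_coordinate[OF f] by simp
  then show ?thesis by (rule side.box_form_vanishes[OF d F])
qed

text \<open>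
  A function of a coordinate \<open>\<epsilon>\<close> with \<open>\<epsilon>\<^sub>i = 1\<close> is invariant under the \<open>i\<close>-th side
  transformation, so in the cube over \<open>X\<^sup>*\<close> it takes the same value at the initial vertex as at
  the neighbour in direction \<open>i\<close>. All such factors can be moved away from the initial vertex.
\<close>

lemma box_form_orthogonal_product:
  assumes f: "f \<in> bounded_borel M" and d: "0 < d"
    and orth: "\<And>h. h \<in> borel_measurable side_join \<Longrightarrow> h \<in> bounded_borel (box d) \<Longrightarrow>
      (\<integral>x. f (x zero) * h x \<partial>box d) = 0"
    and g: "\<And>\<epsilon>. g \<epsilon> \<in> bounded_borel M" and F: "F \<in> bounded_borel (box d)"
  shows "(\<integral>z. f (z zero zero) * (\<Prod>\<epsilon>\<in>cube d - {zero}. g \<epsilon> (z zero \<epsilon>)) * (\<Prod>\<eta>\<in>cube d - {zero}. F (z \<eta>))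
    \<partial>box_measure (box d) side d) = 0"
proof -
  interpret side: commuting_system "box d" side d by (rule commuting_system_side)
  \<comment> \<open>A neighbour of the vertex \<open>0\<close> at which the coordinate \<open>\<epsilon>\<close> is the same as at \<open>0\<close>.\<close>
  define v where "v \<epsilon> = zero[(SOME i. i < d \<and> \<epsilon> ! i) := True]" for \<epsilon>
  have v: "v \<epsilon> \<in> cube d - {zero} \<and> (AE z in side.box d. g \<epsilon> (z zero \<epsilon>) = g \<epsilon> (z (v \<epsilon>) \<epsilon>))"
    if \<epsilon>: "\<epsilon> \<in> cube d - {zero}" for \<epsilon>
  proof -
    have "\<exists>i. i < d \<and> \<epsilon> ! i" using \<epsilon> by (auto simp: cube_def list_eq_iff_nth_eq)
    then have "(SOME i. i < d \<and> \<epsilon> ! i) < d \<and> \<epsilon> ! (SOME i. i < d \<and> \<epsilon> ! i)" by (rule someI_ex)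
    then obtain i where i: "i < d" "\<epsilon> ! i" "v \<epsilon> = zero[i := True]" by (auto simp: v_def)
    have "v \<epsilon> ! i" using i by simp
    then have "v \<epsilon> \<noteq> zero" using i(1) by auto
    moreover have "v \<epsilon> \<in> cube d" by (simp add: i(3) cube_def)
    moreover have "AE z in side.box d. g \<epsilon> (z zero \<epsilon>) = g \<epsilon> (z (v \<epsilon>) \<epsilon>)"
      unfolding i(3)
    proof (rule side.invariant_function_coordinates[where h = "\<lambda>x. g \<epsilon> (x \<epsilon>)"])
      show "(\<lambda>x. g \<epsilon> (x \<epsilon>)) \<in> bounded_borel (box d)" using \<epsilon> g by (intro bounded_borel_coord) auto
      show "AE x in box d. g \<epsilon> (side i x \<epsilon>) = g \<epsilon> (x \<epsilon>)" using i \<epsilon> by (simp add: side_map_def)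
    qed (use i in auto)
    ultimately show ?thesis by blast
  qed
  define G where "G \<eta> = (if \<eta> = zero then (\<lambda>x. f (x zero))
    else (\<lambda>x. (\<Prod>\<epsilon>\<in>{\<epsilon> \<in> cube d - {zero}. v \<epsilon> = \<eta>}. g \<epsilon> (x \<epsilon>)) * F x))" for \<eta>
  have G: "G \<eta> \<in> bounded_borel (box d)" for \<eta>
    using f g F unfolding G_def
    by (cases "\<eta> = zero") (auto intro!: bounded_borel_coord bounded_borel_mult bounded_borel_cube_prod)
  have "AE z in side.box d. \<forall>\<epsilon>\<in>cube d - {zero}. g \<epsilon> (z zero \<epsilon>) = g \<epsilon> (z (v \<epsilon>) \<epsilon>)"
    using v by (subst AE_finite_all) auto
  then have "AE z in side.box d. f (z zero zero) * (\<Prod>\<epsilon>\<in>cube d - {zero}. g \<epsilon> (z zero \<epsilon>)) * (\<Prod>\<eta>\<in>cube d - {zero}. F (z \<eta>))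
      = (\<Prod>\<eta>\<in>cube d. G \<eta> (z \<eta>))"
  proof eventually_elim
    case (elim z)
    have "(\<Prod>\<epsilon>\<in>cube d - {zero}. g \<epsilon> (z zero \<epsilon>)) = (\<Prod>\<epsilon>\<in>cube d - {zero}. g \<epsilon> (z (v \<epsilon>) \<epsilon>))"
      using elim by (intro prod.cong) auto
    also have "\<dots> = (\<Prod>\<eta>\<in>cube d - {zero}. \<Prod>\<epsilon>\<in>{\<epsilon> \<in> cube d - {zero}. v \<epsilon> = \<eta>}. g \<epsilon> (z (v \<epsilon>) \<epsilon>))"
      using v by (intro prod.group[symmetric]) auto
    also have "\<dots> = (\<Prod>\<eta>\<in>cube d - {zero}. \<Prod>\<epsilon>\<in>{\<epsilon> \<in> cube d - {zero}. v \<epsilon> = \<eta>}. g \<epsilon> (z \<eta> \<epsilon>))"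
      by (intro prod.cong) auto
    finally have "f (z zero zero) * (\<Prod>\<epsilon>\<in>cube d - {zero}. g \<epsilon> (z zero \<epsilon>)) * (\<Prod>\<eta>\<in>cube d - {zero}. F (z \<eta>))
        = G zero (z zero) * (\<Prod>\<eta>\<in>cube d - {zero}. G \<eta> (z \<eta>))"
      by (simp add: G_def prod.distrib)
    then show ?case by (simp add: prod.remove[of "cube d" zero])
  qed
  then have "(\<integral>z. f (z zero zero) * (\<Prod>\<epsilon>\<in>cube d - {zero}. g \<epsilon> (z zero \<epsilon>)) * (\<Prod>\<eta>\<in>cube d - {zero}. F (z \<eta>))
      \<partial>side.box d) = box_form (box d) side d G"
    unfolding box_form_def
  proof (intro integral_cong_AE)
    have "(\<lambda>x. f (x zero) * (\<Prod>\<epsilon>\<in>cube d - {zero}. g \<epsilon> (x \<epsilon>))) \<in> bounded_borel (box d)"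
      using f g by (intro bounded_borel_mult bounded_borel_coord bounded_borel_cube_prod) auto
    then have "(\<lambda>z. f (z zero zero) * (\<Prod>\<epsilon>\<in>cube d - {zero}. g \<epsilon> (z zero \<epsilon>))) \<in> bounded_borel (side.box d)"
      using side.bounded_borel_coord[OF order_refl replicate_in_cube] by fast
    moreover have "(\<lambda>z. \<Prod>\<eta>\<in>cube d - {zero}. F (z \<eta>)) \<in> bounded_borel (side.box d)"
      using F by (intro side.bounded_borel_cube_prod) auto
    ultimately show "(\<lambda>z. f (z zero zero) * (\<Prod>\<epsilon>\<in>cube d - {zero}. g \<epsilon> (z zero \<epsilon>)) * (\<Prod>\<eta>\<in>cube d - {zero}. F (z \<eta>)))
        \<in> borel_measurable (side.box d)"
      by (rule bounded_borel_mult[THEN bounded_borel_measurable])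
    show "(\<lambda>z. \<Prod>\<eta>\<in>cube d. G \<eta> (z \<eta>)) \<in> borel_measurable (side.box d)"
      using G by (intro bounded_borel_measurable side.bounded_borel_cube_prod) auto
  qed
  also have "\<dots> = 0"
  proof (rule box_form_orthogonal[OF f d _ G])
    show "(\<integral>x. f (x zero) * h x \<partial>box d) = 0"
      if "h \<in> borel_measurable side_join" "h \<in> bounded_borel (box d)" for h
      using that by (rule orth)
    show "G zero = (\<lambda>x. f (x zero))" by (simp add: G_def)
  qed
  finally show ?thesis .
qed

text \<open>
  The dual function \<open>D\<close> of \<open>F\<close> is measurable with respect to \<open>side_join\<close>: it suffices to
  test the difference of \<open>D\<close> and its conditional expectation \<open>E\<close> against products \<open>g(x\<^sub>0) H\<close>, where
  \<open>H\<close> depends on the other coordinates. In \<open>g = f' + f\<close> with \<open>f'(x\<^sub>0)\<close> the conditional expectation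
  of \<open>g(x\<^sub>0)\<close>, the first summand yields a test function measurable with respect to \<open>side_join\<close>,
  on which \<open>D\<close> and \<open>E\<close> agree; the second one is annihilated by both.
\<close>

lemma dual_function_side_join:
  assumes d: "0 < d" and F: "F \<in> bounded_borel (box d)" and D: "D \<in> bounded_borel (box d)"
    and dual: "\<And>a. a \<in> bounded_borel (box d) \<Longrightarrow>
      (\<integral>z. (\<Prod>\<eta>\<in>cube d - {zero}. F (z \<eta>)) * a (z zero) \<partial>box_measure (box d) side d) = (\<integral>x. D x * a x \<partial>box d)"
  obtains E where "E \<in> borel_measurable side_join" "E \<in> bounded_borel (box d)" "AE x in box d. D x = E x"
proof -
  interpret B: prob_space "box d" by (rule prob_box) simp
  obtain E where E: "E \<in> borel_measurable side_join" "E \<in> bounded_borel (box d)"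
      "\<And>h. h \<in> borel_measurable side_join \<Longrightarrow> h \<in> bounded_borel (box d) \<Longrightarrow>
        (\<integral>x. D x * h x \<partial>box d) = (\<integral>x. E x * h x \<partial>box d)"
    using bounded_cond_exp_version[OF prob_box[OF order_refl] subalgebra_side_join D] by blast
  define G where "G = (\<lambda>x. D x - E x)"
  have G: "G \<in> bounded_borel (box d)" unfolding G_def by (intro bounded_borel_diff D E)
  let ?\<R> = "{(\<Pi>\<^sub>E \<epsilon>\<in>cube d. A \<epsilon>) |A. A \<in> cube d \<rightarrow> sets M}"
  have sp: "space (box d) = (\<Pi>\<^sub>E \<epsilon>\<in>cube d. space M)"
    by (simp add: space_box space_PiM)
  have "AE x in box d. G x = 0"
  proof (rule AE_zero_on_generator[OF prob_box[OF order_refl] G, of ?\<R>])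
    show "Int_stable ?\<R>"
    proof (rule Int_stableI)
      fix a b assume "a \<in> ?\<R>" "b \<in> ?\<R>"
      then obtain A B where "a = (\<Pi>\<^sub>E \<epsilon>\<in>cube d. A \<epsilon>)" "b = (\<Pi>\<^sub>E \<epsilon>\<in>cube d. B \<epsilon>)"
          "A \<in> cube d \<rightarrow> sets M" "B \<in> cube d \<rightarrow> sets M" by blast
      then show "a \<inter> b \<in> ?\<R>" by (auto simp: PiE_Int intro!: exI[of _ "\<lambda>\<epsilon>. A \<epsilon> \<inter> B \<epsilon>"])
    qed
    show "?\<R> \<subseteq> Pow (space (box d))"
    proof safe
      fix x A assume "A \<in> cube d \<rightarrow> sets M" "x \<in> (\<Pi>\<^sub>E \<epsilon>\<in>cube d. A \<epsilon>)"
      then show "x \<in> space (box d)"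
        using sets.sets_into_space[of "A _" M] by (force simp: sp PiE_iff Pi_iff)
    qed
    show "space (box d) \<in> ?\<R>" unfolding sp by (auto intro!: exI[of _ "\<lambda>_. space M"])
    show "sets (box d) = sigma_sets (space (box d)) ?\<R>"
      unfolding sp sets_box[OF order_refl] sets_PiM prod_algebra_eq_finite[OF finite_cube] ..
    fix R assume "R \<in> ?\<R>"
    then obtain A where R: "R = (\<Pi>\<^sub>E \<epsilon>\<in>cube d. A \<epsilon>)" and A: "\<And>\<epsilon>. \<epsilon> \<in> cube d \<Longrightarrow> A \<epsilon> \<in> sets M" by blast
    define g where "g \<epsilon> = (indicator (if \<epsilon> \<in> cube d then A \<epsilon> else {}) :: 'a \<Rightarrow> real)" for \<epsilon>
    have g: "g \<epsilon> \<in> bounded_borel M" for \<epsilon> using A by (auto simp: g_def)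
    define H where "H = (\<lambda>x. \<Prod>\<epsilon>\<in>cube d - {zero}. g \<epsilon> (x \<epsilon>))"
    have H: "H \<in> borel_measurable side_join" "H \<in> bounded_borel (box d)"
      unfolding H_def using g
      by (auto intro!: borel_measurable_prod other_coordinate_measurable bounded_borel_cube_prod)
    obtain f' where f': "f' \<in> bounded_borel M"
        "\<And>h. h \<in> borel_measurable side_join \<Longrightarrow> h \<in> bounded_borel (box d) \<Longrightarrow>
          (\<integral>x. g zero (x zero) * h x \<partial>box d) = (\<integral>x. f' (x zero) * h x \<partial>box d)"
        "\<exists>e. e \<in> borel_measurable side_join \<and> e \<in> bounded_borel (box d) \<and> (AE x in box d. e x = f' (x zero))"
      using cond_exp_initial_coordinate[OF g[of zero]] by blast
    obtain e where e: "e \<in> borel_measurable side_join" "e \<in> bounded_borel (box d)" "AE x in box d. e x = f' (x zero)"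
      using f'(3) by blast
    have coord: "(\<lambda>x. u (x zero)) \<in> bounded_borel (box d)" if "u \<in> bounded_borel M" for u
      using that by (intro bounded_borel_coord) auto
    note meas = bounded_borel_measurable borel_measurable_times bounded_borel_mult coord f'(1) g D E(2) H(2) e(2)
    define f where "f = (\<lambda>x. g zero x - f' x)"
    have f: "f \<in> bounded_borel M" unfolding f_def by (intro bounded_borel_diff g f')
    have orth: "(\<integral>x. f (x zero) * h x \<partial>box d) = 0"
      if h: "h \<in> borel_measurable side_join" "h \<in> bounded_borel (box d)" for h
    proof -
      have "(\<integral>x. f (x zero) * h x \<partial>box d) = (\<integral>x. g zero (x zero) * h x - f' (x zero) * h x \<partial>box d)"
        by (simp add: f_def left_diff_distrib)
      also have "\<dots> = (\<integral>x. g zero (x zero) * h x \<partial>box d) - (\<integral>x. f' (x zero) * h x \<partial>box d)"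
        by (intro Bochner_Integration.integral_diff B.integrable_bounded_borel bounded_borel_mult coord g f' h)
      finally show ?thesis using f'(2)[OF h] by simp
    qed
    have small_D: "(\<integral>x. D x * (f (x zero) * H x) \<partial>box d) = 0"
    proof -
      have "(\<integral>x. D x * (f (x zero) * H x) \<partial>box d)
          = (\<integral>z. (\<Prod>\<eta>\<in>cube d - {zero}. F (z \<eta>)) * (f (z zero zero) * H (z zero)) \<partial>box_measure (box d) side d)"
        by (rule dual[symmetric]) (intro bounded_borel_mult coord f H)
      also have "\<dots> = (\<integral>z. f (z zero zero) * (\<Prod>\<epsilon>\<in>cube d - {zero}. g \<epsilon> (z zero \<epsilon>)) * (\<Prod>\<eta>\<in>cube d - {zero}. F (z \<eta>))
          \<partial>box_measure (box d) side d)"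
        by (simp add: H_def mult_ac)
      also have "\<dots> = 0" by (rule box_form_orthogonal_product[OF f d orth g F])
      finally show ?thesis .
    qed
    have small_E: "(\<integral>x. E x * (f (x zero) * H x) \<partial>box d) = 0"
      using orth[of "\<lambda>x. E x * H x"] E(1,2) H by (simp add: bounded_borel_mult mult_ac)
    have main: "(\<integral>x. D x * (f' (x zero) * H x) \<partial>box d) = (\<integral>x. E x * (f' (x zero) * H x) \<partial>box d)"
    proof -
      have "(\<integral>x. D x * (f' (x zero) * H x) \<partial>box d) = (\<integral>x. D x * (e x * H x) \<partial>box d)"
        using e(3) by (intro integral_cong_AE) (auto intro!: meas)
      also have "\<dots> = (\<integral>x. E x * (e x * H x) \<partial>box d)"
        using e(1,2) H by (intro E(3)) (auto intro: bounded_borel_mult)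
      also have "\<dots> = (\<integral>x. E x * (f' (x zero) * H x) \<partial>box d)"
        using e(3) by (intro integral_cong_AE) (auto intro!: meas)
      finally show ?thesis .
    qed
    have split: "(\<integral>x. V x * indicator R x \<partial>box d)
        = (\<integral>x. V x * (f (x zero) * H x) \<partial>box d) + (\<integral>x. V x * (f' (x zero) * H x) \<partial>box d)"
      if V: "V \<in> bounded_borel (box d)" for V
    proof -
      have "(\<integral>x. V x * indicator R x \<partial>box d)
          = (\<integral>x. V x * (f (x zero) * H x) + V x * (f' (x zero) * H x) \<partial>box d)"
      proof (intro Bochner_Integration.integral_cong refl)
        fix x assume x: "x \<in> space (box d)"
        have "indicator R x = (\<Prod>\<epsilon>\<in>cube d. g \<epsilon> (x \<epsilon>))"
          using x by (auto simp: R g_def indicator_def sp PiE_iff prod.neutral intro!: prod_zero[symmetric])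
        also have "\<dots> = g zero (x zero) * H x"
          by (simp add: H_def prod.remove[of "cube d" zero])
        finally show "V x * indicator R x = V x * (f (x zero) * H x) + V x * (f' (x zero) * H x)"
          by (simp add: f_def algebra_simps)
      qed
      also have "\<dots> = (\<integral>x. V x * (f (x zero) * H x) \<partial>box d) + (\<integral>x. V x * (f' (x zero) * H x) \<partial>box d)"
        by (intro Bochner_Integration.integral_add B.integrable_bounded_borel bounded_borel_mult coord V f f' H)
      finally show ?thesis .
    qed
    have RN: "R \<in> sets (box d)"
      unfolding R sets_box[OF order_refl] using A by (intro sets_PiM_I_finite) auto
    have "(\<integral>x. G x * indicator R x \<partial>box d) = (\<integral>x. D x * indicator R x - E x * indicator R x \<partial>box d)"
      by (simp add: G_def left_diff_distrib)
    also have "\<dots> = (\<integral>x. D x * indicator R x \<partial>box d) - (\<integral>x. E x * indicator R x \<partial>box d)"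
      by (intro Bochner_Integration.integral_diff B.integrable_bounded_borel bounded_borel_closure D E RN)
    also have "\<dots> = 0"
      unfolding split[OF D] split[OF E(2)] small_D small_E main by simp
    finally show "(\<integral>x. G x * indicator R x \<partial>box d) = 0" .
  qed
  then have "AE x in box d. D x = E x" by (simp add: G_def)
  then show thesis using that E by blast
qed

end

section \<open>The box seminorm of the side transformations\<close>

theorem theorem2:
  fixes M :: "'a measure"
    and T :: "nat \<Rightarrow> 'a \<Rightarrow> 'a"
    and d :: nat
    and F :: "(bool list \<Rightarrow> 'a) \<Rightarrow> real"
  assumes "d \<ge> 1"
    and "standard_prob_space M"
    and "\<And>i. i < d \<Longrightarrow> mp_automorphism M (T i)"
    and "\<And>i j x. i < d \<Longrightarrow> j < d \<Longrightarrow> x \<in> space M \<Longrightarrow> T i (T j x) = T j (T i x)"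
    and "F \<in> borel_measurable (box_measure M T d)"
    and "\<exists>C. AE x in box_measure M T d. \<bar>F x\<bar> \<le> C"
    and "AE x in box_measure M T d.
           real_cond_exp (box_measure M T d)
             (join_invariant_algebras (box_measure M T d) (side_map d T) d) F x = 0"
  shows "box_seminorm (box_measure M T d) (side_map d T) d F = 0"
proof -
  interpret prob_space M using assms(2) by (simp add: standard_prob_space_def)
  interpret commuting_system M T d
  proof
    show "regular_measure M" using assms(2) by (rule regular_measure_standard)
    show "measure_preserving M (T i)" if "i < d" for i
      using assms(3)[OF that] by (simp add: mp_automorphism_def measure_preserving_def)
  qed (rule assms(4))
  interpret side: commuting_system "box d" side d by (rule commuting_system_side)
  have d: "0 < d" using assms(1) by simp
  obtain C where C: "AE x in box d. \<bar>F x\<bar> \<le> C" using assms(6) by blast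
  \<comment> \<open>\<open>F\<close> is bounded almost everywhere only; a clipped version is bounded everywhere.\<close>
  define F' where "F' = (\<lambda>x. max (- C) (min C (F x)))"
  have "F' \<in> borel_measurable (box d)" unfolding F'_def using assms(5) by measurable
  then have F': "F' \<in> bounded_borel (box d)"
    by (rule bounded_borelI[where C = "\<bar>C\<bar>"]) (auto simp: F'_def)
  have FF': "AE x in box d. F x = F' x"
    using C by eventually_elim (auto simp: F'_def)
  obtain EF where EF: "AE x in box d. real_cond_exp (box d) side_join F' x = EF x"
      "EF \<in> bounded_borel (box d)"
      "\<And>h. h \<in> borel_measurable side_join \<Longrightarrow> h \<in> bounded_borel (box d) \<Longrightarrow>
        (\<integral>x. F' x * h x \<partial>box d) = (\<integral>x. EF x * h x \<partial>box d)"
    using bounded_cond_exp_version[OF prob_box[OF order_refl] subalgebra_side_join F'] by blast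
  interpret sub_prob "box d" side_join
    using prob_box[OF order_refl] subalgebra_side_join by (simp add: sub_prob_def sub_prob_axioms_def)
  have "AE x in box d. cexp F x = cexp F' x"
    using FF' assms(5) bounded_borel_measurable[OF F'] by (rule real_cond_exp_cong)
  then have EF0: "AE x in box d. EF x = 0"
    using EF(1) assms(7) by eventually_elim simp
  let ?H = "\<lambda>z. \<Prod>\<eta>\<in>cube d - {zero}. F' (z \<eta>)"
  have H: "?H \<in> bounded_borel (side.box d)"
    using F' by (intro side.bounded_borel_cube_prod) auto
  obtain D where D: "D \<in> bounded_borel (box d)"
      "\<And>a. a \<in> bounded_borel (box d) \<Longrightarrow> (\<integral>z. ?H z * a (z zero) \<partial>side.box d) = (\<integral>x. D x * a x \<partial>box d)"
    using conditional_expectation_along_map[OF side.prob_box[OF order_refl] prob_box[OF order_refl]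
        side.coord_measurable[OF order_refl replicate_in_cube]
        side.distr_box[OF order_refl replicate_in_cube] H] by blast
  obtain E where E: "E \<in> borel_measurable side_join" "E \<in> bounded_borel (box d)" "AE x in box d. D x = E x"
    using dual_function_side_join[OF d F' D] by blast
  have "AE z in side.box d. \<forall>\<eta>\<in>cube d. F (z \<eta>) = F' (z \<eta>)"
    by (subst AE_finite_all) (auto intro: side.AE_coord[OF order_refl _ FF'])
  then have "AE z in side.box d. (\<Prod>\<eta>\<in>cube d. F (z \<eta>)) = ?H z * F' (z zero)"
    by eventually_elim (simp add: prod.remove[of "cube d" zero] mult.commute)
  moreover have "(\<lambda>z. \<Prod>\<eta>\<in>cube d. F (z \<eta>)) \<in> borel_measurable (side.box d)"
    by (intro borel_measurable_prod measurable_compose[OF side.coord_measurable[OF order_refl] assms(5)])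
  moreover have "(\<lambda>z. ?H z * F' (z zero)) \<in> borel_measurable (side.box d)"
    using F' by (intro bounded_borel_measurable bounded_borel_mult H side.bounded_borel_coord) auto
  ultimately have "(\<integral>z. (\<Prod>\<eta>\<in>cube d. F (z \<eta>)) \<partial>side.box d) = (\<integral>z. ?H z * F' (z zero) \<partial>side.box d)"
    by (intro integral_cong_AE)
  also have "\<dots> = (\<integral>x. D x * F' x \<partial>box d)" by (rule D(2)[OF F'])
  also have "\<dots> = (\<integral>x. F' x * E x \<partial>box d)"
    using E(3) D(1) E(2) F'
    by (intro integral_cong_AE borel_measurable_times bounded_borel_measurable) auto
  also have "\<dots> = (\<integral>x. EF x * E x \<partial>box d)" by (rule EF(3)[OF E(1,2)])
  also have "\<dots> = 0" using EF0 by (intro integral_eq_zero_AE) auto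
  finally show ?thesis by (simp add: box_seminorm_def)
qed

end
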